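(* Let $p$ be an odd prime, let $H$ be one of the groups $H_1, H_2$, and let $\mathcal{A}$ be a non-commutative $p$-S-ring over $H$ such that, with $L := \mathbf{O}^{\theta}(\mathcal{A})$, (A) $|T| = p$ for each $T \in \mathrm{Bsets}(\mathcal{A}) \setminus \mathrm{Bsets}(\mathcal{A}_L)$, and (B) $|\{ \mathrm{St}_R(T) \mid T \in \mathrm{Bsets}(\mathcal{A}) \setminus \mathrm{Bsets}(\mathcal{A}_L) \}| = p-1$. Let $T_1, T_2, \dots, T_{p-1}$ be elements of $\mathrm{Bsets}(\mathcal{A}) \setminus \mathrm{Bsets}(\mathcal{A}_L)$ such that $\mathrm{St}_R(T_i) \neq \mathrm{St}_R(T_j)$ for distinct $1 \le i, j \le p-1$. Then $\mathcal{A}$ is Schurian if and only if there exists a nontrivial element $\sigma \in \Gamma_1$ such that $T_i \sim_\sigma T_j$ for all $1 \le i, j \le p-1$.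
   Context: Groups: $H_1 = \langle a, b \mid a^{p^2} = b^p = 1,\ ab = ba^{p+1} \rangle$ and $H_2 = \langle a, b, c \mid a^p = b^p = c^p = 1,\ [a,b]=c,\ [a,c]=[b,c]=1 \rangle$ (the two non-abelian groups of order $p^3$ up to isomorphism). S-rings: For a finite group $H$ and nonempty $T \subseteq H$, put $\underline{T} := \sum_{t \in T} t \in \mathbb{Q}H$. A subalgebra $\mathcal{A}$ of $\mathbb{Q}H$ is an S-ring (Schur ring) over $H$ if there is a partition $\mathrm{Bsets}(\mathcal{A}) = \{T_0, \dots, T_r\}$ of $H$ with $T_0 = \{1_H\}$, with $T_i^{-1} := \{t^{-1} \mid t \in T_i\} \in \mathrm{Bsets}(\mathcal{A})$ for all $i$, and with $\{\underline{T_i}\}$ a linear basis of $\mathcal{A}$. An S-ring over a $p$-group is a $p$-S-ring if every element of $\mathrm{Bsets}(\mathcal{A})$ has size a power of $p$. Schurian: For a subgroup $G \le \mathrm{Sym}(H)$ containing the right regular representation of $H$, let $V(H, G_{1_H})$ be the span of the $\underline{T}$, $T$ running over the orbits on $H$ of the stabilizer $G_{1_H}$. An S-ring $\mathcal{A}$ over $H$ is Schurian if $\mathcal{A} = V(H, G_{1_H})$ for some such $G$. Further notation: $\mathbf{O}^{\theta}(\mathcal{A})$ is the subgroup of $H$ generated by all sets $T^{-1}T$, $T \in \mathrm{Bsets}(\mathcal{A})$; $\mathrm{Bsets}(\mathcal{A}_L) = \{T \in \mathrm{Bsets}(\mathcal{A}) \mid T \subseteq L\}$; $\mathrm{St}_R(T)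 = \{h \in H \mid Th = T\}$. Under the standing assumptions it is known that $L = \{h \in H \mid \{h\} \in \mathrm{Bsets}(\mathcal{A})\} \cong C_p \times C_p$. For $T \subseteq H$ let $R_H(T) = \{(h, th) \mid h \in H, t \in T\}$; the sets $R_H(T)$, $T \in \mathrm{Bsets}(\mathcal{A})$, partition $H \times H$, and $r(\beta, \gamma)$ denotes the one containing $(\beta,\gamma)$. $\Gamma_1$ is the set of permutations $\sigma$ of $H$ such that (i) $L$ is the set of fixed points of $\sigma$; (ii) for each $T \in \mathrm{Bsets}(\mathcal{A})$ of size $p$, $\sigma$ is a $p$-cycle on $T$ (it maps $T$ to itself and acts on $T$ as a $p$-cycle) such that $r(\beta,\gamma) = r(\beta^\sigma, \gamma^\sigma)$ for each $(\beta,\gamma) \in T \times T$. For $T, T' \in \mathrm{Bsets}(\mathcal{A})$ and $\sigma \in \Gamma_1$, write $T \sim_\sigma T'$ ($T$ and $T'$ are compatible with respect to $\sigma$) if $r(\beta,\gamma) = r(\beta^\sigma,\gamma^\sigma)$ for each $(\beta,\gamma) \in T \times T'$. *)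

theory Defs
  imports
    "HOL-Algebra.Algebra"
    "HOL-Combinatorics.Orbits"
    "HOL-Computational_Algebra.Primes"
    "HOL-Library.Disjoint_Sets"
    "HOL-Library.Function_Algebras"
begin

section \<open>Groups given by generators and relations\<close>

text \<open>
  A word is a list of letters; \<^term>\<open>(x, True)\<close> stands for the generator \<^term>\<open>x\<close> and
  \<^term>\<open>(x, False)\<close> for its inverse. The generators are all elements of the type \<^typ>\<open>'g\<close>,
  and a pair \<^term>\<open>(l, r)\<close> of words stands for the relation \<open>l = r\<close>.
\<close>

type_synonym 'g word = "('g \<times> bool) list"

inductive pres_eq :: "('g word \<times> 'g word) set \<Rightarrow> 'g word \<Rightarrow> 'g word \<Rightarrow> bool"
  for R :: "('g word \<times> 'g word) set"
where
  pres_refl: "pres_eq R w w"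
| pres_sym: "pres_eq R v w \<Longrightarrow> pres_eq R w v"
| pres_trans: "pres_eq R u v \<Longrightarrow> pres_eq R v w \<Longrightarrow> pres_eq R u w"
| pres_cancel: "pres_eq R (u @ [(x, s), (x, \<not> s)] @ v) (u @ v)"
| pres_rel: "(l, r) \<in> R \<Longrightarrow> pres_eq R (u @ l @ v) (u @ r @ v)"

definition presented_group :: "('g word \<times> 'g word) set \<Rightarrow> 'g word set monoid" where
  "presented_group R =
     (let E = {(v, w). pres_eq R v w} in
       \<lparr>carrier = UNIV // E,
        monoid.mult = (\<lambda>U V. \<Union>u\<in>U. \<Union>v\<in>V. E `` {u @ v}),
        one = E `` {[]}\<rparr>)"

lemma equiv_pres_eq: "equiv UNIV {(v, w). pres_eq R v w}"
  by (rule equivI) (auto simp: refl_on_def sym_def trans_def intro: pres_eq.intros)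

lemma pres_eq_append_right: "pres_eq R v w \<Longrightarrow> pres_eq R (v @ y) (w @ y)"
proof (induction rule: pres_eq.induct)
  case (pres_cancel u x s v)
  show ?case using pres_eq.pres_cancel[of R u x s "v @ y"] by simp
next
  case (pres_rel l r u v)
  then show ?case using pres_eq.pres_rel[of l r R u "v @ y"] by simp
qed (blast intro: pres_eq.intros)+

lemma pres_eq_append_left: "pres_eq R v w \<Longrightarrow> pres_eq R (y @ v) (y @ w)"
proof (induction rule: pres_eq.induct)
  case (pres_cancel u x s v)
  show ?case using pres_eq.pres_cancel[of R "y @ u" x s v] by simp
next
  case (pres_rel l r u v)
  then show ?case using pres_eq.pres_rel[of l r R "y @ u" v] by simp
qed (blast intro: pres_eq.intros)+

lemma pres_eq_inverse: "pres_eq R (map (apsnd Not) (rev w) @ w) []"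
proof (induction w)
  case Nil
  show ?case by (simp add: pres_refl)
next
  case (Cons l w)
  obtain x s where l: "l = (x, s)" by fastforce
  have "pres_eq R (map (apsnd Not) (rev w) @ [(x, \<not> s), (x, \<not> \<not> s)] @ w)
          (map (apsnd Not) (rev w) @ w)"
    by (rule pres_cancel)
  then show ?case using Cons l by (auto intro: pres_trans)
qed

lemma group_presented_group: "group (presented_group R)"
proof -
  define E where "E = {(v, w). pres_eq R v w}"
  have eq: "equiv UNIV E" unfolding E_def by (rule equiv_pres_eq)
  have "congruent2 E E (\<lambda>u v. E `` {u @ v})"
  proof (rule congruent2I[OF eq eq])
    show "E `` {y @ v} = E `` {z @ v}" if "(y, z) \<in> E" for y z v
      using that by (intro equiv_class_eq[OF eq]) (auto simp: E_def pres_eq_append_right)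
    show "E `` {v @ y} = E `` {v @ z}" if "(y, z) \<in> E" for y z v
      using that by (intro equiv_class_eq[OF eq]) (auto simp: E_def pres_eq_append_left)
  qed
  then have mult: "E `` {u} \<otimes>\<^bsub>presented_group R\<^esub> E `` {v} = E `` {u @ v}" for u v
    by (simp add: presented_group_def E_def[symmetric] Let_def UN_equiv_class2[OF eq eq])
  have carr: "carrier (presented_group R) = range (\<lambda>u. E `` {u})"
    by (auto simp: presented_group_def E_def[symmetric] Let_def quotient_def)
  have one: "\<one>\<^bsub>presented_group R\<^esub> = E `` {[]}"
    by (simp add: presented_group_def E_def[symmetric] Let_def)
  have linv: "E `` {map (apsnd Not) (rev w) @ w} = E `` {[]}" for w
    by (rule equiv_class_eq[OF eq]) (simp add: E_def pres_eq_inverse)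
  show ?thesis
  proof (rule groupI)
    fix x assume "x \<in> carrier (presented_group R)"
    then obtain w where w: "x = E `` {w}" by (auto simp: carr)
    show "\<exists>y\<in>carrier (presented_group R). y \<otimes>\<^bsub>presented_group R\<^esub> x = \<one>\<^bsub>presented_group R\<^esub>"
      by (rule bexI[of _ "E `` {map (apsnd Not) (rev w)}"]) (auto simp: w mult linv one carr)
  qed (auto simp: carr mult one)
qed

datatype gens1 = gen1_a | gen1_b

definition H1 :: "nat \<Rightarrow> gens1 word set monoid" where
  "H1 p =
     (let a = (gen1_a, True); b = (gen1_b, True) in
      presented_group
       {(replicate (p\<^sup>2) a, []),
        (replicate p b, []),
        ([a, b], [b] @ replicate (p + 1) a)})"

datatype gens2 = gen2_a | gen2_b | gen2_c

text \<open>Commutators are read as \<open>[x,y] = x\<^sup>-\<^sup>1 y\<^sup>-\<^sup>1 x y\<close>; since \<open>c\<close> is central, the other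
  convention \<open>x y x\<^sup>-\<^sup>1 y\<^sup>-\<^sup>1\<close> presents the same group.\<close>

definition comm_word :: "'g \<Rightarrow> 'g \<Rightarrow> 'g word" where
  "comm_word x y = [(x, False), (y, False), (x, True), (y, True)]"

definition H2 :: "nat \<Rightarrow> gens2 word set monoid" where
  "H2 p =
     presented_group
       {(replicate p (gen2_a, True), []),
        (replicate p (gen2_b, True), []),
        (replicate p (gen2_c, True), []),
        (comm_word gen2_a gen2_b, [(gen2_c, True)]),
        (comm_word gen2_a gen2_c, []),
        (comm_word gen2_b gen2_c, [])}"


section \<open>The rational group algebra\<close>

text \<open>
  An element of the group algebra of a finite group \<open>H\<close> is its coefficient function, which vanishes
  outside \<^term>\<open>carrier H\<close>. Addition is the pointwise one of \<^theory>\<open>HOL-Library.Function_Algebras\<close>;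
  the pointwise product from there is not used, the product of the group algebra being \<open>ga_mult\<close>.
\<close>

global_interpretation QH: vector_space "\<lambda>(q::rat) (f::'a \<Rightarrow> rat) x. q * f x"
  by unfold_locales (simp_all add: fun_eq_iff algebra_simps)

definition group_algebra :: "('a, 'm) monoid_scheme \<Rightarrow> ('a \<Rightarrow> rat) set" where
  "group_algebra H = {f. \<forall>x. x \<notin> carrier H \<longrightarrow> f x = 0}"

definition ga_mult :: "('a, 'm) monoid_scheme \<Rightarrow> ('a \<Rightarrow> rat) \<Rightarrow> ('a \<Rightarrow> rat) \<Rightarrow> 'a \<Rightarrow> rat" where
  "ga_mult H f g =
     (\<lambda>x. \<Sum>(y, z) | y \<in> carrier H \<and> z \<in> carrier H \<and> y \<otimes>\<^bsub>H\<^esub> z = x. f y * g z)"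

definition set_sum :: "'a set \<Rightarrow> 'a \<Rightarrow> rat" where
  "set_sum T = (\<lambda>x. if x \<in> T then 1 else 0)"

definition ga_subalgebra :: "('a, 'm) monoid_scheme \<Rightarrow> ('a \<Rightarrow> rat) set \<Rightarrow> bool" where
  "ga_subalgebra H A \<longleftrightarrow>
     A \<subseteq> group_algebra H \<and> QH.subspace A \<and> set_sum {\<one>\<^bsub>H\<^esub>} \<in> A \<and>
     (\<forall>f\<in>A. \<forall>g\<in>A. ga_mult H f g \<in> A)"

definition ga_commutative :: "('a, 'm) monoid_scheme \<Rightarrow> ('a \<Rightarrow> rat) set \<Rightarrow> bool" where
  "ga_commutative H A \<longleftrightarrow> (\<forall>f\<in>A. \<forall>g\<in>A. ga_mult H f g = ga_mult H g f)"


section \<open>S-rings\<close>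

definition basic_partition ::
  "('a, 'm) monoid_scheme \<Rightarrow> ('a \<Rightarrow> rat) set \<Rightarrow> 'a set set \<Rightarrow> bool" where
  "basic_partition H A P \<longleftrightarrow>
     partition_on (carrier H) P \<and>
     {\<one>\<^bsub>H\<^esub>} \<in> P \<and>
     (\<forall>T\<in>P. set_inv\<^bsub>H\<^esub> T \<in> P) \<and>
     QH.independent (set_sum ` P) \<and> QH.span (set_sum ` P) = A"

definition S_ring :: "('a, 'm) monoid_scheme \<Rightarrow> ('a \<Rightarrow> rat) set \<Rightarrow> bool" where
  "S_ring H A \<longleftrightarrow> ga_subalgebra H A \<and> (\<exists>P. basic_partition H A P)"

definition Bsets :: "('a, 'm) monoid_scheme \<Rightarrow> ('a \<Rightarrow> rat) set \<Rightarrow> 'a set set" where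
  "Bsets H A = (THE P. basic_partition H A P)"

lemma span_set_sum_constant:
  assumes P: "partition_on S P" and f: "f \<in> QH.span (set_sum ` P)"
    and T: "T \<in> P" "x \<in> T" "y \<in> T"
  shows "f x = f y"
  using f
proof (induction rule: QH.span_induct)
  case base
  show ?case
    unfolding QH.subspace_def by auto
next
  case (step g)
  then obtain U where U: "U \<in> P" "g = set_sum U" by blast
  have "x \<in> U \<longleftrightarrow> y \<in> U"
    using P T U(1) by (metis partition_onD2 disjointD disjoint_iff)
  then show ?case using U by (simp add: set_sum_def)
qed

lemma basic_partition_unique:
  assumes P: "basic_partition H A P" and Q: "basic_partition H A Q"
  shows "P = Q"
proof -
  have sub: "P \<subseteq> Q" if P: "basic_partition H A P" and Q: "basic_partition H A Q" for P Q
  proof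
    fix T assume T: "T \<in> P"
    have pP: "partition_on (carrier H) P" and pQ: "partition_on (carrier H) Q"
      and sp: "QH.span (set_sum ` P) = QH.span (set_sum ` Q)"
      using P Q by (auto simp: basic_partition_def)
    have "T \<noteq> {}" using pP T by (metis partition_onD3)
    then obtain x where x: "x \<in> T" by blast
    then have "x \<in> carrier H" using pP T by (auto simp: partition_on_def)
    then obtain U where U: "U \<in> Q" "x \<in> U" using pQ by (auto simp: partition_on_def)
    have "set_sum T \<in> QH.span (set_sum ` Q)"
      using T sp by (metis QH.span_base image_eqI)
    then have "\<And>y. y \<in> U \<Longrightarrow> set_sum T x = set_sum T y"
      using span_set_sum_constant[OF pQ _ U(1) U(2)] by blast
    then have 1: "U \<subseteq> T" using x by (force simp: set_sum_def split: if_splits)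
    have "set_sum U \<in> QH.span (set_sum ` P)"
      using U sp by (metis QH.span_base image_eqI)
    then have "\<And>y. y \<in> T \<Longrightarrow> set_sum U x = set_sum U y"
      using span_set_sum_constant[OF pP _ T x] by blast
    then have 2: "T \<subseteq> U" using U by (force simp: set_sum_def split: if_splits)
    show "T \<in> Q" using 1 2 U by auto
  qed
  show ?thesis using sub[OF P Q] sub[OF Q P] by blast
qed

lemma Bsets_eq: "basic_partition H A P \<Longrightarrow> Bsets H A = P"
  unfolding Bsets_def by (rule the_equality) (assumption, erule (1) basic_partition_unique)

definition p_S_ring :: "nat \<Rightarrow> ('a, 'm) monoid_scheme \<Rightarrow> ('a \<Rightarrow> rat) set \<Rightarrow> bool" where
  "p_S_ring p H A \<longleftrightarrow> S_ring H A \<and> (\<forall>T\<in>Bsets H A. \<exists>k. card T = p ^ k)"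

definition Bsets_in :: "('a, 'm) monoid_scheme \<Rightarrow> ('a \<Rightarrow> rat) set \<Rightarrow> 'a set \<Rightarrow> 'a set set" where
  "Bsets_in H A L = {T \<in> Bsets H A. T \<subseteq> L}"

definition O_theta :: "('a, 'm) monoid_scheme \<Rightarrow> ('a \<Rightarrow> rat) set \<Rightarrow> 'a set" where
  "O_theta H A = generate H (\<Union>T\<in>Bsets H A. set_inv\<^bsub>H\<^esub> T <#>\<^bsub>H\<^esub> T)"

definition St_R :: "('a, 'm) monoid_scheme \<Rightarrow> 'a set \<Rightarrow> 'a set" where
  "St_R H T = {h \<in> carrier H. T #>\<^bsub>H\<^esub> h = T}"


section \<open>Schurian S-rings\<close>

text \<open>Permutations of \<open>H\<close> are elements of \<^term>\<open>BijGroup (carrier H)\<close>, i.e. they take the value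
  \<^term>\<open>undefined\<close> outside \<^term>\<open>carrier H\<close>.\<close>

definition right_regular :: "('a, 'm) monoid_scheme \<Rightarrow> ('a \<Rightarrow> 'a) set" where
  "right_regular H = {(\<lambda>h\<in>carrier H. h \<otimes>\<^bsub>H\<^esub> g) | g. g \<in> carrier H}"

definition one_stabilizer :: "('a, 'm) monoid_scheme \<Rightarrow> ('a \<Rightarrow> 'a) set \<Rightarrow> ('a \<Rightarrow> 'a) set" where
  "one_stabilizer H G = stabilizer (BijGroup (carrier H)\<lparr>carrier := G\<rparr>) (\<lambda>g. g) \<one>\<^bsub>H\<^esub>"

definition transitivity_module ::
  "('a, 'm) monoid_scheme \<Rightarrow> ('a \<Rightarrow> 'a) set \<Rightarrow> ('a \<Rightarrow> rat) set" where
  "transitivity_module H K =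
     QH.span (set_sum ` orbits (BijGroup (carrier H)\<lparr>carrier := K\<rparr>) (carrier H) (\<lambda>g. g))"

definition Schurian :: "('a, 'm) monoid_scheme \<Rightarrow> ('a \<Rightarrow> rat) set \<Rightarrow> bool" where
  "Schurian H A \<longleftrightarrow>
     (\<exists>G. subgroup G (BijGroup (carrier H)) \<and> right_regular H \<subseteq> G \<and>
          A = transitivity_module H (one_stabilizer H G))"


section \<open>The set of permutations \<open>\<Gamma>\<^sub>1\<close> and compatibility\<close>

definition R_rel :: "('a, 'm) monoid_scheme \<Rightarrow> 'a set \<Rightarrow> ('a \<times> 'a) set" where
  "R_rel H T = {(h, t \<otimes>\<^bsub>H\<^esub> h) | h t. h \<in> carrier H \<and> t \<in> T}"

definition basic_rel ::
  "('a, 'm) monoid_scheme \<Rightarrow> ('a \<Rightarrow> rat) set \<Rightarrow> 'a \<Rightarrow> 'a \<Rightarrow> ('a \<times> 'a) set" where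
  "basic_rel H A \<beta> \<gamma> = (THE r. r \<in> R_rel H ` Bsets H A \<and> (\<beta>, \<gamma>) \<in> r)"

definition compatible ::
  "('a, 'm) monoid_scheme \<Rightarrow> ('a \<Rightarrow> rat) set \<Rightarrow> ('a \<Rightarrow> 'a) \<Rightarrow> 'a set \<Rightarrow> 'a set \<Rightarrow> bool" where
  "compatible H A \<sigma> T T' \<longleftrightarrow>
     (\<forall>\<beta>\<in>T. \<forall>\<gamma>\<in>T'. basic_rel H A \<beta> \<gamma> = basic_rel H A (\<sigma> \<beta>) (\<sigma> \<gamma>))"

text \<open>For a set \<^term>\<open>T\<close> of size \<^term>\<open>p\<close>, \<^term>\<open>cyclic_on \<sigma> T\<close> says that
  \<^term>\<open>\<sigma>\<close> acts on \<^term>\<open>T\<close> as a single cycle, here a \<open>p\<close>-cycle.\<close>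

definition Gamma1 ::
  "nat \<Rightarrow> ('a, 'm) monoid_scheme \<Rightarrow> ('a \<Rightarrow> rat) set \<Rightarrow> 'a set \<Rightarrow> ('a \<Rightarrow> 'a) set" where
  "Gamma1 p H A L =
     {\<sigma> \<in> carrier (BijGroup (carrier H)).
        {x \<in> carrier H. \<sigma> x = x} = L \<and>
        (\<forall>T\<in>Bsets H A. card T = p \<longrightarrow>
           \<sigma> ` T = T \<and> cyclic_on \<sigma> T \<and>
           (\<forall>\<beta>\<in>T. \<forall>\<gamma>\<in>T. basic_rel H A \<beta> \<gamma> = basic_rel H A (\<sigma> \<beta>) (\<sigma> \<gamma>)))}"

end

theory Submission
  imports Defs
begin

text \<open>
  Put \<open>L = O_theta H A\<close>, write \<open>bset h\<close> for the basic set containing \<open>h\<close> and \<open>stab h\<close> for its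
  right stabilizer. Both directions rest on the following description of the S-ring: \<open>L\<close> is an
  abelian normal subgroup of order \<open>p\<^sup>2\<close>, each of its elements is a basic set by itself, and for
  \<open>h\<close> outside \<open>L\<close> the basic set is a coset \<open>bset h = h (stab h)\<close> of a subgroup \<open>stab h \<le> L\<close> of
  order \<open>p\<close>. This subgroup depends only on the coset \<open>h L\<close>, and since there are \<open>p - 1\<close> nontrivial
  cosets and, by (B), \<open>p - 1\<close> stabilizers, different cosets have different ones, with trivial
  intersection (\<open>thin_eq_L\<close>, \<open>bset_eq_coset\<close>, \<open>stab_coset\<close>, \<open>stab_inj\<close>).

  Consequently a permutation that fixes \<open>1\<close> and preserves all basic relations has the form
  \<open>h \<mapsto> h \<rho>(h)\<close> with \<open>\<rho>(h) \<in> stab h\<close> constant on the cosets of \<open>L\<close>, and a map of this form preserves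
  the relations if and only if \<open>h \<rho>(k) \<rho>(h)\<^sup>-\<^sup>1 h\<^sup>-\<^sup>1 \<in> stab (k h\<^sup>-\<^sup>1)\<close> for all \<open>h\<close>, \<open>k\<close>
  (\<open>bset_shift\<close>). This condition only depends on the cosets of \<open>h\<close> and \<open>k\<close>.

  If \<open>\<sigma>\<close> as in the theorem is given, then it shifts one point \<open>t\<^sub>i \<in> T\<^sub>i\<close> of each nontrivial coset by some
  \<open>r\<^sub>i \<noteq> 1\<close>, and compatibility is the condition above for these points. Shifting the whole coset of
  \<open>t\<^sub>i\<close> by \<open>r\<^sub>i\<close> is therefore an automorphism of the scheme, and its powers move \<open>h\<close> through all
  of \<open>h (stab h)\<close>. So the basic sets are the point stabilizer orbits of the automorphism group.

  Conversely, let \<open>G\<close> witness that \<open>A\<close> is Schurian and let \<open>g \<in> G\<close> fix \<open>1\<close> and move \<open>h\<^sub>0\<close>. It has all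
  the properties asked of \<open>\<sigma>\<close> once it is known to move every \<open>h\<close> outside \<open>L\<close>. If it fixed \<open>h\<close>, then
  the condition, with \<open>\<rho>(h) = 1 \<noteq> \<rho>(h\<^sub>0)\<close>, would give \<open>h (stab h\<^sub>0) h\<^sup>-\<^sup>1 = stab (h\<^sub>0 h\<^sup>-\<^sup>1)\<close>. Every other
  \<open>g'\<close> in the point stabilizer shifts \<open>h\<close> by some \<open>r\<close> and \<open>h\<^sub>0\<close> by some \<open>s\<close> with \<open>s r\<^sup>-\<^sup>1 \<in> stab h\<^sub>0\<close>, whence
  \<open>r \<in> stab h\<^sub>0 \<inter> stab h = 1\<close>. So \<open>h\<close> would be fixed by the whole stabilizer and form a basic set
  of size \<open>1\<close> instead of \<open>p\<close>.

  The presentations of the groups enter only through two consequences: \<open>H\<close> has order \<open>p\<^sup>3\<close>, and its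
  subgroups of order \<open>p\<^sup>2\<close> are abelian and normal. Non-commutativity of \<open>A\<close> is used to see
  that \<open>H\<close> is non-abelian.
\<close>

section \<open>Non-abelian groups with Heisenberg relations\<close>

text \<open>
  Common relations of the two groups: for \<open>H1\<close> take \<open>c = a\<^sup>p\<close> and \<open>e = 1\<close>, for \<open>H2\<close> take \<open>e = 0\<close>.
  They also hold in proper quotients; being non-abelian is what excludes these.
\<close>

locale heisenberg_relations = group G for G (structure) +
  fixes p e :: nat and a b c
  assumes prime_p: "Factorial_Ring.prime p"
    and gens_closed [simp]: "a \<in> carrier G" "b \<in> carrier G" "c \<in> carrier G"
    and generated: "carrier G = generate G {a, b, c}"
    and c_central: "x \<in> carrier G \<Longrightarrow> c \<otimes> x = x \<otimes> c"
    and c_pow_p: "c [^] p = \<one>" and b_pow_p: "b [^] p = \<one>" and a_pow_p: "a [^] p = c [^] e"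
    and a_b: "a \<otimes> b = b \<otimes> (a \<otimes> c)"
begin

lemma c_pow_central: "x \<in> carrier G \<Longrightarrow> c [^] (k::nat) \<otimes> x = x \<otimes> c [^] k"
  by (rule group_commutes_pow) (simp_all add: c_central)

text \<open>
  The normal form of a group element. With \<open>b\<close> in front, multiplying two normal forms means moving a
  power of \<open>b\<close> to the left past a power of \<open>a\<close>, which only produces powers of the central \<open>c\<close>.
\<close>

definition nf :: "nat \<Rightarrow> nat \<Rightarrow> nat \<Rightarrow> 'a" where
  "nf i j k = b [^] i \<otimes> (a [^] j \<otimes> c [^] k)"

lemma nf_closed [simp]: "nf i j k \<in> carrier G"
  by (simp add: nf_def)

lemma a_pow_b: "a [^] (j::nat) \<otimes> b = b \<otimes> (a [^] j \<otimes> c [^] j)"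
proof (induction j)
  case (Suc j)
  have "a [^] Suc j \<otimes> b = a [^] j \<otimes> (a \<otimes> b)" by (simp add: m_assoc)
  also have "\<dots> = (a [^] j \<otimes> b) \<otimes> (a \<otimes> c)" by (simp add: a_b m_assoc)
  also have "\<dots> = b \<otimes> (a [^] j \<otimes> (c [^] j \<otimes> a) \<otimes> c)" by (simp add: Suc m_assoc)
  also have "\<dots> = b \<otimes> (a [^] Suc j \<otimes> c [^] Suc j)"
    by (simp add: c_pow_central m_assoc)
  finally show ?case .
qed simp

lemma a_pow_b_pow: "a [^] (j::nat) \<otimes> b [^] (i::nat) = b [^] i \<otimes> (a [^] j \<otimes> c [^] (j * i))"
proof (induction i)
  case (Suc i)
  have "a [^] j \<otimes> b [^] Suc i = (a [^] j \<otimes> b [^] i) \<otimes> b" by (simp add: m_assoc)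
  also have "\<dots> = b [^] i \<otimes> (a [^] j \<otimes> (c [^] (j * i) \<otimes> b))" by (simp add: Suc m_assoc)
  also have "\<dots> = b [^] i \<otimes> ((a [^] j \<otimes> b) \<otimes> c [^] (j * i))" by (simp add: c_pow_central m_assoc)
  also have "\<dots> = b [^] Suc i \<otimes> (a [^] j \<otimes> (c [^] j \<otimes> c [^] (j * i)))"
    by (simp add: a_pow_b m_assoc)
  also have "c [^] j \<otimes> c [^] (j * i) = c [^] (j * Suc i)" by (simp add: nat_pow_mult)
  finally show ?case .
qed simp

lemma nf_mult: "nf i j k \<otimes> nf i' j' k' = nf (i + i') (j + j') (k + k' + j * i')"
proof -
  have "nf i j k \<otimes> nf i' j' k' = b [^] i \<otimes> (a [^] j \<otimes> ((c [^] k \<otimes> (b [^] i' \<otimes> a [^] j')) \<otimes> c [^] k'))"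
    by (simp add: nf_def m_assoc)
  also have "\<dots> = b [^] i \<otimes> ((a [^] j \<otimes> b [^] i') \<otimes> (a [^] j' \<otimes> (c [^] k \<otimes> c [^] k')))"
    by (simp add: c_pow_central[of "b [^] i' \<otimes> a [^] j'"] m_assoc)
  also have "\<dots> = b [^] i \<otimes> (b [^] i' \<otimes> (a [^] j \<otimes> ((c [^] (j * i') \<otimes> a [^] j') \<otimes> (c [^] k \<otimes> c [^] k'))))"
    by (simp add: a_pow_b_pow m_assoc)
  also have "\<dots> = (b [^] i \<otimes> b [^] i') \<otimes> ((a [^] j \<otimes> a [^] j') \<otimes> (c [^] (j * i') \<otimes> (c [^] k \<otimes> c [^] k')))"
    by (simp add: c_pow_central[of "a [^] j'"] m_assoc)
  also have "\<dots> = nf (i + i') (j + j') (k + k' + j * i')"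
    by (simp add: nat_pow_mult nf_def ac_simps)
  finally show ?thesis .
qed

lemma gens_nf: "a = nf 0 1 0" "b = nf 1 0 0" "c = nf 0 0 1" "\<one> = nf 0 0 0"
  by (auto simp: nf_def)

lemma gens_pow_p_squared: "x \<in> {a, b, c} \<Longrightarrow> x [^] (p * p) = \<one>"
proof -
  have "a [^] (p * p) = (c [^] p) [^] e"
    by (simp add: nat_pow_pow[symmetric] a_pow_p) (simp add: nat_pow_pow mult.commute)
  moreover have "b [^] (p * p) = \<one>" "c [^] (p * p) = \<one>"
    by (simp_all add: nat_pow_pow[symmetric] b_pow_p c_pow_p)
  ultimately show "x \<in> {a, b, c} \<Longrightarrow> x [^] (p * p) = \<one>" by (auto simp: c_pow_p)
qed

text \<open>
  Normal forms are closed under products, and the inverse of a generator is one of its powers.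
\<close>

lemma carrier_nf: "carrier G = {nf i j k | i j k. True}"
proof
  let ?N = "{nf i j k | i j k. True}"
  have mult: "x \<otimes> y \<in> ?N" if "x \<in> ?N" "y \<in> ?N" for x y
  proof -
    obtain i j k i' j' k' where "x = nf i j k" "y = nf i' j' k'" using \<open>x \<in> ?N\<close> \<open>y \<in> ?N\<close> by blast
    then show ?thesis using nf_mult by blast
  qed
  have gens: "{a, b, c} \<subseteq> ?N" "\<one> \<in> ?N" using gens_nf by blast+
  have pow: "x [^] (n::nat) \<in> ?N" if "x \<in> {a, b, c}" for x n
  proof (induction n)
    case 0
    then show ?case using gens by simp
  next
    case (Suc n)
    then have "x [^] n \<otimes> x \<in> ?N" using gens that by (intro mult) blast+
    then show ?case by simp
  qed
  have p2: "p * p = Suc (p * p - 1)" using prime_p prime_gt_0_nat[of p] by simp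
  have inv_gens: "inv x \<in> ?N" if x: "x \<in> {a, b, c}" for x
  proof -
    have xc: "x \<in> carrier G" using x by auto
    have "x [^] (p * p - 1) \<otimes> x = x [^] (p * p)" by (subst (2) p2) simp
    also have "\<dots> = \<one>" by (rule gens_pow_p_squared[OF x])
    finally have "inv x = x [^] (p * p - 1)" using xc by (intro inv_equality) auto
    then show ?thesis using pow[OF x] by simp
  qed
  have "x \<in> ?N" if "x \<in> generate G {a, b, c}" for x
    using that
  proof induction
    case one
    show ?case by (rule gens)
  next
    case (incl h)
    then show ?case using gens by blast
  next
    case (inv h)
    then show ?case by (intro inv_gens)
  next
    case (eng h1 h2)
    then show ?case using mult by blast
  qed
  then show "carrier G \<subseteq> ?N" using generated by blast
qed auto

lemma nf_reduce: "\<exists>i'<p. \<exists>j'<p. \<exists>k'<p. nf i j k = nf i' j' k'"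
proof -
  have p: "p > 0" using prime_p prime_gt_0_nat by blast
  have "b [^] i = b [^] (i mod p)"
  proof -
    have "b [^] i = b [^] (p * (i div p) + i mod p)" by simp
    also have "\<dots> = (b [^] p) [^] (i div p) \<otimes> b [^] (i mod p)"
      by (simp only: nat_pow_mult[symmetric] nat_pow_pow gens_closed)
    finally show ?thesis by (simp add: b_pow_p)
  qed
  moreover have c: "c [^] l = c [^] (l mod p)" for l
  proof -
    have "c [^] l = c [^] (p * (l div p) + l mod p)" by simp
    also have "\<dots> = (c [^] p) [^] (l div p) \<otimes> c [^] (l mod p)"
      by (simp only: nat_pow_mult[symmetric] nat_pow_pow gens_closed)
    finally show ?thesis by (simp add: c_pow_p)
  qed
  moreover have "a [^] j = a [^] (j mod p) \<otimes> c [^] (e * (j div p))"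
  proof -
    have "a [^] j = a [^] (p * (j div p) + j mod p)" by simp
    also have "\<dots> = (a [^] p) [^] (j div p) \<otimes> a [^] (j mod p)"
      by (simp only: nat_pow_mult[symmetric] nat_pow_pow gens_closed)
    finally show ?thesis by (simp add: a_pow_p nat_pow_pow c_pow_central)
  qed
  ultimately have "nf i j k = b [^] (i mod p) \<otimes> (a [^] (j mod p) \<otimes> (c [^] (e * (j div p)) \<otimes> c [^] k))"
    by (simp add: nf_def m_assoc)
  also have "c [^] (e * (j div p)) \<otimes> c [^] k = c [^] ((e * (j div p) + k) mod p)"
    by (simp add: nat_pow_mult c[symmetric])
  finally have "nf i j k = nf (i mod p) (j mod p) ((e * (j div p) + k) mod p)"
    by (simp add: nf_def)
  then show ?thesis using p by (meson mod_less_divisor)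
qed

text \<open>
  If \<open>c = 1\<close>, the multiplication rule \<open>nf_mult\<close> just adds the exponents of \<open>a\<close> and \<open>b\<close>.
\<close>

lemma commutative_if_c_trivial:
  assumes "c = \<one>" "x \<in> carrier G" "y \<in> carrier G"
  shows "x \<otimes> y = y \<otimes> x"
proof -
  have nf_0: "nf i j k = nf i j 0" for i j k unfolding nf_def by (simp add: assms(1))
  obtain i j k i' j' k' where xy: "x = nf i j k" "y = nf i' j' k'"
    using assms carrier_nf by blast
  have "x \<otimes> y = nf (i + i') (j + j') 0" unfolding xy nf_mult by (rule nf_0)
  also have "\<dots> = y \<otimes> x" unfolding xy nf_mult nf_0[of _ _ "k' + k + j' * i"] by (simp add: add.commute)
  finally show ?thesis .
qed

end

locale nonabelian_heisenberg = heisenberg_relations +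
  assumes nonabelian: "\<exists>x\<in>carrier G. \<exists>y\<in>carrier G. x \<otimes> y \<noteq> y \<otimes> x"
begin

lemma c_nontrivial: "c \<noteq> \<one>"
  using nonabelian commutative_if_c_trivial by blast

lemma ord_c: "ord c = p"
proof -
  have "ord c dvd p" using c_pow_p pow_eq_id by simp
  moreover have "ord c \<noteq> 1" using ord_eq_1 c_nontrivial by simp
  ultimately show ?thesis using prime_p by (metis prime_nat_iff)
qed

lemma c_pow_eq_iff: "i < p \<Longrightarrow> j < p \<Longrightarrow> c [^] i = c [^] j \<longleftrightarrow> i = j"
proof -
  have "i = j" if "i < p" "j < p" "c [^] i = c [^] j" "i \<le> j" for i j
  proof -
    have "c [^] i \<otimes> c [^] (j - i) = c [^] (i + (j - i))"
      by (simp only: nat_pow_mult gens_closed)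
    then have "c [^] i \<otimes> c [^] (j - i) = c [^] i"
      using that by (simp only: le_add_diff_inverse)
    then have "c [^] (j - i) = \<one>" by simp
    then have "p dvd j - i" using pow_eq_id ord_c by simp
    then have "\<not> 0 < j - i" using that nat_dvd_not_less[of "j - i" p] by linarith
    then show ?thesis using that by linarith
  qed
  from this[of i j] this[of j i]
  show "i < p \<Longrightarrow> j < p \<Longrightarrow> c [^] i = c [^] j \<longleftrightarrow> i = j"
    by (cases "i \<le> j") auto
qed

text \<open>
  The exponents can be recovered: commuting an element with \<open>b\<close> gives \<open>c\<close> to the exponent of \<open>a\<close>,
  commuting it with \<open>a\<close> gives \<open>c\<close> to the exponent of \<open>b\<close>, and \<open>c\<close> has order exactly \<open>p\<close>.
\<close>

lemma nf_inj:
  assumes "nf i j k = nf i' j' k'" and "i < p" "j < p" "k < p" "i' < p" "j' < p" "k' < p"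
  shows "i = i' \<and> j = j' \<and> k = k'"
proof -
  have cnf: "nf i j k \<otimes> c [^] l = nf i j (k + l)" for i j k l
    by (simp add: nf_def m_assoc nat_pow_mult)
  have "nf i j k \<otimes> b = nf (i + 1) j (k + j)" for i j k
    using nf_mult[of i j k 1 0 0] gens_nf by simp
  moreover have "b \<otimes> nf i j k = nf (i + 1) j k" for i j k
    using nf_mult[of 1 0 0 i j k] gens_nf by simp
  ultimately have b: "nf i j k \<otimes> b = (b \<otimes> nf i j k) \<otimes> c [^] j" for i j k by (simp add: cnf)
  have "nf i j k \<otimes> a = nf i (j + 1) k" for i j k
    using nf_mult[of i j k 0 1 0] gens_nf by simp
  moreover have "a \<otimes> nf i j k = nf i (j + 1) (k + i)" for i j k
    using nf_mult[of 0 1 0 i j k] gens_nf by simp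
  ultimately have a: "a \<otimes> nf i j k = (nf i j k \<otimes> a) \<otimes> c [^] i" for i j k by (simp add: cnf)
  have "(b \<otimes> nf i j k) \<otimes> c [^] j = (b \<otimes> nf i j k) \<otimes> c [^] j'"
    using b[of i j k] b[of i' j' k'] assms(1) by simp
  then have j: "c [^] j = c [^] j'" by simp
  have "(nf i j k \<otimes> a) \<otimes> c [^] i = (nf i j k \<otimes> a) \<otimes> c [^] i'"
    using a[of i j k] a[of i' j' k'] assms(1) by simp
  then have i: "c [^] i = c [^] i'" by simp
  have ij: "i = i'" "j = j'" using i j c_pow_eq_iff assms by auto
  then have "c [^] k = c [^] k'" using assms(1) by (simp add: nf_def)
  then show ?thesis using ij c_pow_eq_iff assms by auto
qed

lemma order_p3: "order G = p ^ 3"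
proof -
  let ?D = "{..<p} \<times> {..<p} \<times> {..<p}"
  have "bij_betw (\<lambda>(i, j, k). nf i j k) ?D (carrier G)"
    unfolding bij_betw_def
  proof
    show "inj_on (\<lambda>(i, j, k). nf i j k) ?D"
    proof (rule inj_onI)
      fix x y
      assume xy: "x \<in> ?D" "y \<in> ?D" and eq: "(\<lambda>(i, j, k). nf i j k) x = (\<lambda>(i, j, k). nf i j k) y"
      obtain i j k i' j' k' where x: "x = (i, j, k)" and y: "y = (i', j', k')" 
        by (cases x rule: prod_cases3, cases y rule: prod_cases3)
      show "x = y" using nf_inj[of i j k i' j' k'] xy eq unfolding x y by simp
    qed
    show "(\<lambda>(i, j, k). nf i j k) ` ?D = carrier G"
    proof
      show "carrier G \<subseteq> (\<lambda>(i, j, k). nf i j k) ` ?D"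
      proof
        fix x assume "x \<in> carrier G"
        then obtain i j k where "x = nf i j k" using carrier_nf by blast
        then obtain i' j' k' where "i' < p" "j' < p" "k' < p" "x = nf i' j' k'"
          using nf_reduce by metis
        then show "x \<in> (\<lambda>(i, j, k). nf i j k) ` ?D" by force
      qed
    qed auto
  qed
  then have "order G = card ?D" by (simp add: order_def bij_betw_same_card)
  then show ?thesis by (simp add: card_cartesian_product power3_eq_cube)
qed

lemma commute_up_to_c:
  assumes "x \<in> carrier G" "y \<in> carrier G"
  shows "\<exists>m::nat. x \<otimes> y = y \<otimes> x \<otimes> c [^] m"
proof -
  obtain i j k i' j' k' where xy: "x = nf i j k" "y = nf i' j' k'"
    using assms carrier_nf by blast
  have cnf: "nf i j k \<otimes> c [^] l = nf i j (k + l)" for i j k l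
    by (simp add: nf_def m_assoc nat_pow_mult)
  have p: "p = Suc (p - 1)" using prime_p prime_gt_0_nat[of p] by simp
  \<comment> \<open>the exponent \<open>- j' i\<close> of the commutator, made nonnegative by adding \<open>p j' i\<close>\<close>
  have "c [^] (p * (j' * i)) = \<one>"
    by (simp add: nat_pow_pow[symmetric] c_pow_p)
  then have "nf (i' + i) (j' + j) (k' + k + j * i') = nf (i' + i) (j' + j) (k' + k + j * i') \<otimes> c [^] (p * (j' * i))"
    by simp
  also have "\<dots> = nf (i' + i) (j' + j) (k' + k + j' * i) \<otimes> c [^] (j * i' + (p - 1) * (j' * i))"
    unfolding cnf by (subst p) (simp add: algebra_simps)
  finally have "x \<otimes> y = y \<otimes> x \<otimes> c [^] (j * i' + (p - 1) * (j' * i))"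
    by (simp add: xy nf_mult add.commute)
  then show ?thesis by blast
qed

text \<open>
  A subgroup \<open>K\<close> of order \<open>p\<^sup>2\<close> that avoids \<open>c\<close> meets the central subgroup generated by \<open>c\<close>
  trivially. As commutators are powers of \<open>c\<close>, such a \<open>K\<close> is abelian, and by counting the group is
  the product of \<open>K\<close> with a central subgroup, hence abelian.
\<close>

lemma c_in_subgroup_p2:
  assumes K: "subgroup K G" and card: "card K = p ^ 2"
  shows "c \<in> K"
proof (rule ccontr)
  assume c: "c \<notin> K"
  have c_K: "p dvd m" if "c [^] m \<in> K" for m :: nat
  proof (rule ccontr)
    assume "\<not> p dvd m"
    then have "coprime m p" using prime_p by (metis coprime_commute prime_imp_coprime)
    then obtain r s where rs: "m * r = p * s + 1"
      using coprime_bezout_strong[of m p] prime_gt_1_nat[OF prime_p] by auto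
    have "(c [^] m) [^] r \<in> K"
      using that K by (induction r) (auto intro: subgroup.m_closed subgroup.one_closed)
    moreover have "(c [^] m) [^] r = c [^] (p * s) \<otimes> c"
      by (simp add: nat_pow_pow rs)
    moreover have "c [^] (p * s) = \<one>" by (simp add: nat_pow_pow[symmetric] c_pow_p)
    ultimately show False using c by simp
  qed
  have Kc: "x \<in> carrier G" if "x \<in> K" for x using that by (rule subgroup.mem_carrier[OF K])
  \<comment> \<open>commutators of elements of \<open>K\<close> are powers of \<open>c\<close> in \<open>K\<close>, hence trivial\<close>
  have K_comm: "x \<otimes> y = y \<otimes> x" if x: "x \<in> K" and y: "y \<in> K" for x y
  proof -
    obtain m :: nat where m: "x \<otimes> y = y \<otimes> x \<otimes> c [^] m"
      using commute_up_to_c[OF Kc[OF x] Kc[OF y]] by blast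
    have "c [^] m = inv (y \<otimes> x) \<otimes> (y \<otimes> x \<otimes> c [^] m)"
      using Kc[OF x] Kc[OF y] m_assoc[of "inv (y \<otimes> x)" "y \<otimes> x" "c [^] m"] by simp
    then have "c [^] m = inv (y \<otimes> x) \<otimes> (x \<otimes> y)" unfolding m .
    moreover have "inv (y \<otimes> x) \<otimes> (x \<otimes> y) \<in> K"
      using subgroup.m_closed[OF K] subgroup.m_inv_closed[OF K] x y by blast
    ultimately have "p dvd m" using c_K[of m] by simp
    then have "c [^] m = \<one>" using pow_eq_id[of c m] ord_c by simp
    then show ?thesis using m Kc[OF x] Kc[OF y] by simp
  qed
  let ?f = "\<lambda>(x, k::nat). x \<otimes> c [^] k"
  have eq: "x = y \<and> k = l"
    if x: "x \<in> K" and y: "y \<in> K" and kl: "k < p" "l < p" and eq: "x \<otimes> c [^] k = y \<otimes> c [^] l" for x y k l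
  proof -
    have "x \<otimes> c [^] (k + (p - l)) = (x \<otimes> c [^] k) \<otimes> c [^] (p - l)"
      using Kc[OF x] by (simp add: m_assoc nat_pow_mult)
    also have "\<dots> = y \<otimes> c [^] (l + (p - l))"
      unfolding eq using Kc[OF y] by (simp add: m_assoc nat_pow_mult)
    also have "\<dots> = y" using kl Kc[OF y] by (simp add: c_pow_p)
    finally have "c [^] (k + (p - l)) = inv x \<otimes> y"
      using Kc[OF x] Kc[OF y] by (simp add: inv_solve_left)
    moreover have "inv x \<otimes> y \<in> K"
      using subgroup.m_closed[OF K] subgroup.m_inv_closed[OF K] x y by blast
    ultimately have "p dvd k + (p - l)" using c_K by simp
    moreover have "k + (p - l) < 2 * p" "k + (p - l) > 0" using kl by auto
    moreover have "q = 1" if "p * q < 2 * p" "p * q > 0" for q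
      using that by (cases q) (auto simp: mult.commute[of 2] less_2_cases_iff)
    ultimately have "k + (p - l) = p" by (metis dvdE mult.right_neutral)
    then have "k = l" using kl by simp
    then show ?thesis using eq Kc[OF x] Kc[OF y] by simp
  qed
  have inj: "inj_on ?f (K \<times> {..<p})"
  proof (rule inj_onI)
    fix u v
    assume "u \<in> K \<times> {..<p}" "v \<in> K \<times> {..<p}" "?f u = ?f v"
    then show "u = v" using eq[of "fst u" "fst v" "snd u" "snd v"]
      by (simp add: case_prod_beta mem_Times_iff prod_eq_iff)
  qed
  have "?f ` (K \<times> {..<p}) \<subseteq> carrier G" by (auto simp: Kc)
  moreover have "finite (carrier G)"
    using order_p3 prime_gt_0_nat[OF prime_p] order_gt_0_iff_finite by simp
  moreover have "card (?f ` (K \<times> {..<p})) = card (carrier G)"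
    using inj by (simp add: card_image card_cartesian_product card order_p3[unfolded order_def] power2_eq_square power3_eq_cube)
  ultimately have surj: "?f ` (K \<times> {..<p}) = carrier G" by (simp add: card_subset_eq)
  have all_comm: "x \<otimes> y = y \<otimes> x" if "x \<in> carrier G" "y \<in> carrier G" for x y
  proof -
    have "x \<in> ?f ` (K \<times> {..<p})" "y \<in> ?f ` (K \<times> {..<p})" using that surj by simp_all
    then obtain u k v l where xy: "x = u \<otimes> c [^] (k::nat)" "y = v \<otimes> c [^] (l::nat)" "u \<in> K" "v \<in> K"
      by auto
    have "x \<otimes> y = u \<otimes> (c [^] k \<otimes> v) \<otimes> c [^] l" using xy Kc by (simp add: m_assoc)
    also have "\<dots> = (u \<otimes> v) \<otimes> (c [^] k \<otimes> c [^] l)" using xy Kc by (simp add: c_pow_central[of v] m_assoc)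
    also have "\<dots> = (v \<otimes> u) \<otimes> (c [^] l \<otimes> c [^] k)" using xy K_comm by (simp add: nat_pow_mult add.commute)
    also have "\<dots> = v \<otimes> (c [^] l \<otimes> u) \<otimes> c [^] k" using xy Kc by (simp add: c_pow_central[of u] m_assoc)
    also have "\<dots> = y \<otimes> x" using xy Kc by (simp add: m_assoc)
    finally show ?thesis .
  qed
  have "b \<otimes> (a \<otimes> c) = b \<otimes> a" using a_b all_comm[of a b] by simp
  then have "a \<otimes> c = a" by simp
  then show False using c_nontrivial by simp
qed

lemma subgroup_p2_normal:
  assumes K: "subgroup K G" and card: "card K = p ^ 2" and x: "x \<in> carrier G" and l: "l \<in> K"
  shows "x \<otimes> l \<otimes> inv x \<in> K"
proof -
  have lc: "l \<in> carrier G" using l by (rule subgroup.mem_carrier[OF K])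
  obtain m :: nat where "x \<otimes> l = l \<otimes> x \<otimes> c [^] m" using commute_up_to_c x lc by blast
  also have "\<dots> = l \<otimes> (c [^] m \<otimes> x)" using x lc by (simp add: c_pow_central[of x] m_assoc)
  finally have "x \<otimes> l \<otimes> inv x = l \<otimes> c [^] m" using x lc by (simp add: m_assoc)
  moreover have "c [^] m \<in> K"
    using c_in_subgroup_p2[OF K card] K
    by (induction m) (auto intro: subgroup.m_closed subgroup.one_closed)
  ultimately show ?thesis using K l by (simp add: subgroup.m_closed)
qed

text \<open>
  The centralizer of \<open>x\<close> in \<open>K\<close> contains the powers of \<open>c\<close>. If \<open>x\<close> is not one of them, it has more
  than \<open>p\<close> elements, so it is all of \<open>K\<close>.
\<close>

lemma subgroup_p2_commutative:
  assumes K: "subgroup K G" and card: "card K = p ^ 2" and x: "x \<in> K" and y: "y \<in> K"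
  shows "x \<otimes> y = y \<otimes> x"
proof (cases "x \<in> generate G {c}")
  case True
  then obtain k :: nat where "x = c [^] k"
    using generate_pow_nat[of c] ord_c prime_p by auto
  then show ?thesis using c_pow_central[of y k] subgroup.mem_carrier[OF K y] by simp
next
  case False
  have Kc: "z \<in> carrier G" if "z \<in> K" for z using that by (rule subgroup.mem_carrier[OF K])
  let ?C = "{z \<in> K. x \<otimes> z = z \<otimes> x}"
  have C: "subgroup ?C G"
  proof (rule subgroupI)
    show "?C \<subseteq> carrier G" using Kc by blast
    show "?C \<noteq> {}" using x by blast
    show "inv z \<in> ?C" if "z \<in> ?C" for z
    proof -
      have zc: "z \<in> carrier G" and xc: "x \<in> carrier G" using that Kc x by simp_all
      have "inv z \<otimes> x = inv z \<otimes> (x \<otimes> z) \<otimes> inv z" using zc xc by (simp add: m_assoc)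
      also have "\<dots> = inv z \<otimes> (z \<otimes> x) \<otimes> inv z" using that by simp
      also have "\<dots> = x \<otimes> inv z" using zc xc by (simp add: m_assoc[symmetric])
      finally have "x \<otimes> inv z = inv z \<otimes> x" by simp
      then show ?thesis using that K by (simp add: subgroup.m_inv_closed)
    qed
    show "z \<otimes> w \<in> ?C" if "z \<in> ?C" "w \<in> ?C" for z w
    proof -
      have zw: "z \<in> carrier G" "w \<in> carrier G" and xc: "x \<in> carrier G" using that Kc x by simp_all
      have "x \<otimes> (z \<otimes> w) = (x \<otimes> z) \<otimes> w" using zw xc by (simp add: m_assoc)
      also have "\<dots> = z \<otimes> (x \<otimes> w)" using that zw xc by (simp add: m_assoc)
      also have "\<dots> = z \<otimes> w \<otimes> x" using that zw xc by (simp add: m_assoc)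
      finally have "x \<otimes> (z \<otimes> w) = z \<otimes> w \<otimes> x" .
      then show ?thesis using that K by (simp add: subgroup.m_closed)
    qed
  qed
  have finK: "finite K" using card prime_p by (metis card.infinite not_prime_0 power_eq_0_iff)
  have Z: "generate G {c} \<subseteq> ?C"
  proof -
    have "c \<in> ?C" using c_in_subgroup_p2[OF K card] c_central[of x] Kc[OF x] by simp
    then show ?thesis using C by (intro generate_subgroup_incl) auto
  qed
  have "x \<in> ?C" using x by simp
  then have "generate G {c} \<subset> ?C" using Z False by blast
  then have "card (generate G {c}) < card ?C" using finK by (intro psubset_card_mono) auto
  then have gt: "p < card ?C" using generate_pow_card[of c] ord_c by simp
  have "subgroup ?C (G\<lparr>carrier := K\<rparr>)"
    using C K by (intro subgroup_incl) auto
  then have "card (rcosets\<^bsub>G\<lparr>carrier := K\<rparr>\<^esub> ?C) * card ?C = p ^ 2"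
    using group.lagrange[OF subgroup_imp_group[OF K], of ?C] card by (simp add: order_def)
  from dvd_triv_right[of "card ?C" "card (rcosets\<^bsub>G\<lparr>carrier := K\<rparr>\<^esub> ?C)", unfolded this]
  obtain i where "i \<le> 2" "card ?C = p ^ i" using prime_p divides_primepow_nat by blast
  then have "card ?C = p ^ 2"
    using gt prime_gt_1_nat[OF prime_p]
    by (cases "i = 2") (auto simp: less_2_cases_iff le_less)
  then have "?C = K" using finK card by (intro card_subset_eq) auto
  then show ?thesis using y by blast
qed

end

section \<open>The presented groups satisfy the Heisenberg relations\<close>

definition word_class :: "('g word \<times> 'g word) set \<Rightarrow> 'g word \<Rightarrow> 'g word set" where
  "word_class R w = {v. pres_eq R w v}"

lemma word_class_eq: "word_class R v = word_class R w \<longleftrightarrow> pres_eq R v w"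
  unfolding word_class_def by (blast intro: pres_eq.intros)

lemma carrier_presented_group: "carrier (presented_group R) = range (word_class R)"
  by (auto simp: presented_group_def Let_def quotient_def word_class_def Image_def)

lemma one_presented_group: "\<one>\<^bsub>presented_group R\<^esub> = word_class R []"
  by (auto simp: presented_group_def Let_def word_class_def)

lemma mult_presented_group:
  "word_class R u \<otimes>\<^bsub>presented_group R\<^esub> word_class R v = word_class R (u @ v)"
proof -
  have "pres_eq R (u @ v) (u' @ v')" if "pres_eq R u u'" "pres_eq R v v'" for u' v'
    using that pres_eq_append_left pres_eq_append_right pres_trans by metis
  moreover have "pres_eq R u u" "pres_eq R v v" by (rule pres_refl)+
  ultimately show ?thesis
    by (auto simp: presented_group_def Let_def word_class_def intro: pres_trans)
qed

lemma word_class_rel: "(l, r) \<in> R \<Longrightarrow> word_class R l = word_class R r"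
  using pres_rel[of l r R "[]" "[]"] by (simp add: word_class_eq)

lemma word_class_replicate:
  "word_class R (replicate n x) = word_class R [x] [^]\<^bsub>presented_group R\<^esub> n"
proof (induction n)
  case 0
  show ?case by (simp add: one_presented_group)
next
  case (Suc n)
  have "replicate (Suc n) x = replicate n x @ [x]" by (simp add: replicate_append_same)
  then show ?case using Suc by (simp add: mult_presented_group[symmetric] del: replicate_Suc)
qed

lemma word_class_inverse:
  "word_class R [(x, False)] = inv\<^bsub>presented_group R\<^esub> word_class R [(x, True)]"
proof -
  interpret group "presented_group R" by (rule group_presented_group)
  have "word_class R ([] @ [(x, False), (x, \<not> False)] @ []) = word_class R ([] @ [])"
    unfolding word_class_eq by (rule pres_cancel)
  then have "word_class R [(x, False)] \<otimes>\<^bsub>presented_group R\<^esub> word_class R [(x, True)] = \<one>\<^bsub>presented_group R\<^esub>"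
    by (simp add: mult_presented_group one_presented_group)
  then show ?thesis
    by (intro inv_equality[symmetric]) (auto simp: carrier_presented_group)
qed

lemma presented_group_generated:
  "carrier (presented_group R) = generate (presented_group R) (range (\<lambda>x. word_class R [(x, True)]))"
    (is "_ = generate _ ?X")
proof
  interpret group "presented_group R" by (rule group_presented_group)
  have X: "?X \<subseteq> carrier (presented_group R)" by (auto simp: carrier_presented_group)
  then show "generate (presented_group R) ?X \<subseteq> carrier (presented_group R)"
    by (rule generate_incl)
  have "word_class R w \<in> generate (presented_group R) ?X" for w
  proof (induction w)
    case Nil
    show ?case using generate.one one_presented_group by metis
  next
    case (Cons l w)
    obtain x s where l: "l = (x, s)" by fastforce
    have "word_class R [l] \<in> generate (presented_group R) ?X"
    proof (cases s)
      case True
      then show ?thesis using l by (auto intro: generate.incl)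
    next
      case False
      have "inv\<^bsub>presented_group R\<^esub> word_class R [(x, True)] \<in> generate (presented_group R) ?X"
        by (rule generate.inv) simp
      then show ?thesis using l False by (simp add: word_class_inverse)
    qed
    then have "word_class R [l] \<otimes>\<^bsub>presented_group R\<^esub> word_class R w \<in> generate (presented_group R) ?X"
      using Cons.IH by (rule generate.eng)
    then show ?case by (simp add: mult_presented_group)
  qed
  then show "carrier (presented_group R) \<subseteq> generate (presented_group R) ?X"
    by (auto simp: carrier_presented_group)
qed

lemma (in group) central_generator:
  assumes "S \<subseteq> carrier G" "z \<in> carrier G" "x \<in> generate G S"
    and "\<And>y. y \<in> S \<Longrightarrow> z \<otimes> y = y \<otimes> z"
  shows "z \<otimes> x = x \<otimes> z"
  using assms(3)
proof induction
  case one
  show ?case using assms by simp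
next
  case (incl h)
  then show ?case using assms by blast
next
  case (inv h)
  then have h: "h \<in> carrier G" "z \<otimes> h = h \<otimes> z" using assms by auto
  have "inv h \<otimes> z = inv h \<otimes> (z \<otimes> h) \<otimes> inv h" using h(1) assms(2) by (simp add: m_assoc)
  also have "\<dots> = inv h \<otimes> (h \<otimes> z) \<otimes> inv h" using h by simp
  also have "\<dots> = z \<otimes> inv h" using h(1) assms(2) by (simp add: m_assoc[symmetric])
  finally show ?case by simp
next
  case (eng h k)
  have hk: "h \<in> carrier G" "k \<in> carrier G" using eng generate_in_carrier[OF assms(1)] by auto
  have "z \<otimes> (h \<otimes> k) = (z \<otimes> h) \<otimes> k" using hk assms(2) by (simp add: m_assoc)
  also have "\<dots> = h \<otimes> (z \<otimes> k)" using eng.IH hk assms(2) by (simp add: m_assoc)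
  also have "\<dots> = (h \<otimes> k) \<otimes> z" using eng.IH hk assms(2) by (simp add: m_assoc)
  finally show ?case .
qed

lemma UNIV_gens1: "UNIV = {gen1_a, gen1_b}"
  using gens1.exhaust by blast

lemma UNIV_gens2: "UNIV = {gen2_a, gen2_b, gen2_c}"
  using gens2.exhaust by blast

lemma H1_heisenberg_relations:
  assumes "Factorial_Ring.prime p"
  shows "\<exists>e a b c. heisenberg_relations (H1 p) p e a b c"
proof -
  define R where "R = {(replicate (p\<^sup>2) (gen1_a, True), []), (replicate p (gen1_b, True), []),
    ([(gen1_a, True), (gen1_b, True)], [(gen1_b, True)] @ replicate (p + 1) (gen1_a, True))}"
  have H1: "H1 p = presented_group R" by (simp add: H1_def R_def Let_def)
  interpret group "H1 p" unfolding H1 by (rule group_presented_group)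
  let ?G = "H1 p"
  define a where "a = word_class R [(gen1_a, True)]"
  define b where "b = word_class R [(gen1_b, True)]"
  have ab: "a \<in> carrier ?G" "b \<in> carrier ?G" by (auto simp: a_def b_def H1 carrier_presented_group)
  have a_p2: "a [^]\<^bsub>?G\<^esub> (p\<^sup>2) = \<one>\<^bsub>?G\<^esub>"
    unfolding a_def H1 word_class_replicate[symmetric] one_presented_group
    by (rule word_class_rel) (simp add: R_def)
  have b_p: "b [^]\<^bsub>?G\<^esub> p = \<one>\<^bsub>?G\<^esub>"
    unfolding b_def H1 word_class_replicate[symmetric] one_presented_group
    by (rule word_class_rel) (simp add: R_def)
  have "a \<otimes>\<^bsub>?G\<^esub> b = b \<otimes>\<^bsub>?G\<^esub> a [^]\<^bsub>?G\<^esub> (p + 1)"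
    unfolding a_def b_def H1 word_class_replicate[symmetric] mult_presented_group
    by (rule word_class_rel) (simp add: R_def)
  then have rel: "a \<otimes>\<^bsub>?G\<^esub> b = b \<otimes>\<^bsub>?G\<^esub> (a \<otimes>\<^bsub>?G\<^esub> a [^]\<^bsub>?G\<^esub> p)"
    using ab nat_pow_mult[of a 1 p] by (simp add: add.commute)
  define c where "c = a [^]\<^bsub>?G\<^esub> p"
  have c: "c \<in> carrier ?G" using ab by (simp add: c_def)
  have c_p: "c [^]\<^bsub>?G\<^esub> p = \<one>\<^bsub>?G\<^esub>"
    using a_p2 ab by (simp add: c_def nat_pow_pow power2_eq_square)
  have ac: "a \<otimes>\<^bsub>?G\<^esub> c = c \<otimes>\<^bsub>?G\<^esub> a"
    using ab by (simp add: c_def group_commutes_pow)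
  \<comment> \<open>conjugation by \<open>b\<close> maps \<open>a\<close> to \<open>a c\<close>, hence fixes \<open>c = a\<^sup>p\<close>\<close>
  have rel_pow: "a [^]\<^bsub>?G\<^esub> n \<otimes>\<^bsub>?G\<^esub> b = b \<otimes>\<^bsub>?G\<^esub> (a \<otimes>\<^bsub>?G\<^esub> c) [^]\<^bsub>?G\<^esub> n" for n :: nat
  proof (induction n)
    case 0
    show ?case using ab by simp
  next
    case (Suc n)
    have "a [^]\<^bsub>?G\<^esub> Suc n \<otimes>\<^bsub>?G\<^esub> b = a [^]\<^bsub>?G\<^esub> n \<otimes>\<^bsub>?G\<^esub> (a \<otimes>\<^bsub>?G\<^esub> b)" using ab by (simp add: m_assoc)
    also have "\<dots> = (a [^]\<^bsub>?G\<^esub> n \<otimes>\<^bsub>?G\<^esub> b) \<otimes>\<^bsub>?G\<^esub> (a \<otimes>\<^bsub>?G\<^esub> c)"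
      using rel ab c by (simp add: m_assoc c_def)
    also have "\<dots> = b \<otimes>\<^bsub>?G\<^esub> ((a \<otimes>\<^bsub>?G\<^esub> c) [^]\<^bsub>?G\<^esub> n \<otimes>\<^bsub>?G\<^esub> (a \<otimes>\<^bsub>?G\<^esub> c))"
      using Suc ab c by (simp add: m_assoc)
    finally show ?case by simp
  qed
  have "(a \<otimes>\<^bsub>?G\<^esub> c) [^]\<^bsub>?G\<^esub> p = c"
    using pow_mult_distrib[OF ac ab(1) c] c_p c by (simp add: c_def[symmetric])
  then have cb: "c \<otimes>\<^bsub>?G\<^esub> b = b \<otimes>\<^bsub>?G\<^esub> c"
    using rel_pow[of p] by (simp add: c_def[symmetric])
  have gens: "range (\<lambda>x. word_class R [(x, True)]) = {a, b}"
    unfolding a_def b_def UNIV_gens1 by simp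
  have generated: "carrier ?G = generate ?G {a, b, c}"
  proof
    show "carrier ?G \<subseteq> generate ?G {a, b, c}"
      using presented_group_generated[of R] unfolding gens H1[symmetric]
      using mono_generate[of "{a, b}" "{a, b, c}"] by blast
    show "generate ?G {a, b, c} \<subseteq> carrier ?G" using ab c by (intro generate_incl) auto
  qed
  have central: "c \<otimes>\<^bsub>?G\<^esub> x = x \<otimes>\<^bsub>?G\<^esub> c" if "x \<in> carrier ?G" for x
    using central_generator[of "{a, b, c}" c x] that generated ab c ac cb by auto
  have "heisenberg_relations ?G p 1 a b c"
    by unfold_locales
      (use assms ab c generated central c_p b_p rel in \<open>auto simp: c_def[symmetric]\<close>)
  then show ?thesis by blast
qed

lemma H2_heisenberg_relations:
  assumes "Factorial_Ring.prime p"
  shows "\<exists>e a b c. heisenberg_relations (H2 p) p e a b c"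
proof -
  define R where "R = {(replicate p (gen2_a, True), []), (replicate p (gen2_b, True), []),
        (replicate p (gen2_c, True), []), (comm_word gen2_a gen2_b, [(gen2_c, True)]),
        (comm_word gen2_a gen2_c, []), (comm_word gen2_b gen2_c, [])}"
  have H2: "H2 p = presented_group R" by (simp add: H2_def R_def)
  interpret group "H2 p" unfolding H2 by (rule group_presented_group)
  let ?G = "H2 p"
  define a where "a = word_class R [(gen2_a, True)]"
  define b where "b = word_class R [(gen2_b, True)]"
  define c where "c = word_class R [(gen2_c, True)]"
  have abc: "a \<in> carrier ?G" "b \<in> carrier ?G" "c \<in> carrier ?G"
    by (auto simp: a_def b_def c_def H2 carrier_presented_group)
  have pow: "a [^]\<^bsub>?G\<^esub> p = \<one>\<^bsub>?G\<^esub>" "b [^]\<^bsub>?G\<^esub> p = \<one>\<^bsub>?G\<^esub>" "c [^]\<^bsub>?G\<^esub> p = \<one>\<^bsub>?G\<^esub>"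
    unfolding a_def b_def c_def H2 word_class_replicate[symmetric] one_presented_group
    by (rule word_class_rel, simp add: R_def)+
  have comm: "word_class R (comm_word x y) =
      inv\<^bsub>?G\<^esub> word_class R [(x, True)] \<otimes>\<^bsub>?G\<^esub> (inv\<^bsub>?G\<^esub> word_class R [(y, True)] \<otimes>\<^bsub>?G\<^esub>
        (word_class R [(x, True)] \<otimes>\<^bsub>?G\<^esub> word_class R [(y, True)]))" for x y
    by (simp add: comm_word_def H2 word_class_inverse[symmetric] mult_presented_group)
  have eq: "x \<otimes>\<^bsub>?G\<^esub> y = y \<otimes>\<^bsub>?G\<^esub> (x \<otimes>\<^bsub>?G\<^esub> z)"
    if "inv\<^bsub>?G\<^esub> x \<otimes>\<^bsub>?G\<^esub> (inv\<^bsub>?G\<^esub> y \<otimes>\<^bsub>?G\<^esub> (x \<otimes>\<^bsub>?G\<^esub> y)) = z" "x \<in> carrier ?G" "y \<in> carrier ?G" for x y z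
    unfolding that(1)[symmetric] using that(2,3) by (simp add: m_assoc[symmetric])
  have "inv\<^bsub>?G\<^esub> a \<otimes>\<^bsub>?G\<^esub> (inv\<^bsub>?G\<^esub> b \<otimes>\<^bsub>?G\<^esub> (a \<otimes>\<^bsub>?G\<^esub> b)) = c"
    unfolding a_def b_def c_def comm[symmetric] by (rule word_class_rel) (simp add: R_def)
  then have rel: "a \<otimes>\<^bsub>?G\<^esub> b = b \<otimes>\<^bsub>?G\<^esub> (a \<otimes>\<^bsub>?G\<^esub> c)" using eq abc by blast
  have "inv\<^bsub>?G\<^esub> a \<otimes>\<^bsub>?G\<^esub> (inv\<^bsub>?G\<^esub> c \<otimes>\<^bsub>?G\<^esub> (a \<otimes>\<^bsub>?G\<^esub> c)) = \<one>\<^bsub>?G\<^esub>"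
    unfolding a_def c_def comm[symmetric] unfolding H2 one_presented_group
    by (rule word_class_rel) (simp add: R_def)
  then have ac: "a \<otimes>\<^bsub>?G\<^esub> c = c \<otimes>\<^bsub>?G\<^esub> a" using eq[of a c "\<one>\<^bsub>?G\<^esub>"] abc by simp
  have "inv\<^bsub>?G\<^esub> b \<otimes>\<^bsub>?G\<^esub> (inv\<^bsub>?G\<^esub> c \<otimes>\<^bsub>?G\<^esub> (b \<otimes>\<^bsub>?G\<^esub> c)) = \<one>\<^bsub>?G\<^esub>"
    unfolding b_def c_def comm[symmetric] unfolding H2 one_presented_group
    by (rule word_class_rel) (simp add: R_def)
  then have bc: "b \<otimes>\<^bsub>?G\<^esub> c = c \<otimes>\<^bsub>?G\<^esub> b" using eq[of b c "\<one>\<^bsub>?G\<^esub>"] abc by simp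
  have "range (\<lambda>x. word_class R [(x, True)]) = {a, b, c}"
    unfolding a_def b_def c_def UNIV_gens2 by simp
  then have generated: "carrier ?G = generate ?G {a, b, c}"
    using presented_group_generated[of R] by (simp add: H2)
  have central: "c \<otimes>\<^bsub>?G\<^esub> x = x \<otimes>\<^bsub>?G\<^esub> c" if "x \<in> carrier ?G" for x
    using central_generator[of "{a, b, c}" c x] that generated abc ac bc by auto
  have "heisenberg_relations ?G p 0 a b c"
    by unfold_locales (use assms abc generated central pow rel in auto)
  then show ?thesis by blast
qed

lemma heisenberg_relations_iso:
  assumes "heisenberg_relations K p e a b c" and "group G" and \<phi>: "\<phi> \<in> iso K G"
  shows "heisenberg_relations G p e (\<phi> a) (\<phi> b) (\<phi> c)"
proof -
  interpret K: heisenberg_relations K p e a b c by fact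
  interpret G: group G by fact
  have hom: "\<phi> \<in> hom K G" and bij: "\<phi> ` carrier K = carrier G"
    using \<phi> by (auto simp: iso_def bij_betw_def)
  interpret group_hom K G \<phi> using hom by unfold_locales
  have gen: "carrier G = generate G {\<phi> a, \<phi> b, \<phi> c}"
  proof -
    have "{a, b, c} \<subseteq> carrier K" by (simp del: K.generated)
    then have "generate G (\<phi> ` {a, b, c}) = \<phi> ` generate K {a, b, c}" by (rule generate_img)
    then show ?thesis unfolding K.generated[symmetric] bij by simp
  qed
  have central: "\<phi> c \<otimes>\<^bsub>G\<^esub> x = x \<otimes>\<^bsub>G\<^esub> \<phi> c" if "x \<in> carrier G" for x
  proof -
    have "x \<in> \<phi> ` carrier K" using that by (simp add: bij)
    then obtain y where y: "x = \<phi> y" "y \<in> carrier K" by (rule imageE)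
    have "\<phi> (c \<otimes>\<^bsub>K\<^esub> y) = \<phi> (y \<otimes>\<^bsub>K\<^esub> c)" using K.c_central y by simp
    then show ?thesis using y by simp
  qed
  have "\<phi> (a \<otimes>\<^bsub>K\<^esub> b) = \<phi> (b \<otimes>\<^bsub>K\<^esub> (a \<otimes>\<^bsub>K\<^esub> c))" using K.a_b by simp
  then have rel: "\<phi> a \<otimes>\<^bsub>G\<^esub> \<phi> b = \<phi> b \<otimes>\<^bsub>G\<^esub> (\<phi> a \<otimes>\<^bsub>G\<^esub> \<phi> c)" by simp
  have pow: "\<phi> c [^]\<^bsub>G\<^esub> p = \<one>\<^bsub>G\<^esub>" "\<phi> b [^]\<^bsub>G\<^esub> p = \<one>\<^bsub>G\<^esub>" "\<phi> a [^]\<^bsub>G\<^esub> p = \<phi> c [^]\<^bsub>G\<^esub> e"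
    using K.c_pow_p K.b_pow_p K.a_pow_p by (simp_all add: hom_nat_pow[symmetric])
  show ?thesis
    by unfold_locales (use K.prime_p gen central rel pow in auto)
qed

lemma nonabelian_heisenberg_if_iso:
  assumes "Factorial_Ring.prime p" and G: "group G" and iso: "G \<cong> H1 p \<or> G \<cong> H2 p"
    and nonabelian: "\<exists>x\<in>carrier G. \<exists>y\<in>carrier G. x \<otimes>\<^bsub>G\<^esub> y \<noteq> y \<otimes>\<^bsub>G\<^esub> x"
  shows "\<exists>e a b c. nonabelian_heisenberg G p e a b c"
proof -
  have "\<exists>e a b c. heisenberg_relations G p e a b c"
    using iso
  proof
    assume "G \<cong> H1 p"
    then have "H1 p \<cong> G" by (rule group.iso_sym[OF G])
    then obtain \<phi> where \<phi>: "\<phi> \<in> iso (H1 p) G" unfolding is_iso_def by blast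
    obtain e a b c where "heisenberg_relations (H1 p) p e a b c"
      using H1_heisenberg_relations[OF assms(1)] by blast
    from heisenberg_relations_iso[OF this G \<phi>]
    show ?thesis by blast
  next
    assume "G \<cong> H2 p"
    then have "H2 p \<cong> G" by (rule group.iso_sym[OF G])
    then obtain \<phi> where \<phi>: "\<phi> \<in> iso (H2 p) G" unfolding is_iso_def by blast
    obtain e a b c where "heisenberg_relations (H2 p) p e a b c"
      using H2_heisenberg_relations[OF assms(1)] by blast
    from heisenberg_relations_iso[OF this G \<phi>]
    show ?thesis by blast
  qed
  then show ?thesis
    using nonabelian by (auto simp: nonabelian_heisenberg_def nonabelian_heisenberg_axioms_def)
qed

section \<open>Basic sets of an S-ring\<close>

text \<open>
  A partition can be read off from the span of the indicator functions of its parts: this space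
  consists of functions that are constant on the parts, and it separates them.
\<close>

lemma partition_same_span:
  assumes P: "partition_on S P" and Q: "partition_on S Q"
    and span: "QH.span (set_sum ` P) = QH.span (set_sum ` Q)"
  shows "P = Q"
proof -
  have sub: "P \<subseteq> Q"
    if P: "partition_on S P" and Q: "partition_on S Q"
      and span: "QH.span (set_sum ` P) = QH.span (set_sum ` Q)" for P Q
  proof
    fix T assume T: "T \<in> P"
    then obtain x where x: "x \<in> T" using P by (metis partition_onD3 ex_in_conv)
    then have "x \<in> S" using P T by (auto simp: partition_on_def)
    then obtain U where U: "U \<in> Q" "x \<in> U" using Q by (auto simp: partition_on_def)
    have "set_sum T \<in> QH.span (set_sum ` Q)"
      unfolding span[symmetric] by (rule QH.span_base) (rule imageI[OF T])
    then have "set_sum T x = set_sum T y" if "y \<in> U" for y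
      using span_set_sum_constant[OF Q _ U that] by blast
    then have 1: "U \<subseteq> T" using x by (force simp: set_sum_def split: if_splits)
    have "set_sum U \<in> QH.span (set_sum ` P)"
      unfolding span by (rule QH.span_base) (rule imageI[OF U(1)])
    then have "set_sum U x = set_sum U y" if "y \<in> T" for y
      using span_set_sum_constant[OF P _ T x that] by blast
    then have 2: "T \<subseteq> U" using U by (force simp: set_sum_def split: if_splits)
    show "T \<in> Q" using 1 2 U by (metis subset_antisym)
  qed
  show ?thesis using sub[OF P Q span] sub[OF Q P span[symmetric]] by (rule subset_antisym)
qed

lemma (in group) ga_commutative_if_commutative:
  assumes "\<And>x y. x \<in> carrier G \<Longrightarrow> y \<in> carrier G \<Longrightarrow> x \<otimes> y = y \<otimes> x"
  shows "ga_commutative G A"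
proof -
  have "ga_mult G f g = ga_mult G g f" for f g
  proof
    fix x
    let ?S = "{(y, z). y \<in> carrier G \<and> z \<in> carrier G \<and> y \<otimes> z = x}"
    have "bij_betw prod.swap ?S ?S"
      by (intro bij_betwI[of _ _ _ prod.swap]) (auto simp: assms)
    from sum.reindex_bij_betw[OF this, of "\<lambda>(y, z). g y * f z"]
    show "ga_mult G f g x = ga_mult G g f x"
      by (simp add: ga_mult_def case_prod_beta mult.commute)
  qed
  then show ?thesis by (simp add: ga_commutative_def)
qed

locale s_ring = group H for H (structure) +
  fixes A :: "('a \<Rightarrow> rat) set"
  assumes S_ring: "S_ring H A" and finite_carrier: "finite (carrier H)"
begin

lemma basic_partition_Bsets: "basic_partition H A (Bsets H A)"
  using S_ring Bsets_eq unfolding S_ring_def by blast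

lemma partition_Bsets: "partition_on (carrier H) (Bsets H A)"
  using basic_partition_Bsets by (simp add: basic_partition_def)

definition bset :: "'a \<Rightarrow> 'a set" where
  "bset h = (THE T. T \<in> Bsets H A \<and> h \<in> T)"

lemma bset_eqI: "T \<in> Bsets H A \<Longrightarrow> h \<in> T \<Longrightarrow> bset h = T"
  unfolding bset_def
proof (rule the_equality)
  fix U
  assume "T \<in> Bsets H A" "h \<in> T" "U \<in> Bsets H A \<and> h \<in> U"
  then show "U = T"
    using partition_onD2[OF partition_Bsets] by (auto simp: disjoint_def)
qed simp

lemma bset_mem:
  assumes "h \<in> carrier H"
  shows bset_in_Bsets: "bset h \<in> Bsets H A" and self_in_bset: "h \<in> bset h"
proof -
  obtain T where "T \<in> Bsets H A" "h \<in> T"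
    using partition_onD1[OF partition_Bsets] assms by auto
  then show "bset h \<in> Bsets H A" "h \<in> bset h" using bset_eqI by metis+
qed

lemma Bsets_subset: "T \<in> Bsets H A \<Longrightarrow> T \<subseteq> carrier H"
  using partition_onD1[OF partition_Bsets] by auto

lemma Bsets_bset: "Bsets H A = bset ` carrier H"
proof
  show "Bsets H A \<subseteq> bset ` carrier H"
  proof
    fix T assume T: "T \<in> Bsets H A"
    then obtain h where "h \<in> T" using partition_onD3[OF partition_Bsets] by (metis ex_in_conv)
    then show "T \<in> bset ` carrier H" using T Bsets_subset bset_eqI by (metis image_eqI subsetD)
  qed
qed (auto simp: bset_in_Bsets)

lemma bset_carrier: "h \<in> carrier H \<Longrightarrow> g \<in> bset h \<Longrightarrow> g \<in> carrier H"
  using Bsets_subset bset_in_Bsets by blast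

lemma bset_eq: "h \<in> carrier H \<Longrightarrow> g \<in> bset h \<Longrightarrow> bset g = bset h"
  by (rule bset_eqI[OF bset_in_Bsets])

lemma finite_bset: "h \<in> carrier H \<Longrightarrow> finite (bset h)"
  using bset_carrier finite_carrier by (meson finite_subset subsetI)

lemma bset_one: "bset \<one> = {\<one>}"
  using basic_partition_Bsets by (intro bset_eqI) (auto simp: basic_partition_def)

lemma bset_inv:
  assumes "h \<in> carrier H"
  shows "bset (inv h) = (\<lambda>x. inv x) ` bset h"
proof (rule bset_eqI)
  have "set_inv (bset h) \<in> Bsets H A"
    using basic_partition_Bsets bset_in_Bsets[OF assms] by (simp add: basic_partition_def)
  then show "(\<lambda>x. inv x) ` bset h \<in> Bsets H A" by (simp add: SET_INV_def UNION_singleton_eq_range)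
  show "inv h \<in> (\<lambda>x. inv x) ` bset h" using self_in_bset[OF assms] by blast
qed

lemma ga_mult_set_sum:
  assumes "T \<subseteq> carrier H" "U \<subseteq> carrier H"
  shows "ga_mult H (set_sum T) (set_sum U) x = of_nat (card {(y, z). y \<in> T \<and> z \<in> U \<and> y \<otimes> z = x})"
proof -
  let ?S = "{(y, z). y \<in> carrier H \<and> z \<in> carrier H \<and> y \<otimes> z = x}"
  have fin: "finite ?S"
    by (rule finite_subset[of _ "carrier H \<times> carrier H"]) (auto simp: finite_carrier)
  have "ga_mult H (set_sum T) (set_sum U) x = (\<Sum>yz\<in>?S. if yz \<in> T \<times> U then 1 else 0)"
    unfolding ga_mult_def by (rule sum.cong) (auto simp: set_sum_def split: if_splits)
  also have "\<dots> = of_nat (card (?S \<inter> T \<times> U))"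
    using fin by (simp add: sum.If_cases)
  also have "?S \<inter> T \<times> U = {(y, z). y \<in> T \<and> z \<in> U \<and> y \<otimes> z = x}" using assms by auto
  finally show ?thesis .
qed

text \<open>
  The structure constants of the algebra. All further information about the algebra is drawn from the
  fact that these counts agree on a basic set.
\<close>

lemma product_count_constant:
  assumes T: "T \<in> Bsets H A" and U: "U \<in> Bsets H A" and h: "h \<in> carrier H" and g: "g \<in> bset h"
  shows "card {(y, z). y \<in> T \<and> z \<in> U \<and> y \<otimes> z = g} = card {(y, z). y \<in> T \<and> z \<in> U \<and> y \<otimes> z = h}"
proof -
  have A: "QH.span (set_sum ` Bsets H A) = A"
    using basic_partition_Bsets by (simp add: basic_partition_def)
  have "set_sum T \<in> QH.span (set_sum ` Bsets H A)" "set_sum U \<in> QH.span (set_sum ` Bsets H A)"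
    by (rule QH.span_base, rule imageI, fact)+
  then have "set_sum T \<in> A" "set_sum U \<in> A" unfolding A .
  then have "ga_mult H (set_sum T) (set_sum U) \<in> A"
    using S_ring by (simp add: S_ring_def ga_subalgebra_def)
  then have "ga_mult H (set_sum T) (set_sum U) g = ga_mult H (set_sum T) (set_sum U) h"
    using span_set_sum_constant[OF partition_Bsets _ bset_in_Bsets[OF h] g self_in_bset[OF h]]
    unfolding A by blast
  then show ?thesis using T U Bsets_subset by (simp add: ga_mult_set_sum)
qed

lemma bset_mult_subset:
  assumes "x \<in> carrier H" "y \<in> carrier H" "g \<in> bset (x \<otimes> y)"
  shows "\<exists>u\<in>bset x. \<exists>v\<in>bset y. g = u \<otimes> v"
proof -
  let ?N = "\<lambda>g. {(u, v). u \<in> bset x \<and> v \<in> bset y \<and> u \<otimes> v = g}"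
  have "card (?N g) = card (?N (x \<otimes> y))"
    using assms by (intro product_count_constant) (auto simp: bset_in_Bsets)
  moreover have "(x, y) \<in> ?N (x \<otimes> y)" using assms by (simp add: self_in_bset)
  moreover have "finite (?N (x \<otimes> y))"
    by (rule finite_subset[of _ "bset x \<times> bset y"]) (auto simp: finite_bset assms)
  ultimately have "card (?N g) \<noteq> 0" by auto
  then have "?N g \<noteq> {}" by force
  then show ?thesis by blast
qed

definition thin :: "'a set" where
  "thin = {z \<in> carrier H. bset z = {z}}"

lemma thin_inv: "z \<in> thin \<Longrightarrow> inv z \<in> thin"
  by (simp add: thin_def bset_inv)

text \<open>
  One inclusion holds because products of basic sets are unions of basic sets; applying it to
  \<open>h z\<close> and \<open>z\<^sup>-\<^sup>1\<close> gives the other one.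
\<close>

lemma bset_mult_thin:
  assumes h: "h \<in> carrier H" and z: "z \<in> thin"
  shows "bset (h \<otimes> z) = (\<lambda>x. x \<otimes> z) ` bset h"
proof -
  have sub: "bset (h \<otimes> z) \<subseteq> (\<lambda>x. x \<otimes> z) ` bset h" if h: "h \<in> carrier H" and z: "z \<in> thin" for h z
  proof
    fix g assume g: "g \<in> bset (h \<otimes> z)"
    have zz: "z \<in> carrier H" "bset z = {z}" using z by (auto simp: thin_def)
    show "g \<in> (\<lambda>x. x \<otimes> z) ` bset h" using bset_mult_subset[OF h zz(1) g] zz(2) by auto
  qed
  have zc: "z \<in> carrier H" using z by (simp add: thin_def)
  have "x \<otimes> z \<in> bset (h \<otimes> z)" if x: "x \<in> bset h" for x
  proof -
    have "bset h \<subseteq> (\<lambda>x. x \<otimes> inv z) ` bset (h \<otimes> z)"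
      using sub[OF _ thin_inv[OF z], of "h \<otimes> z"] h zc by (simp add: m_assoc)
    then obtain w where w: "w \<in> bset (h \<otimes> z)" "x = w \<otimes> inv z" using x by blast
    have "w \<in> carrier H" using bset_carrier[OF _ w(1)] h zc by simp
    then show ?thesis using w zc by (simp add: m_assoc)
  qed
  then show ?thesis using sub[OF h z] by blast
qed

lemma thin_subgroup: "subgroup thin H"
proof (rule subgroupI)
  show "thin \<subseteq> carrier H" by (auto simp: thin_def)
  show "thin \<noteq> {}" using bset_one by (auto simp: thin_def)
  show "inv z \<in> thin" if "z \<in> thin" for z using that by (rule thin_inv)
  show "z \<otimes> w \<in> thin" if "z \<in> thin" "w \<in> thin" for z w
    using that bset_mult_thin[of z w] by (simp add: thin_def)
qed

definition stab :: "'a \<Rightarrow> 'a set" where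
  "stab h = {s \<in> carrier H. (\<lambda>x. x \<otimes> s) ` bset h = bset h}"

lemma stab_St_R: "stab h = St_R H (bset h)"
  by (auto simp: stab_def St_R_def r_coset_def)

lemma stab_mult: "s \<in> stab h \<Longrightarrow> x \<in> bset h \<Longrightarrow> x \<otimes> s \<in> bset h"
  by (auto simp: stab_def)

lemma stabI:
  assumes h: "h \<in> carrier H" and s: "s \<in> carrier H" and "\<And>x. x \<in> bset h \<Longrightarrow> x \<otimes> s \<in> bset h"
  shows "s \<in> stab h"
proof -
  have "inj_on (\<lambda>x. x \<otimes> s) (bset h)"
    using bset_carrier[OF h] s by (auto simp: inj_on_def)
  moreover have "(\<lambda>x. x \<otimes> s) ` bset h \<subseteq> bset h" using assms by blast
  ultimately have "(\<lambda>x. x \<otimes> s) ` bset h = bset h"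
    using finite_bset[OF h] by (intro endo_inj_surj)
  then show ?thesis using s by (simp add: stab_def)
qed

lemma stab_subgroup:
  assumes h: "h \<in> carrier H"
  shows "subgroup (stab h) H"
proof (rule subgroupI)
  show "stab h \<subseteq> carrier H" by (auto simp: stab_def)
  have "\<one> \<in> stab h" using h bset_carrier[OF h] by (intro stabI) auto
  then show "stab h \<noteq> {}" by blast
  show "inv s \<in> stab h" if s: "s \<in> stab h" for s
  proof (rule stabI[OF h])
    have sc: "s \<in> carrier H" using s by (simp add: stab_def)
    then show "inv s \<in> carrier H" by simp
    fix x assume "x \<in> bset h"
    then obtain y where y: "y \<in> bset h" "x = y \<otimes> s" using s by (force simp: stab_def)
    then show "x \<otimes> inv s \<in> bset h" using bset_carrier[OF h y(1)] sc by (simp add: m_assoc)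
  qed
  show "s \<otimes> t \<in> stab h" if "s \<in> stab h" "t \<in> stab h" for s t
  proof (rule stabI[OF h])
    have st: "s \<in> carrier H" "t \<in> carrier H" using that by (auto simp: stab_def)
    then show "s \<otimes> t \<in> carrier H" by simp
    fix x assume x: "x \<in> bset h"
    then show "x \<otimes> (s \<otimes> t) \<in> bset h"
      using stab_mult[OF that(2) stab_mult[OF that(1) x]] st bset_carrier[OF h x] by (simp add: m_assoc)
  qed
qed

text \<open>
  An element \<open>s\<close> stabilizes \<open>bset h\<close> if and only if its coefficient in the product of the inverse of
  \<open>bset h\<close> with \<open>bset h\<close> has the largest possible value \<open>card (bset h)\<close>, and these coefficients are constant
  on basic sets.
\<close>

lemma bset_subset_stab:
  assumes h: "h \<in> carrier H" and s: "s \<in> stab h" and u: "u \<in> bset s"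
  shows "u \<in> stab h"
proof -
  have sc: "s \<in> carrier H" using s by (simp add: stab_def)
  have uc: "u \<in> carrier H" using bset_carrier[OF sc u] .
  let ?N = "\<lambda>v. {(y, z). y \<in> bset (inv h) \<and> z \<in> bset h \<and> y \<otimes> z = v}"
  \<comment> \<open>a pair with product \<open>v\<close> is \<open>(x\<^sup>-\<^sup>1, x v)\<close>\<close>
  have count: "card (?N v) = card {x \<in> bset h. x \<otimes> v \<in> bset h}" if v: "v \<in> carrier H" for v
  proof -
    have "?N v = (\<lambda>x. (inv x, x \<otimes> v)) ` {x \<in> bset h. x \<otimes> v \<in> bset h}"
    proof
      show "?N v \<subseteq> (\<lambda>x. (inv x, x \<otimes> v)) ` {x \<in> bset h. x \<otimes> v \<in> bset h}"
      proof
        fix yz assume "yz \<in> ?N v"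
        then obtain x z where xz: "yz = (inv x, z)" "x \<in> bset h" "z \<in> bset h" "inv x \<otimes> z = v"
          by (auto simp: bset_inv[OF h])
        have "x \<in> carrier H" "z \<in> carrier H" using xz bset_carrier[OF h] by auto
        then have "z = x \<otimes> v" using xz(4) inv_solve_left v by metis
        then show "yz \<in> (\<lambda>x. (inv x, x \<otimes> v)) ` {x \<in> bset h. x \<otimes> v \<in> bset h}"
          using xz by blast
      qed
      show "(\<lambda>x. (inv x, x \<otimes> v)) ` {x \<in> bset h. x \<otimes> v \<in> bset h} \<subseteq> ?N v"
        using bset_carrier[OF h] v by (auto simp: bset_inv[OF h] m_assoc[symmetric])
    qed
    moreover have "inj_on (\<lambda>x. (inv x, x \<otimes> v)) {x \<in> bset h. x \<otimes> v \<in> bset h}"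
      using bset_carrier[OF h] by (auto simp: inj_on_def)
    ultimately show ?thesis by (simp add: card_image)
  qed
  have "card (?N u) = card (?N s)"
    using h sc u by (intro product_count_constant) (auto simp: bset_in_Bsets)
  moreover have "{x \<in> bset h. x \<otimes> s \<in> bset h} = bset h" using stab_mult[OF s] by blast
  ultimately have "card {x \<in> bset h. x \<otimes> u \<in> bset h} = card (bset h)"
    using count sc uc by simp
  then have "{x \<in> bset h. x \<otimes> u \<in> bset h} = bset h"
    using finite_bset[OF h] by (intro card_subset_eq) auto
  then show ?thesis using h uc by (intro stabI) auto
qed

lemma O_theta_subgroup: "subgroup (O_theta H A) H"
  unfolding O_theta_def
proof (rule generate_is_subgroup)
  show "(\<Union>T\<in>Bsets H A. set_inv T <#> T) \<subseteq> carrier H"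
    using Bsets_subset by (fastforce simp: SET_INV_def set_mult_def)
qed

lemma bset_O_theta:
  assumes "h \<in> carrier H" "x \<in> bset h"
  shows "inv h \<otimes> x \<in> O_theta H A"
  unfolding O_theta_def
proof (rule generate.incl)
  have "inv h \<otimes> x \<in> set_inv (bset h) <#> bset h"
    using assms self_in_bset[OF assms(1)] by (auto simp: SET_INV_def set_mult_def)
  then show "inv h \<otimes> x \<in> (\<Union>T\<in>Bsets H A. set_inv T <#> T)"
    using bset_in_Bsets[OF assms(1)] by blast
qed

lemma basic_rel_bset:
  assumes "\<beta> \<in> carrier H" "\<gamma> \<in> carrier H"
  shows "basic_rel H A \<beta> \<gamma> = R_rel H (bset (\<gamma> \<otimes> inv \<beta>))"
  unfolding basic_rel_def
proof (rule the_equality)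
  have "\<gamma> = \<gamma> \<otimes> inv \<beta> \<otimes> \<beta>" using assms by (simp add: m_assoc)
  moreover have "\<gamma> \<otimes> inv \<beta> \<in> bset (\<gamma> \<otimes> inv \<beta>)" using assms by (simp add: self_in_bset)
  ultimately have "(\<beta>, \<gamma>) \<in> R_rel H (bset (\<gamma> \<otimes> inv \<beta>))"
    using assms unfolding R_rel_def by blast
  then show "R_rel H (bset (\<gamma> \<otimes> inv \<beta>)) \<in> R_rel H ` Bsets H A \<and> (\<beta>, \<gamma>) \<in> R_rel H (bset (\<gamma> \<otimes> inv \<beta>))"
    using assms by (simp add: bset_in_Bsets)
next
  fix r assume "r \<in> R_rel H ` Bsets H A \<and> (\<beta>, \<gamma>) \<in> r"
  then obtain T t where T: "T \<in> Bsets H A" "r = R_rel H T" "t \<in> T" "\<gamma> = t \<otimes> \<beta>"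
    by (auto simp: R_rel_def)
  have "t \<in> carrier H" using T Bsets_subset by blast
  then have "\<gamma> \<otimes> inv \<beta> = t" using T(4) assms(1) by (simp add: m_assoc)
  then show "r = R_rel H (bset (\<gamma> \<otimes> inv \<beta>))" using T bset_eqI by simp
qed

lemma basic_rel_eq_iff:
  assumes "\<beta> \<in> carrier H" "\<gamma> \<in> carrier H" "\<beta>' \<in> carrier H" "\<gamma>' \<in> carrier H"
  shows "basic_rel H A \<beta> \<gamma> = basic_rel H A \<beta>' \<gamma>' \<longleftrightarrow> bset (\<gamma> \<otimes> inv \<beta>) = bset (\<gamma>' \<otimes> inv \<beta>')"
proof
  assume "basic_rel H A \<beta> \<gamma> = basic_rel H A \<beta>' \<gamma>'"
  then have "R_rel H (bset (\<gamma> \<otimes> inv \<beta>)) = R_rel H (bset (\<gamma>' \<otimes> inv \<beta>'))"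
    using assms by (simp add: basic_rel_bset)
  moreover have "(\<one>, \<gamma> \<otimes> inv \<beta>) \<in> R_rel H (bset (\<gamma> \<otimes> inv \<beta>))"
  proof -
    have "(\<one>, \<gamma> \<otimes> inv \<beta> \<otimes> \<one>) \<in> R_rel H (bset (\<gamma> \<otimes> inv \<beta>))"
      unfolding R_rel_def using assms self_in_bset[of "\<gamma> \<otimes> inv \<beta>"] by blast
    then show ?thesis using assms by simp
  qed
  ultimately have "(\<one>, \<gamma> \<otimes> inv \<beta>) \<in> R_rel H (bset (\<gamma>' \<otimes> inv \<beta>'))" by simp
  then obtain t where t: "t \<in> bset (\<gamma>' \<otimes> inv \<beta>')" "\<gamma> \<otimes> inv \<beta> = t \<otimes> \<one>"
    by (auto simp: R_rel_def)
  have "t \<in> carrier H" using bset_carrier[OF _ t(1)] assms by simp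
  then have "\<gamma> \<otimes> inv \<beta> \<in> bset (\<gamma>' \<otimes> inv \<beta>')" using t by simp
  from bset_eq[OF _ this] show "bset (\<gamma> \<otimes> inv \<beta>) = bset (\<gamma>' \<otimes> inv \<beta>')" using assms by simp
qed (simp add: basic_rel_bset assms)

end

section \<open>The structure of the S-ring\<close>

lemma (in group) card_subgroup_dvd:
  assumes K: "subgroup K G" and J: "subgroup J G" and sub: "J \<subseteq> K"
  shows "card J dvd card K"
proof -
  have "subgroup J (G\<lparr>carrier := K\<rparr>)" using J K sub by (rule subgroup_incl)
  then have "card (rcosets\<^bsub>G\<lparr>carrier := K\<rparr>\<^esub> J) * card J = card K"
    using group.lagrange[OF subgroup_imp_group[OF K], of J] by (simp add: order_def)
  from dvd_triv_right[of "card J" "card (rcosets\<^bsub>G\<lparr>carrier := K\<rparr>\<^esub> J)", unfolded this]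
  show ?thesis .
qed

lemma (in group) subgroup_of_prime_order:
  assumes K: "subgroup K G" and J: "subgroup J G" and sub: "J \<subseteq> K"
    and p: "Factorial_Ring.prime (card K)" and s: "s \<in> J" "s \<noteq> \<one>"
  shows "J = K"
proof -
  have fin: "finite K" using p by (metis card.infinite not_prime_0)
  have "card J dvd card K" by (rule card_subgroup_dvd[OF K J sub])
  then have "card J = 1 \<or> card J = card K" using p by (metis prime_nat_iff)
  moreover have "card J \<noteq> 1"
  proof
    assume "card J = 1"
    then obtain x where "J = {x}" by (rule card_1_singletonE)
    then show False using s subgroup.one_closed[OF J] by auto
  qed
  ultimately show ?thesis using fin sub by (intro card_subset_eq) auto
qed

lemma (in group) subgroups_of_prime_order_eq:
  assumes K: "subgroup K G" and J: "subgroup J G" and card: "card K = card J"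
    and p: "Factorial_Ring.prime (card K)" and s: "s \<in> K" "s \<in> J" "s \<noteq> \<one>"
  shows "K = J"
proof -
  have KJ: "subgroup (K \<inter> J) G" by (rule subgroups_Inter_pair[OF K J])
  have "K \<inter> J = K" using subgroup_of_prime_order[OF K KJ _ p] s by blast
  moreover have "K \<inter> J = J"
    using subgroup_of_prime_order[OF J KJ, of s] p s card by auto
  ultimately show ?thesis by simp
qed

lemma (in group) conj_pow:
  assumes "h \<in> carrier G" "x \<in> carrier G"
  shows "(h \<otimes> x \<otimes> inv h) [^] (n::nat) = h \<otimes> x [^] n \<otimes> inv h"
proof (induction n)
  case (Suc n)
  have "(h \<otimes> x \<otimes> inv h) [^] Suc n = (h \<otimes> x [^] n \<otimes> inv h) \<otimes> (h \<otimes> x \<otimes> inv h)" using Suc by simp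
  also have "\<dots> = h \<otimes> x [^] n \<otimes> ((inv h \<otimes> h) \<otimes> x) \<otimes> inv h"
    using assms by (simp only: m_assoc m_closed inv_closed nat_pow_closed)
  also have "\<dots> = h \<otimes> x [^] Suc n \<otimes> inv h" using assms by (simp add: m_assoc)
  finally show ?case .
qed (use assms in simp)

text \<open>
  The hypotheses on the S-ring, with the group reduced to the two properties that are used.
  Hypothesis (B) appears as \<open>card_stabs\<close>; it will separate the cosets of \<open>L\<close> by their stabilizers.
\<close>

locale separated_s_ring = s_ring H A for H (structure) and A +
  fixes p :: nat and L
  assumes prime_p: "Factorial_Ring.prime p" and odd_p: "odd p"
    and order_H: "order H = p ^ 3"
    and p2_normal: "\<And>K x l. subgroup K H \<Longrightarrow> card K = p ^ 2 \<Longrightarrow> x \<in> carrier H \<Longrightarrow> l \<in> K \<Longrightarrow> x \<otimes> l \<otimes> inv x \<in> K"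
    and p2_commutative: "\<And>K x y. subgroup K H \<Longrightarrow> card K = p ^ 2 \<Longrightarrow> x \<in> K \<Longrightarrow> y \<in> K \<Longrightarrow> x \<otimes> y = y \<otimes> x"
    and card_Bsets: "\<And>h. h \<in> carrier H \<Longrightarrow> \<exists>k. card (bset h) = p ^ k"
    and L: "L = O_theta H A"
    and card_bset: "\<And>h. h \<in> carrier H - L \<Longrightarrow> card (bset h) = p"
    and card_stabs: "card (stab ` (carrier H - L)) = p - 1"
begin

lemma p_ge_3: "p \<ge> 3"
  using prime_ge_2_nat[OF prime_p] odd_p by (cases "p = 2") auto

lemma L_subgroup: "subgroup L H"
  unfolding L by (rule O_theta_subgroup)

lemma L_carrier: "l \<in> L \<Longrightarrow> l \<in> carrier H"
  by (rule subgroup.mem_carrier[OF L_subgroup])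

lemma finite_L: "finite L"
  using finite_carrier L_carrier by (meson finite_subset subsetI)

lemma L_mult: "l \<in> L \<Longrightarrow> m \<in> L \<Longrightarrow> l \<otimes> m \<in> L"
  by (rule subgroup.m_closed[OF L_subgroup])

lemma L_inv: "l \<in> L \<Longrightarrow> inv l \<in> L"
  by (rule subgroup.m_inv_closed[OF L_subgroup])

lemma bset_coset_L: "h \<in> carrier H \<Longrightarrow> x \<in> bset h \<Longrightarrow> inv h \<otimes> x \<in> L"
  unfolding L by (rule bset_O_theta)

lemma bset_subset_hL:
  assumes h: "h \<in> carrier H"
  shows "bset h \<subseteq> (\<lambda>l. h \<otimes> l) ` L"
proof
  fix x assume x: "x \<in> bset h"
  have "x = h \<otimes> (inv h \<otimes> x)" using h bset_carrier[OF h x] by (simp add: m_assoc[symmetric])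
  then show "x \<in> (\<lambda>l. h \<otimes> l) ` L" using bset_coset_L[OF h x] by (rule image_eqI)
qed

lemma hL_not_L:
  assumes h: "h \<in> carrier H - L" and l: "l \<in> L"
  shows "h \<otimes> l \<in> carrier H - L"
proof -
  have "h \<otimes> l \<notin> L"
  proof
    assume "h \<otimes> l \<in> L"
    then have "h \<otimes> l \<otimes> inv l \<in> L" using L_mult L_inv l by blast
    then show False using h l L_carrier[OF l] by (simp add: m_assoc)
  qed
  then show ?thesis using h L_carrier[OF l] by simp
qed

lemma inv_not_L: "h \<in> carrier H - L \<Longrightarrow> inv h \<in> carrier H - L"
  using L_inv[of "inv h"] by auto

lemma stab_subset_L:
  assumes h: "h \<in> carrier H"
  shows "stab h \<subseteq> L"
proof
  fix s assume s: "s \<in> stab h"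
  then have "s \<in> carrier H" by (simp add: stab_def)
  then show "s \<in> L"
    using bset_coset_L[OF h stab_mult[OF s self_in_bset[OF h]]] h by (simp add: m_assoc[symmetric])
qed

lemma card_hL: "h \<in> carrier H \<Longrightarrow> card ((\<lambda>l. h \<otimes> l) ` L) = card L"
  by (rule card_image) (auto simp: inj_on_def L_carrier)

lemma ex_not_L: "\<exists>h. h \<in> carrier H - L"
proof -
  have "carrier H - L \<noteq> {}"
  proof
    assume "carrier H - L = {}"
    then have "card (stab ` (carrier H - L)) = 0" by (simp only: image_empty card.empty)
    then show False using card_stabs p_ge_3 by linarith
  qed
  then show ?thesis by blast
qed

text \<open>
  A basic set outside \<open>L\<close> has \<open>p\<close> elements and lies in a coset of \<open>L\<close>. If \<open>L\<close> had order \<open>p\<close>, it would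
  be that coset, and \<open>L\<close> would be the only stabilizer, whereas there are \<open>p - 1 \<ge> 2\<close> of them.
\<close>

lemma card_L: "card L = p ^ 2"
proof -
  obtain h where h: "h \<in> carrier H - L" using ex_not_L by blast
  have "card L dvd order H"
    using lagrange[OF L_subgroup] by (metis dvd_triv_right)
  then obtain i where i: "i \<le> 3" "card L = p ^ i"
    using prime_p order_H divides_primepow_nat by metis
  have "i \<noteq> 3"
  proof
    assume "i = 3"
    then have "card L = card (carrier H)" using i order_H by (simp add: order_def)
    then have "L = carrier H"
      using L_carrier finite_carrier by (intro card_subset_eq) auto
    then show False using h by blast
  qed
  have "p \<le> card L"
    using card_mono[OF _ bset_subset_hL[of h]] h card_bset[OF h] card_hL[of h] finite_L by simp
  then have "i \<noteq> 0" using i p_ge_3 by (intro notI) simp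
  have "i \<noteq> 1"
  proof
    assume "i = 1"
    have "stab h = L" if h: "h \<in> carrier H - L" for h
    proof
      have hc: "h \<in> carrier H" using h by simp
      show "stab h \<subseteq> L" by (rule stab_subset_L[OF hc])
      have eq: "bset h = (\<lambda>l. h \<otimes> l) ` L"
        using bset_subset_hL[OF hc] card_bset[OF h] card_hL[OF hc] i \<open>i = 1\<close> finite_L
        by (intro card_subset_eq) auto
      show "L \<subseteq> stab h"
      proof
        fix l assume l: "l \<in> L"
        show "l \<in> stab h"
        proof (rule stabI[OF hc L_carrier[OF l]])
          fix x assume "x \<in> bset h"
          then obtain m where m: "m \<in> L" "x = h \<otimes> m" unfolding eq by blast
          then have "x \<otimes> l = h \<otimes> (m \<otimes> l)" using hc l L_carrier by (simp add: m_assoc)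
          then show "x \<otimes> l \<in> bset h" unfolding eq using L_mult[OF m(1) l] by blast
        qed
      qed
    qed
    then have "stab ` (carrier H - L) \<subseteq> {L}" by blast
    from card_mono[OF finite.insertI[OF finite.emptyI] this]
    show False using card_stabs p_ge_3 is_singletonI[of L, unfolded is_singleton_altdef] by linarith
  qed
  then have "i = 2" using i \<open>i \<noteq> 3\<close> \<open>i \<noteq> 0\<close> by linarith
  then show ?thesis using i by simp
qed

lemma L_normal: "x \<in> carrier H \<Longrightarrow> l \<in> L \<Longrightarrow> x \<otimes> l \<otimes> inv x \<in> L"
  by (rule p2_normal[OF L_subgroup card_L])

lemma L_comm: "l \<in> L \<Longrightarrow> m \<in> L \<Longrightarrow> l \<otimes> m = m \<otimes> l"
  by (rule p2_commutative[OF L_subgroup card_L])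

lemma thin_subset_L: "thin \<subseteq> L"
proof
  fix z assume z: "z \<in> thin"
  show "z \<in> L"
  proof (rule ccontr)
    assume "z \<notin> L"
    then have "card (bset z) = p" using z by (intro card_bset) (simp add: thin_def)
    then show False using z p_ge_3 by (simp add: thin_def)
  qed
qed

lemma thin_if_card_bset_less:
  assumes "h \<in> carrier H" "card (bset h) < p"
  shows "h \<in> thin"
proof -
  obtain k where k: "card (bset h) = p ^ k" using card_Bsets[OF assms(1)] by blast
  have "k = 0"
  proof (rule ccontr)
    assume "k \<noteq> 0"
    then have "p ^ 1 \<le> p ^ k" using p_ge_3 by (intro power_increasing) auto
    then show False using k assms(2) by simp
  qed
  then have "card (bset h) = 1" using k by simp
  then obtain x where "bset h = {x}" by (rule card_1_singletonE)
  then show ?thesis using self_in_bset[OF assms(1)] assms(1) by (simp add: thin_def)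
qed

text \<open>
  The class equation of the S-ring on \<open>L\<close>: the basic sets with more than one element have size
  divisible by \<open>p\<close>, so the number of remaining elements is divisible by \<open>p\<close> as well.
\<close>

lemma card_thin: "card thin = p \<or> card thin = p ^ 2"
proof -
  have union: "\<Union>(bset ` (L - thin)) = L - thin"
  proof
    show "\<Union>(bset ` (L - thin)) \<subseteq> L - thin"
    proof
      fix x assume "x \<in> \<Union>(bset ` (L - thin))"
      then obtain l where l: "l \<in> L" "l \<notin> thin" "x \<in> bset l" by blast
      have lc: "l \<in> carrier H" by (rule L_carrier[OF l(1)])
      have xc: "x \<in> carrier H" by (rule bset_carrier[OF lc l(3)])
      have "l \<otimes> (inv l \<otimes> x) \<in> L" using L_mult[OF l(1) bset_coset_L[OF lc l(3)]] .
      then have "x \<in> L" using lc xc by (simp add: m_assoc[symmetric])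
      moreover have "x \<notin> thin"
      proof
        assume "x \<in> thin"
        then have "bset l = {x}" using bset_eq[OF lc l(3)] by (simp add: thin_def)
        then show False using l \<open>x \<in> thin\<close> self_in_bset[OF lc] by auto
      qed
      ultimately show "x \<in> L - thin" by blast
    qed
    show "L - thin \<subseteq> \<Union>(bset ` (L - thin))" using self_in_bset L_carrier by blast
  qed
  have "p dvd card (\<Union>(bset ` (L - thin)))"
  proof (rule dvd_partition)
    show "finite (\<Union>(bset ` (L - thin)))" unfolding union using finite_L by simp
    show "\<forall>c\<in>bset ` (L - thin). p dvd card c"
    proof
      fix c assume "c \<in> bset ` (L - thin)"
      then obtain l where l: "l \<in> L" "l \<notin> thin" "c = bset l" by blast
      obtain k where k: "card (bset l) = p ^ k" using card_Bsets L_carrier[OF l(1)] by blast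
      have "k \<noteq> 0" using thin_if_card_bset_less[of l] L_carrier[OF l(1)] l(2) k p_ge_3 by (intro notI) simp
      then show "p dvd card c" using k l by (simp add: dvd_power)
    qed
    show "\<forall>c1\<in>bset ` (L - thin). \<forall>c2\<in>bset ` (L - thin). c1 \<noteq> c2 \<longrightarrow> c1 \<inter> c2 = {}"
      using partition_onD2[OF partition_Bsets] bset_in_Bsets L_carrier
      by (auto simp: disjoint_def)
  qed
  then have "p dvd card L - card thin"
    unfolding union using thin_subset_L finite_L by (simp add: card_Diff_subset finite_subset)
  moreover have le: "card thin \<le> card L" using thin_subset_L finite_L by (intro card_mono)
  ultimately have dvd: "p dvd card thin"
    using card_L by (metis dvd_diffD1 dvd_power zero_less_numeral)
  have "card thin dvd p ^ 2"
    using card_subgroup_dvd[OF L_subgroup thin_subgroup thin_subset_L] card_L by simp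
  then obtain i where i: "i \<le> 2" "card thin = p ^ i" using prime_p divides_primepow_nat by metis
  have "i \<noteq> 0" using dvd i p_ge_3 by (intro notI) simp
  then have "i = 1 \<or> i = 2" using i by linarith
  then show ?thesis using i by auto
qed

lemma stab_bset_eq: "h \<in> carrier H \<Longrightarrow> x \<in> bset h \<Longrightarrow> stab x = stab h"
  using bset_eq by (simp add: stab_def)

text \<open>
  Here \<open>bset (h z) = (bset h) z\<close>, so the stabilizers are conjugate under \<open>z\<close>, and both lie in the
  abelian group \<open>L\<close>.
\<close>

lemma stab_mult_thin:
  assumes h: "h \<in> carrier H" and z: "z \<in> thin"
  shows "stab (h \<otimes> z) = stab h"
proof -
  have sub: "stab h \<subseteq> stab (h \<otimes> z)" if h: "h \<in> carrier H" and z: "z \<in> thin" for h z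
  proof
    fix s assume s: "s \<in> stab h"
    have sL: "s \<in> L" "z \<in> L" using s stab_subset_L[OF h] z thin_subset_L by blast+
    have zc: "s \<in> carrier H" "z \<in> carrier H" using sL L_carrier by blast+
    show "s \<in> stab (h \<otimes> z)"
    proof (rule stabI)
      fix x assume "x \<in> bset (h \<otimes> z)"
      then obtain y where y: "y \<in> bset h" "x = y \<otimes> z" using bset_mult_thin[OF h z] by blast
      have "x \<otimes> s = y \<otimes> (z \<otimes> s)" using y zc bset_carrier[OF h y(1)] by (simp add: m_assoc)
      also have "\<dots> = (y \<otimes> s) \<otimes> z"
        using L_comm[OF sL] zc bset_carrier[OF h y(1)] by (simp add: m_assoc)
      finally show "x \<otimes> s \<in> bset (h \<otimes> z)"
        using stab_mult[OF s y(1)] bset_mult_thin[OF h z] by blast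
    qed (use h zc in auto)
  qed
  have zc: "z \<in> carrier H" using z by (simp add: thin_def)
  have "stab (h \<otimes> z) \<subseteq> stab h"
    using sub[of "h \<otimes> z" "inv z"] thin_inv[OF z] h zc by (simp add: m_assoc)
  then show ?thesis using sub[OF h z] by (rule subset_antisym)
qed

text \<open>
  The translates of \<open>bset h\<close> by thin elements are disjoint, so they already fill the coset \<open>h L\<close>, and
  translating does not change the stabilizer.
\<close>

lemma stab_coset_if_trivial:
  assumes h: "h \<in> carrier H - L" and l: "l \<in> L" and triv: "stab h \<inter> thin = {\<one>}"
  shows "stab (h \<otimes> l) = stab h"
proof -
  have hc: "h \<in> carrier H" using h by simp
  let ?f = "\<lambda>(x, z). x \<otimes> z"
  have thin_c: "z \<in> carrier H" if "z \<in> thin" for z using that by (simp add: thin_def)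
  have inj: "inj_on ?f (bset h \<times> thin)"
  proof (rule inj_onI)
    fix u v assume u: "u \<in> bset h \<times> thin" and v: "v \<in> bset h \<times> thin" and eq: "?f u = ?f v"
    obtain x z y w where uv: "u = (x, z)" "v = (y, w)" by (cases u, cases v)
    have xy: "x \<in> bset h" "y \<in> bset h" "z \<in> thin" "w \<in> thin" "x \<otimes> z = y \<otimes> w"
      using u v eq uv by auto
    have c: "x \<in> carrier H" "y \<in> carrier H" "z \<in> carrier H" "w \<in> carrier H"
      using xy bset_carrier[OF hc] thin_c by auto
    \<comment> \<open>\<open>t\<close> carries \<open>x\<close> to \<open>y\<close> inside the same basic set, so it is a thin stabilizing element\<close>
    define t where "t = z \<otimes> inv w"
    have t: "t \<in> thin" "t \<in> carrier H"
      using xy subgroup.m_closed[OF thin_subgroup] thin_inv c by (auto simp: t_def)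
    have "y = x \<otimes> z \<otimes> inv w" using xy(5) c by (simp add: m_assoc)
    then have y: "y = x \<otimes> t" using c by (simp add: t_def m_assoc)
    have "bset y = (\<lambda>g. g \<otimes> t) ` bset x" unfolding y by (rule bset_mult_thin[OF c(1) t(1)])
    then have "t \<in> stab h" using bset_eq[OF hc xy(1)] bset_eq[OF hc xy(2)] t by (simp add: stab_def)
    then have "t = \<one>" using triv t by blast
    then have "z = w" using c by (metis inv_equality inv_inv inv_closed r_inv t_def inv_solve_right l_one one_closed)
    then show "u = v" using xy(5) c uv by simp
  qed
  have sub: "?f ` (bset h \<times> thin) \<subseteq> (\<lambda>l. h \<otimes> l) ` L"
  proof
    fix g assume "g \<in> ?f ` (bset h \<times> thin)"
    then obtain x z where xz: "x \<in> bset h" "z \<in> thin" "g = x \<otimes> z" by auto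
    then obtain m where m: "m \<in> L" "x = h \<otimes> m" using bset_subset_hL[OF hc] by blast
    have "z \<in> L" using xz thin_subset_L by blast
    then have "g = h \<otimes> (m \<otimes> z)" "m \<otimes> z \<in> L" using xz m hc L_carrier L_mult by (auto simp: m_assoc)
    then show "g \<in> (\<lambda>l. h \<otimes> l) ` L" by blast
  qed
  have "card (?f ` (bset h \<times> thin)) = p * card thin"
    using inj card_bset[OF h] by (simp add: card_image card_cartesian_product)
  moreover have "card (?f ` (bset h \<times> thin)) \<le> p * p"
    using card_mono[OF _ sub] finite_L card_hL[OF hc] card_L by (simp add: power2_eq_square)
  moreover have "p * p \<le> p * card thin"
    using card_thin p_ge_3 by (auto simp: power2_eq_square)
  ultimately have "card (?f ` (bset h \<times> thin)) = card ((\<lambda>l. h \<otimes> l) ` L)"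
    unfolding card_hL[OF hc] card_L power2_eq_square by linarith
  then have "?f ` (bset h \<times> thin) = (\<lambda>l. h \<otimes> l) ` L"
    using sub finite_L by (intro card_subset_eq) auto
  then have "h \<otimes> l \<in> ?f ` (bset h \<times> thin)" using l by blast
  then obtain x z where xz: "x \<in> bset h" "z \<in> thin" "h \<otimes> l = x \<otimes> z" by auto
  then show ?thesis
    using stab_mult_thin[OF bset_carrier[OF hc xz(1)] xz(2)] stab_bset_eq[OF hc xz(1)] by simp
qed

lemma card_stab_le:
  assumes h: "h \<in> carrier H"
  shows "card (stab h) \<le> card (bset h)"
proof (rule card_inj_on_le[of "\<lambda>s. h \<otimes> s"])
  show "inj_on (\<lambda>s. h \<otimes> s) (stab h)" using h by (auto simp: inj_on_def stab_def)
  show "(\<lambda>s. h \<otimes> s) ` stab h \<subseteq> bset h" using stab_mult self_in_bset[OF h] by blast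
qed (rule finite_bset[OF h])

lemma finite_stab: "finite (stab h)"
  using finite_carrier by (simp add: stab_def)

lemma one_in_stab: "h \<in> carrier H \<Longrightarrow> \<one> \<in> stab h"
  by (rule subgroup.one_closed[OF stab_subgroup])

lemma stab_eq_thin_if_card_thin:
  assumes h: "h \<in> carrier H - L" and card: "card thin = p" and "stab h \<inter> thin \<noteq> {\<one>}"
  shows "stab h = thin"
proof -
  have hc: "h \<in> carrier H" using h by simp
  have st: "subgroup (stab h \<inter> thin) H"
    by (rule subgroups_Inter_pair[OF stab_subgroup[OF hc] thin_subgroup])
  have "\<one> \<in> stab h \<inter> thin" by (rule subgroup.one_closed[OF st])
  then obtain s where s: "s \<in> stab h \<inter> thin" "s \<noteq> \<one>" using assms(3) by blast
  then have "stab h \<inter> thin = thin"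
    using subgroup_of_prime_order[OF thin_subgroup st] card prime_p by blast
  then have sub: "thin \<subseteq> stab h" by blast
  moreover have "card (stab h) \<le> card thin" using card_stab_le[OF hc] card_bset[OF h] card by simp
  ultimately show ?thesis using finite_stab card_seteq by metis
qed

text \<open>
  The stabilizer is a union of basic sets and has at most \<open>p\<close> elements. A basic set in it that avoids \<open>1\<close> has
  fewer than \<open>p\<close> elements, hence consists of a thin element. So a nontrivial stabilizer contains
  nontrivial thin elements.
\<close>

lemma stab_if_card_thin:
  assumes h: "h \<in> carrier H - L" and card: "card thin = p"
  shows "stab h = {\<one>} \<or> stab h = thin"
proof (cases "stab h \<inter> thin = {\<one>}")
  case True
  have hc: "h \<in> carrier H" using h by simp
  have "s = \<one>" if s: "s \<in> stab h" for s
  proof (rule ccontr)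
    assume "s \<noteq> \<one>"
    have sc: "s \<in> carrier H" using s by (simp add: stab_def)
    have "\<one> \<notin> bset s"
      using bset_eq[OF sc, of \<one>] bset_one self_in_bset[OF sc] \<open>s \<noteq> \<one>\<close> by auto
    then have "bset s \<subset> stab h"
      using bset_subset_stab[OF hc s] one_in_stab[OF hc] by blast
    then have "card (bset s) < card (stab h)" by (rule psubset_card_mono[OF finite_stab])
    then have "card (bset s) < p" using card_stab_le[OF hc] card_bset[OF h] by simp
    then have "s \<in> thin" by (rule thin_if_card_bset_less[OF sc])
    then show False using s True \<open>s \<noteq> \<one>\<close> by blast
  qed
  then show ?thesis using one_in_stab[OF hc] by blast
qed (use stab_eq_thin_if_card_thin[OF h card] in blast)

lemma stab_coset:
  assumes h: "h \<in> carrier H - L" and l: "l \<in> L"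
  shows "stab (h \<otimes> l) = stab h"
proof (cases "card thin = p")
  case True
  have hl: "h \<otimes> l \<in> carrier H - L" by (rule hL_not_L[OF h l])
  show ?thesis
  proof (cases "stab h \<inter> thin = {\<one>}")
    case True
    then show ?thesis by (rule stab_coset_if_trivial[OF h l])
  next
    case nontriv: False
    show ?thesis
    proof (cases "stab (h \<otimes> l) \<inter> thin = {\<one>}")
      case True
      then have "stab (h \<otimes> l \<otimes> inv l) = stab (h \<otimes> l)"
        by (rule stab_coset_if_trivial[OF hl L_inv[OF l]])
      then show ?thesis using h L_carrier[OF l] by (simp add: m_assoc)
    next
      case False
      then show ?thesis
        using nontriv stab_eq_thin_if_card_thin[OF h] stab_eq_thin_if_card_thin[OF hl] \<open>card thin = p\<close> by simp
    qed
  qed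
next
  case False
  then have "card thin = card L" using card_thin card_L by simp
  then have "thin = L" using thin_subset_L finite_L by (intro card_subset_eq)
  then show ?thesis using h l by (intro stab_mult_thin) auto
qed

text \<open>
  There are \<open>p - 1\<close> left cosets of \<open>L\<close> other than \<open>L\<close>, and they are mapped onto a set of \<open>p - 1\<close> stabilizers.
\<close>

lemma stab_inj:
  assumes h: "h \<in> carrier H - L" and k: "k \<in> carrier H - L" and eq: "stab h = stab k"
  shows "inv h \<otimes> k \<in> L"
proof -
  define C where "C = lcosets L - {L}"
  have "card (lcosets L) * p ^ 2 = p ^ 3"
    using l_lagrange[OF finite_carrier L_subgroup] card_L order_H by simp
  then have card_lcosets: "card (lcosets L) = p"
    using p_ge_3 by (simp add: power2_eq_square power3_eq_cube)
  have one: "\<one> <# L = L" using L_carrier by (intro lcos_mult_one) blast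
  then have L_in: "L \<in> lcosets L" unfolding LCOSETS_def by (metis UN_iff one_closed singletonI)
  have "finite (lcosets L)" using card_lcosets p_ge_3 by (intro card_ge_0_finite) simp
  then have fin: "finite C" unfolding C_def by simp
  have card_C: "card C = p - 1" unfolding C_def using L_in card_lcosets by simp
  have mem: "x \<in> h <# L \<longleftrightarrow> (\<exists>l\<in>L. x = h \<otimes> l)" for x h by (auto simp: l_coset_def)
  have C_eq: "C = (\<lambda>h. h <# L) ` (carrier H - L)"
  proof
    show "C \<subseteq> (\<lambda>h. h <# L) ` (carrier H - L)"
    proof
      fix c assume c: "c \<in> C"
      then obtain x where x: "x \<in> carrier H" "c = x <# L" "c \<noteq> L" unfolding C_def LCOSETS_def by blast
      have "x \<notin> L"
      proof
        assume xL: "x \<in> L"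
        have "x <# L = L"
        proof
          show "x <# L \<subseteq> L" using xL L_mult by (auto simp: mem)
          show "L \<subseteq> x <# L"
          proof
            fix y assume y: "y \<in> L"
            have "y = x \<otimes> (inv x \<otimes> y)" using L_carrier xL y by (simp add: m_assoc[symmetric])
            then show "y \<in> x <# L" unfolding mem using L_mult[OF L_inv[OF xL] y] by blast
          qed
        qed
        then show False using x by simp
      qed
      then show "c \<in> (\<lambda>h. h <# L) ` (carrier H - L)" using x by blast
    qed
    show "(\<lambda>h. h <# L) ` (carrier H - L) \<subseteq> C"
    proof
      fix c assume "c \<in> (\<lambda>h. h <# L) ` (carrier H - L)"
      then obtain x where x: "x \<in> carrier H" "x \<notin> L" "c = x <# L" by blast
      have "x \<in> x <# L" using lcos_self[OF x(1) L_subgroup] .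
      then show "c \<in> C" using x unfolding C_def LCOSETS_def by blast
    qed
  qed
  \<comment> \<open>the stabilizer of a coset, well defined by \<open>stab_coset\<close>\<close>
  define F where "F c = stab (SOME x. x \<in> c)" for c
  have F: "F (x <# L) = stab x" if x: "x \<in> carrier H - L" for x
  proof -
    have "x \<in> x <# L" using lcos_self[OF _ L_subgroup] x by simp
    then have "(SOME y. y \<in> x <# L) \<in> x <# L" by (rule someI)
    then obtain l where "l \<in> L" "(SOME y. y \<in> x <# L) = x \<otimes> l" unfolding mem by blast
    then show ?thesis unfolding F_def using stab_coset[OF x] by simp
  qed
  have "F ` C = stab ` (carrier H - L)" unfolding C_eq image_image by (rule image_cong) (simp_all add: F)
  then have inj: "inj_on F C" using fin card_C card_stabs by (intro eq_card_imp_inj_on) auto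
  have C: "h <# L \<in> C" "k <# L \<in> C" using h k unfolding C_eq by blast+
  have "F (h <# L) = F (k <# L)" using F[OF h] F[OF k] eq by simp
  then have "h <# L = k <# L" using C by (rule inj_onD[OF inj])
  moreover have "k \<in> k <# L" using lcos_self[OF _ L_subgroup] k by simp
  ultimately have "k \<in> h <# L" by simp
  then obtain l where "l \<in> L" "k = h \<otimes> l" unfolding mem by blast
  then show ?thesis using h L_carrier by (simp add: m_assoc[symmetric])
qed

text \<open>
  The group has odd order, so \<open>h\<close> is a power of its square.
\<close>

lemma square_in_L:
  assumes h: "h \<in> carrier H" and hh: "h \<otimes> h \<in> L"
  shows "h \<in> L"
proof -
  have "odd (p ^ 3)" using odd_p by simp
  then obtain k where k: "p ^ 3 = 2 * k + 1" by (rule oddE)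
  have "h [^] (2 * k + 1) = \<one>" using pow_order_eq_1[OF h] order_H k by simp
  then have "h [^] (2 * k) \<otimes> h = \<one>" using h by simp
  then have "inv h = h [^] (2 * k)" using h by (intro inv_equality) auto
  also have "\<dots> = (h \<otimes> h) [^] k"
  proof -
    have "h \<otimes> h = h [^] (2::nat)" using h by (simp add: numeral_2_eq_2)
    then show ?thesis using h by (simp add: nat_pow_pow)
  qed
  also have "\<dots> \<in> L" using hh by (induction k) (auto intro: L_mult subgroup.one_closed[OF L_subgroup])
  finally show ?thesis using L_inv[of "inv h"] h by simp
qed

text \<open>
  Suppose that there are only \<open>p\<close> thin elements. Then every stabilizer outside \<open>L\<close> is trivial or the
  thin subgroup. If \<open>h\<close> has the thin subgroup as its stabilizer, then the inverse of \<open>bset h\<close> also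
  has a nontrivial stabilizer, so \<open>h\<close> and \<open>h\<^sup>-\<^sup>1\<close> lie in the same coset of \<open>L\<close>, which is impossible in a group
  of odd order. Hence all stabilizers are trivial, contradicting that there are at least two.
\<close>

lemma thin_eq_L: "thin = L"
proof (rule ccontr)
  assume ne: "thin \<noteq> L"
  have "card thin \<noteq> card L" using ne thin_subset_L finite_L card_subset_eq by metis
  then have card: "card thin = p" using card_thin card_L by simp
  have not_thin: "stab h \<noteq> thin" if h: "h \<in> carrier H - L" for h
  proof
    assume st: "stab h = thin"
    have hc: "h \<in> carrier H" using h by simp
    have hi: "inv h \<in> carrier H - L" by (rule inv_not_L[OF h])
    have "card (thin - {\<one>}) > 0" using card p_ge_3 subgroup.one_closed[OF thin_subgroup] by simp
    then obtain w where w: "w \<in> thin" "w \<noteq> \<one>" by (metis DiffE card_gt_0_iff ex_in_conv singletonI)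
    have wc: "w \<in> carrier H" using w by (simp add: thin_def)
    have sub: "(\<lambda>z. h \<otimes> z) ` thin \<subseteq> bset h"
      using stab_mult[OF _ self_in_bset[OF hc]] st by blast
    have "inj_on (\<lambda>z. h \<otimes> z) thin" using hc by (auto simp: inj_on_def thin_def)
    then have "card ((\<lambda>z. h \<otimes> z) ` thin) = card (bset h)" using card card_bset[OF h] by (simp add: card_image)
    then have eq: "bset h = (\<lambda>z. h \<otimes> z) ` thin"
      using sub finite_bset[OF hc] by (intro card_subset_eq[symmetric])
    have bset_inv_h: "bset (inv h) = (\<lambda>z. inv (h \<otimes> z)) ` thin"
      unfolding bset_inv[OF hc] eq image_image ..
    \<comment> \<open>\<open>bset (h\<^sup>-\<^sup>1)\<close> is a right coset of the thin subgroup, stabilized by the conjugate of that subgroup\<close>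
    have "h \<otimes> w \<otimes> inv h \<in> stab (inv h)"
    proof (rule stabI)
      fix x assume "x \<in> bset (inv h)"
      then obtain z where z: "z \<in> thin" "x = inv (h \<otimes> z)" unfolding bset_inv_h by blast
      have zc: "z \<in> carrier H" using z by (simp add: thin_def)
      have "inv h \<otimes> (h \<otimes> (w \<otimes> inv h)) = w \<otimes> inv h" using hc wc by (simp add: m_assoc[symmetric])
      then have "x \<otimes> (h \<otimes> w \<otimes> inv h) = inv (h \<otimes> (inv w \<otimes> z))"
        unfolding z(2) using hc wc zc by (simp add: inv_mult_group m_assoc)
      moreover have "inv w \<otimes> z \<in> thin"
        using subgroup.m_closed[OF thin_subgroup thin_inv[OF w(1)] z(1)] .
      ultimately show "x \<otimes> (h \<otimes> w \<otimes> inv h) \<in> bset (inv h)" unfolding bset_inv_h by (rule image_eqI)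
    qed (use hc wc in auto)
    moreover have "h \<otimes> w \<otimes> inv h \<noteq> \<one>"
    proof
      assume "h \<otimes> w \<otimes> inv h = \<one>"
      then have "h \<otimes> w \<otimes> inv h \<otimes> h = h" using hc by simp
      then have "h \<otimes> w = h" using hc wc by (simp add: m_assoc)
      then show False using hc wc w by simp
    qed
    ultimately have "stab (inv h) = thin" using stab_if_card_thin[OF hi card] by blast
    then have "inv (inv h) \<otimes> h \<in> L" using stab_inj[OF hi h] st by simp
    then show False using square_in_L[OF hc] h by simp
  qed
  have "stab ` (carrier H - L) \<subseteq> {{\<one>}}" using not_thin stab_if_card_thin card by blast
  from card_mono[OF finite.insertI[OF finite.emptyI] this]
  show False using card_stabs p_ge_3 is_singletonI[of "{\<one>}", unfolded is_singleton_altdef] by linarith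
qed

lemma bset_L: "l \<in> L \<Longrightarrow> bset l = {l}"
  using thin_eq_L by (auto simp: thin_def)

lemma bset_stab:
  assumes h: "h \<in> carrier H" and s: "s \<in> carrier H"
  shows "h \<otimes> s \<in> bset h \<longleftrightarrow> s \<in> stab h"
proof
  assume hs: "h \<otimes> s \<in> bset h"
  have "s \<in> L" using bset_coset_L[OF h hs] h s by (simp add: m_assoc[symmetric])
  then have "bset (h \<otimes> s) = (\<lambda>x. x \<otimes> s) ` bset h" using thin_eq_L by (intro bset_mult_thin[OF h]) simp
  then show "s \<in> stab h" using bset_eq[OF h hs] s by (simp add: stab_def)
qed (use stab_mult self_in_bset[OF h] in blast)

lemma bset_eq_coset:
  assumes h: "h \<in> carrier H"
  shows "bset h = (\<lambda>s. h \<otimes> s) ` stab h"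
proof
  show "bset h \<subseteq> (\<lambda>s. h \<otimes> s) ` stab h"
  proof
    fix x assume x: "x \<in> bset h"
    have xc: "x \<in> carrier H" by (rule bset_carrier[OF h x])
    have eq: "x = h \<otimes> (inv h \<otimes> x)" using h xc by (simp add: m_assoc[symmetric])
    then have "inv h \<otimes> x \<in> stab h" using bset_stab[OF h, of "inv h \<otimes> x"] x xc h by simp
    then show "x \<in> (\<lambda>s. h \<otimes> s) ` stab h" using eq by blast
  qed
qed (use stab_mult self_in_bset[OF h] in blast)

lemma card_stab:
  assumes h: "h \<in> carrier H - L"
  shows "card (stab h) = p"
proof -
  have "inj_on (\<lambda>s. h \<otimes> s) (stab h)" using h by (auto simp: inj_on_def stab_def)
  then have "card (stab h) = card (bset h)" using h by (simp add: bset_eq_coset card_image)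
  then show ?thesis using card_bset[OF h] by simp
qed

lemma stab_inter_trivial:
  assumes h: "h \<in> carrier H - L" and k: "k \<in> carrier H - L"
    and "inv h \<otimes> k \<notin> L" and s: "s \<in> stab h" "s \<in> stab k"
  shows "s = \<one>"
proof (rule ccontr)
  assume "s \<noteq> \<one>"
  then have "stab h = stab k"
    using h k s card_stab[OF h] card_stab[OF k] prime_p
    by (intro subgroups_of_prime_order_eq[OF stab_subgroup stab_subgroup]) auto
  then show False using stab_inj[OF h k] assms(3) by blast
qed

text \<open>
  The case \<open>s = 1\<close> also has a positive exponent, namely a multiple of the group order; this is the form
  in which orbits under iteration are described.
\<close>

lemma stab_power:
  assumes h: "h \<in> carrier H - L" and r: "r \<in> stab h" "r \<noteq> \<one>" and s: "s \<in> stab h"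
  shows "\<exists>n::nat. n > 0 \<and> s = r [^] n"
proof -
  have hc: "h \<in> carrier H" using h by simp
  have rc: "r \<in> carrier H" using r by (simp add: stab_def)
  have "generate H {r} \<subseteq> stab h"
    using r by (intro generate_subgroup_incl stab_subgroup[OF hc]) auto
  moreover have "r \<in> generate H {r}" by (rule generate.incl) simp
  moreover have "subgroup (generate H {r}) H" using rc by (intro generate_is_subgroup) simp
  ultimately have "generate H {r} = stab h"
    using subgroup_of_prime_order[OF stab_subgroup[OF hc]] card_stab[OF h] prime_p r(2) by simp
  then obtain n :: nat where n: "s = r [^] n"
    using s generate_pow_on_finite_carrier[OF finite_carrier rc] by blast
  have "order H > 0" using order_gt_0_iff_finite finite_carrier by simp
  moreover have "r [^] (n + order H) = s"
    using rc n pow_order_eq_1[OF rc] by (simp add: nat_pow_mult[symmetric])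
  ultimately show ?thesis by (metis add_gr_0)
qed

end

section \<open>Point stabilizers and automorphisms of the scheme\<close>

lemma subgroup_BijGroup_compose:
  assumes "subgroup G (BijGroup S)" "g \<in> G" "k \<in> G"
  shows "compose S g k \<in> G"
  using subgroup.m_closed[OF assms] subgroup.mem_carrier[OF assms(1)] assms(2,3)
  by (simp add: BijGroup_def)

lemma subgroup_BijGroup_inv:
  assumes "subgroup G (BijGroup S)" "g \<in> G"
  shows "(\<lambda>x\<in>S. inv_into S g x) \<in> G"
proof -
  have "g \<in> Bij S" using subgroup.mem_carrier[OF assms] by (simp add: BijGroup_def)
  from inv_BijGroup[OF this] show ?thesis using subgroup.m_inv_closed[OF assms] by simp
qed

lemma subgroup_BijGroup_id:
  assumes "subgroup G (BijGroup S)"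
  shows "(\<lambda>x\<in>S. x) \<in> G"
  using subgroup.one_closed[OF assms] by (simp add: BijGroup_def)

lemma subgroup_BijGroup_bij:
  assumes "subgroup G (BijGroup S)" "g \<in> G"
  shows "bij_betw g S S"
  using subgroup.mem_carrier[OF assms] by (simp add: BijGroup_def Bij_def)

text \<open>
  For \<open>a = 1\<close> these are the sets whose indicator functions span the transitivity module of a Schurian
  S-ring (\<open>transitivity_module_point_orbit\<close>).
\<close>

definition point_orbit :: "('a \<Rightarrow> 'a) set \<Rightarrow> 'a \<Rightarrow> 'a \<Rightarrow> 'a set" where
  "point_orbit G a x = {g x | g. g \<in> G \<and> g a = a}"

lemma point_orbit_self:
  assumes G: "subgroup G (BijGroup S)" and "a \<in> S" "x \<in> S"
  shows "x \<in> point_orbit G a x"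
  unfolding point_orbit_def
  by (intro CollectI exI[of _ "\<lambda>x\<in>S. x"]) (simp add: assms subgroup_BijGroup_id[OF G])

lemma partition_point_orbit:
  assumes G: "subgroup G (BijGroup S)" and a: "a \<in> S"
  shows "partition_on S (point_orbit G a ` S)"
proof (rule partition_onI)
  have self: "x \<in> point_orbit G a x" if "x \<in> S" for x
    by (rule point_orbit_self[OF G a that])
  have sub: "point_orbit G a x \<subseteq> S" if "x \<in> S" for x
    using subgroup_BijGroup_bij[OF G] that unfolding point_orbit_def bij_betw_def by blast
  show "\<Union>(point_orbit G a ` S) = S" using self sub by blast
  show "{} \<notin> point_orbit G a ` S" using self by blast
  have trans: "z \<in> point_orbit G a x" if x: "x \<in> S" and y: "y \<in> point_orbit G a x" and z: "z \<in> point_orbit G a y" for x y z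
  proof -
    obtain g k where g: "g \<in> G" "g a = a" "y = g x" and k: "k \<in> G" "k a = a" "z = k y"
      using y z unfolding point_orbit_def by blast
    have "compose S k g \<in> G" by (rule subgroup_BijGroup_compose[OF G k(1) g(1)])
    moreover have "compose S k g a = a" "compose S k g x = z"
      using g k a x by (simp_all add: compose_def)
    ultimately show ?thesis unfolding point_orbit_def by blast
  qed
  have sym: "x \<in> point_orbit G a y" if x: "x \<in> S" and y: "y \<in> point_orbit G a x" for x y
  proof -
    obtain g where g: "g \<in> G" "g a = a" "y = g x"
      using y unfolding point_orbit_def by blast
    have bij: "bij_betw g S S" by (rule subgroup_BijGroup_bij[OF G g(1)])
    have "(\<lambda>x\<in>S. inv_into S g x) \<in> G" by (rule subgroup_BijGroup_inv[OF G g(1)])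
    moreover have "(\<lambda>x\<in>S. inv_into S g x) a = a"
      using bij_betw_inv_into_left[OF bij a] a g by simp
    moreover have "(\<lambda>x\<in>S. inv_into S g x) y = x"
      using bij_betw_inv_into_left[OF bij x] sub[OF x] y g by auto
    ultimately show ?thesis unfolding point_orbit_def by blast
  qed
  fix U V
  assume "U \<in> point_orbit G a ` S" "V \<in> point_orbit G a ` S" "U \<noteq> V"
  then obtain x y where xy: "x \<in> S" "y \<in> S" "U = point_orbit G a x" "V = point_orbit G a y" by blast
  have "U = V" if "z \<in> U" "z \<in> V" for z
  proof -
    have eq: "point_orbit G a z = point_orbit G a x" if x: "x \<in> S" and z: "z \<in> point_orbit G a x" for x
    proof (rule subset_antisym)
      have zS: "z \<in> S" using sub[OF x] z by blast
      show "point_orbit G a z \<subseteq> point_orbit G a x" by (rule subsetI) (rule trans[OF x z])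
      show "point_orbit G a x \<subseteq> point_orbit G a z" by (rule subsetI) (rule trans[OF zS sym[OF x z]])
    qed
    show ?thesis using eq[OF xy(1)] eq[OF xy(2)] that xy(3,4) by simp
  qed
  then show "disjnt U V" using \<open>U \<noteq> V\<close> unfolding disjnt_def by blast
qed

lemma transitivity_module_point_orbit:
  "transitivity_module H (one_stabilizer H G) = QH.span (set_sum ` point_orbit G \<one>\<^bsub>H\<^esub> ` carrier H)"
proof -
  have "orbits (BijGroup (carrier H)\<lparr>carrier := one_stabilizer H G\<rparr>) (carrier H) (\<lambda>g. g) =
      point_orbit G \<one>\<^bsub>H\<^esub> ` carrier H"
    unfolding orbits_def Group_Action.orbit_def one_stabilizer_def stabilizer_def point_orbit_def
    by auto
  then show ?thesis by (simp add: transitivity_module_def)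
qed

context s_ring begin

text \<open>
  Two partitions with the same span agree, so the algebra is the transitivity module exactly if its
  basic sets are the orbits.
\<close>

lemma Schurian_iff:
  "Schurian H A \<longleftrightarrow> (\<exists>G. subgroup G (BijGroup (carrier H)) \<and> right_regular H \<subseteq> G \<and>
     (\<forall>h\<in>carrier H. bset h = point_orbit G \<one> h))"
proof -
  have A: "QH.span (set_sum ` Bsets H A) = A"
    using basic_partition_Bsets by (simp add: basic_partition_def)
  have "A = transitivity_module H (one_stabilizer H G) \<longleftrightarrow> (\<forall>h\<in>carrier H. bset h = point_orbit G \<one> h)"
    if G: "subgroup G (BijGroup (carrier H))" for G
  proof
    assume "A = transitivity_module H (one_stabilizer H G)"
    then have "QH.span (set_sum ` Bsets H A) = QH.span (set_sum ` point_orbit G \<one> ` carrier H)"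
      unfolding A transitivity_module_point_orbit .
    then have eq: "Bsets H A = point_orbit G \<one> ` carrier H"
      by (rule partition_same_span[OF partition_Bsets partition_point_orbit[OF G one_closed]])
    show "\<forall>h\<in>carrier H. bset h = point_orbit G \<one> h"
    proof
      fix h assume h: "h \<in> carrier H"
      show "bset h = point_orbit G \<one> h"
      proof (rule bset_eqI)
        show "point_orbit G \<one> h \<in> Bsets H A" unfolding eq using h by (rule imageI)
        show "h \<in> point_orbit G \<one> h" by (rule point_orbit_self[OF G one_closed h])
      qed
    qed
  next
    assume orb: "\<forall>h\<in>carrier H. bset h = point_orbit G \<one> h"
    have "Bsets H A = point_orbit G \<one> ` carrier H"
      unfolding Bsets_bset by (rule image_cong[OF refl]) (rule bspec[OF orb])
    from A[unfolded this] show "A = transitivity_module H (one_stabilizer H G)"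
      unfolding transitivity_module_point_orbit by (rule HOL.sym)
  qed
  then show ?thesis unfolding Schurian_def by blast
qed

lemma right_translation_in_right_regular:
  "g \<in> carrier H \<Longrightarrow> (\<lambda>h\<in>carrier H. h \<otimes> g) \<in> right_regular H"
  unfolding right_regular_def by blast

text \<open>
  Conjugating by right translations, \<open>x \<mapsto> g (x \<beta>) (g \<beta>)\<^sup>-\<^sup>1\<close> lies in \<open>G\<close>, fixes \<open>1\<close> and sends \<open>\<gamma> \<beta>\<^sup>-\<^sup>1\<close> to
  \<open>(g \<gamma>) (g \<beta>)\<^sup>-\<^sup>1\<close>.
\<close>

lemma relation_preserved:
  assumes G: "subgroup G (BijGroup (carrier H))" and reg: "right_regular H \<subseteq> G"
    and orb: "\<forall>h\<in>carrier H. bset h = point_orbit G \<one> h"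
    and g: "g \<in> G" and \<beta>: "\<beta> \<in> carrier H" and \<gamma>: "\<gamma> \<in> carrier H"
  shows "bset (g \<gamma> \<otimes> inv (g \<beta>)) = bset (\<gamma> \<otimes> inv \<beta>)"
proof -
  have gc: "g x \<in> carrier H" if "x \<in> carrier H" for x
    using subgroup_BijGroup_bij[OF G g] that by (auto simp: bij_betw_def)
  define k where "k = compose (carrier H) (\<lambda>h\<in>carrier H. h \<otimes> inv (g \<beta>)) (compose (carrier H) g (\<lambda>h\<in>carrier H. h \<otimes> \<beta>))"
  have "k \<in> G"
    unfolding k_def
    using g reg right_translation_in_right_regular[of "inv (g \<beta>)"] right_translation_in_right_regular[OF \<beta>] gc[OF \<beta>]
    by (intro subgroup_BijGroup_compose[OF G]) auto
  moreover have k: "k x = g (x \<otimes> \<beta>) \<otimes> inv (g \<beta>)" if "x \<in> carrier H" for x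
    using that \<beta> gc by (simp add: k_def compose_def)
  moreover have "k \<one> = \<one>" using k[of \<one>] \<beta> gc by simp
  ultimately have "k (\<gamma> \<otimes> inv \<beta>) \<in> point_orbit G \<one> (\<gamma> \<otimes> inv \<beta>)"
    unfolding point_orbit_def by blast
  then have "k (\<gamma> \<otimes> inv \<beta>) \<in> bset (\<gamma> \<otimes> inv \<beta>)"
    using orb \<beta> \<gamma> by simp
  then have "g \<gamma> \<otimes> inv (g \<beta>) \<in> bset (\<gamma> \<otimes> inv \<beta>)"
    using k[of "\<gamma> \<otimes> inv \<beta>"] \<beta> \<gamma> by (simp add: m_assoc)
  from bset_eq[OF _ this] show ?thesis using \<beta> \<gamma> by simp
qed

text \<open>
  The permutations that preserve every basic relation, by \<open>basic_rel_eq_iff\<close>. This is the largest group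
  that can show the S-ring to be Schurian.
\<close>

definition scheme_automorphisms :: "('a \<Rightarrow> 'a) set" where
  "scheme_automorphisms = {g \<in> Bij (carrier H).
     \<forall>\<beta>\<in>carrier H. \<forall>\<gamma>\<in>carrier H. bset (g \<gamma> \<otimes> inv (g \<beta>)) = bset (\<gamma> \<otimes> inv \<beta>)}"

lemma scheme_automorphisms_subgroup: "subgroup scheme_automorphisms (BijGroup (carrier H))"
proof (rule group.subgroupI[OF group_BijGroup])
  show "scheme_automorphisms \<subseteq> carrier (BijGroup (carrier H))"
    by (auto simp: scheme_automorphisms_def BijGroup_def)
  have "(\<lambda>h\<in>carrier H. h) \<in> scheme_automorphisms"
    by (auto simp: scheme_automorphisms_def id_Bij)
  then show "scheme_automorphisms \<noteq> {}" by blast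
next
  fix g assume g: "g \<in> scheme_automorphisms"
  then have Bij: "g \<in> Bij (carrier H)" by (simp add: scheme_automorphisms_def)
  then have bij: "bij_betw g (carrier H) (carrier H)" by (simp add: Bij_def)
  let ?k = "\<lambda>x\<in>carrier H. inv_into (carrier H) g x"
  have kc: "?k x \<in> carrier H" "g (?k x) = x" if "x \<in> carrier H" for x
    using that Bij_inv_into_mem[OF Bij that] bij_betw_inv_into_right[OF bij that] by simp_all
  have "bset (?k \<gamma> \<otimes> inv (?k \<beta>)) = bset (\<gamma> \<otimes> inv \<beta>)" if "\<beta> \<in> carrier H" "\<gamma> \<in> carrier H" for \<beta> \<gamma>
  proof -
    have "bset (g (?k \<gamma>) \<otimes> inv (g (?k \<beta>))) = bset (?k \<gamma> \<otimes> inv (?k \<beta>))"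
      using g kc(1)[OF that(1)] kc(1)[OF that(2)] unfolding scheme_automorphisms_def by blast
    then show ?thesis unfolding kc(2)[OF that(1)] kc(2)[OF that(2)] by (rule sym)
  qed
  then have "?k \<in> scheme_automorphisms"
    unfolding scheme_automorphisms_def using restrict_inv_into_Bij[OF Bij] by blast
  then show "inv\<^bsub>BijGroup (carrier H)\<^esub> g \<in> scheme_automorphisms" by (simp add: inv_BijGroup[OF Bij])
next
  fix g k assume g: "g \<in> scheme_automorphisms" and k: "k \<in> scheme_automorphisms"
  then have Bij: "g \<in> Bij (carrier H)" "k \<in> Bij (carrier H)" by (simp_all add: scheme_automorphisms_def)
  have kc: "k x \<in> carrier H" if "x \<in> carrier H" for x using Bij_imp_funcset[OF Bij(2)] that by blast
  have "bset (g (k \<gamma>) \<otimes> inv (g (k \<beta>))) = bset (\<gamma> \<otimes> inv \<beta>)" if "\<beta> \<in> carrier H" "\<gamma> \<in> carrier H" for \<beta> \<gamma>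
  proof -
    have "bset (g (k \<gamma>) \<otimes> inv (g (k \<beta>))) = bset (k \<gamma> \<otimes> inv (k \<beta>))"
      using g kc[OF that(1)] kc[OF that(2)] unfolding scheme_automorphisms_def by blast
    also have "\<dots> = bset (\<gamma> \<otimes> inv \<beta>)" using k that unfolding scheme_automorphisms_def by blast
    finally show ?thesis .
  qed
  then have "compose (carrier H) g k \<in> scheme_automorphisms"
    unfolding scheme_automorphisms_def using compose_Bij[OF Bij] by (simp add: compose_def)
  then show "g \<otimes>\<^bsub>BijGroup (carrier H)\<^esub> k \<in> scheme_automorphisms"
    using Bij by (simp add: BijGroup_def)
qed

lemma right_regular_scheme_automorphisms: "right_regular H \<subseteq> scheme_automorphisms"
proof
  fix f assume "f \<in> right_regular H"
  then obtain g where g: "g \<in> carrier H" "f = (\<lambda>h\<in>carrier H. h \<otimes> g)" unfolding right_regular_def by blast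
  have "bij_betw f (carrier H) (carrier H)"
    by (rule bij_betwI[of _ _ _ "\<lambda>h. h \<otimes> inv g"]) (auto simp: g m_assoc)
  then have "f \<in> Bij (carrier H)" by (simp add: Bij_def g(2))
  moreover have "f \<gamma> \<otimes> inv (f \<beta>) = \<gamma> \<otimes> inv \<beta>" if "\<beta> \<in> carrier H" "\<gamma> \<in> carrier H" for \<beta> \<gamma>
  proof -
    have "g \<otimes> (inv g \<otimes> inv \<beta>) = inv \<beta>" using that g(1) by (simp add: m_assoc[symmetric])
    then show ?thesis unfolding g(2) using that g(1) by (simp add: inv_mult_group m_assoc)
  qed
  ultimately show "f \<in> scheme_automorphisms" by (simp add: scheme_automorphisms_def)
qed

lemma scheme_automorphism_bset:
  assumes "g \<in> scheme_automorphisms" "g \<one> = \<one>" "h \<in> carrier H"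
  shows "g h \<in> bset h"
proof -
  have gc: "g h \<in> carrier H"
    using assms Bij_imp_funcset by (fastforce simp: scheme_automorphisms_def)
  have "bset (g h \<otimes> inv (g \<one>)) = bset (h \<otimes> inv \<one>)"
    using assms unfolding scheme_automorphisms_def by blast
  then show ?thesis using assms gc self_in_bset[OF gc] by simp
qed

end

context separated_s_ring begin

text \<open>
  The condition for shifts of \<open>h\<close> by \<open>r\<close> and of \<open>k\<close> by \<open>s\<close> to preserve the basic relation
  between \<open>h\<close> and \<open>k\<close>: the difference \<open>k h\<^sup>-\<^sup>1\<close> changes by the right factor \<open>h s r\<^sup>-\<^sup>1 h\<^sup>-\<^sup>1\<close>, and the
  result stays in its basic set if and only if this factor stabilizes it.
\<close>

lemma bset_shift:
  assumes h: "h \<in> carrier H" and k: "k \<in> carrier H" and r: "r \<in> carrier H" and s: "s \<in> carrier H"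
  shows "bset ((k \<otimes> s) \<otimes> inv (h \<otimes> r)) = bset (k \<otimes> inv h) \<longleftrightarrow> h \<otimes> (s \<otimes> inv r) \<otimes> inv h \<in> stab (k \<otimes> inv h)"
proof -
  let ?u = "h \<otimes> (s \<otimes> inv r) \<otimes> inv h"
  have kh: "k \<otimes> inv h \<in> carrier H" using h k by simp
  have uc: "?u \<in> carrier H" using assms by simp
  have "(k \<otimes> inv h) \<otimes> ?u = k \<otimes> ((inv h \<otimes> h) \<otimes> (s \<otimes> inv r)) \<otimes> inv h"
    using assms by (simp only: m_assoc m_closed inv_closed)
  also have "\<dots> = (k \<otimes> s) \<otimes> inv (h \<otimes> r)" using assms by (simp add: inv_mult_group m_assoc)
  finally have eq: "(k \<otimes> s) \<otimes> inv (h \<otimes> r) = (k \<otimes> inv h) \<otimes> ?u" by simp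
  have "bset ((k \<otimes> inv h) \<otimes> ?u) = bset (k \<otimes> inv h) \<longleftrightarrow> (k \<otimes> inv h) \<otimes> ?u \<in> bset (k \<otimes> inv h)"
  proof
    assume "bset ((k \<otimes> inv h) \<otimes> ?u) = bset (k \<otimes> inv h)"
    then show "(k \<otimes> inv h) \<otimes> ?u \<in> bset (k \<otimes> inv h)"
      using self_in_bset[OF m_closed[OF kh uc]] by (rule subst)
  qed (rule bset_eq[OF kh])
  also have "\<dots> \<longleftrightarrow> ?u \<in> stab (k \<otimes> inv h)" by (rule bset_stab[OF kh uc])
  finally show ?thesis unfolding eq .
qed

lemma quotient_not_L:
  assumes h: "h \<in> carrier H" and k: "k \<in> carrier H" and "inv h \<otimes> k \<notin> L"
  shows "k \<otimes> inv h \<in> carrier H - L"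
proof -
  have "k \<otimes> inv h \<notin> L"
  proof
    assume "k \<otimes> inv h \<in> L"
    then have "inv h \<otimes> (k \<otimes> inv h) \<otimes> inv (inv h) \<in> L" using h by (intro L_normal) auto
    then show False using assms by (simp add: m_assoc)
  qed
  then show ?thesis using h k by simp
qed

text \<open>
  This expresses that \<open>bset (h\<^sup>-\<^sup>1)\<close> consists of the inverses of \<open>bset h = h (stab h)\<close>.
\<close>

lemma conj_stab:
  assumes h: "h \<in> carrier H" and s: "s \<in> stab h"
  shows "h \<otimes> s \<otimes> inv h \<in> stab (inv h)"
proof -
  have sc: "s \<in> carrier H" using s by (simp add: stab_def)
  have "inv s \<in> stab h" by (rule subgroup.m_inv_closed[OF stab_subgroup[OF h] s])
  then have "inv (h \<otimes> inv s) \<in> bset (inv h)"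
    using stab_mult[OF _ self_in_bset[OF h]] bset_inv[OF h] by blast
  moreover have "inv (h \<otimes> inv s) = inv h \<otimes> (h \<otimes> s \<otimes> inv h)"
    using h sc by (simp add: inv_mult_group m_assoc[symmetric])
  ultimately show ?thesis using bset_stab[of "inv h" "h \<otimes> s \<otimes> inv h"] h sc by simp
qed

section \<open>The criterion\<close>

text \<open>
  Any element \<open>g\<close> of the point stabilizer that moves some \<open>h\<^sub>0\<close> will do, and the essential point is
  that it then moves every \<open>h\<close> outside \<open>L\<close>. It preserves all basic relations, which is more than
  compatibility on the chosen basic sets.
\<close>

lemma Schurian_imp_ex_Gamma1:
  assumes "Schurian H A"
  shows "\<exists>\<sigma>\<in>Gamma1 p H A L. \<sigma> \<noteq> \<one>\<^bsub>BijGroup (carrier H)\<^esub> \<and>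
    (\<forall>\<beta>\<in>carrier H. \<forall>\<gamma>\<in>carrier H. basic_rel H A \<beta> \<gamma> = basic_rel H A (\<sigma> \<beta>) (\<sigma> \<gamma>))"
proof -
  obtain G where G: "subgroup G (BijGroup (carrier H))" and reg: "right_regular H \<subseteq> G"
    and orb: "\<forall>h\<in>carrier H. bset h = point_orbit G \<one> h"
    using assms unfolding Schurian_iff by blast
  note pres = relation_preserved[OF G reg orb]
  define G1 where "G1 = {g \<in> G. g \<one> = \<one>}"
  have bset_G1: "bset h = (\<lambda>g. g h) ` G1" if "h \<in> carrier H" for h
    using orb that unfolding point_orbit_def G1_def by blast
  have G1G: "g \<in> G" if "g \<in> G1" for g using that by (simp add: G1_def)
  have g_bset: "g h \<in> bset h" if "g \<in> G1" "h \<in> carrier H" for g h using that bset_G1 by blast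
  have gc: "g h \<in> carrier H" if "g \<in> G1" "h \<in> carrier H" for g h
    by (rule bset_carrier[OF that(2) g_bset[OF that]])
  have g_L: "g l = l" if "g \<in> G1" "l \<in> L" for g l
    using g_bset[OF that(1) L_carrier[OF that(2)]] bset_L[OF that(2)] by simp
  have shift_stab: "inv h \<otimes> g h \<in> stab h" if "g \<in> G1" "h \<in> carrier H" for g h
    using bset_stab[of h "inv h \<otimes> g h"] g_bset[OF that] gc[OF that] that by (simp add: m_assoc[symmetric])
  have g_shift: "g h = h \<otimes> (inv h \<otimes> g h)" if "g \<in> G1" "h \<in> carrier H" for g h
    using gc[OF that] that by (simp add: m_assoc[symmetric])
  \<comment> \<open>the basic relation of an element of \<open>L\<close> is the graph of a left translation, so \<open>g\<close> commutes with it\<close>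
  have g_left: "g (l \<otimes> h) = l \<otimes> g h" if g: "g \<in> G1" and l: "l \<in> L" and h: "h \<in> carrier H" for g l h
  proof -
    have lc: "l \<in> carrier H" by (rule L_carrier[OF l])
    have "bset (g (l \<otimes> h) \<otimes> inv (g h)) = bset (l \<otimes> h \<otimes> inv h)"
      using lc h by (intro pres[OF G1G[OF g]]) auto
    also have "\<dots> = {l}" using bset_L[OF l] lc h by (simp add: m_assoc)
    finally have "g (l \<otimes> h) \<otimes> inv (g h) = l"
      using self_in_bset[of "g (l \<otimes> h) \<otimes> inv (g h)"] gc[OF g] lc h by simp
    then have "g (l \<otimes> h) \<otimes> inv (g h) \<otimes> g h = l \<otimes> g h" by simp
    then show ?thesis using gc[OF g] lc h by (simp add: m_assoc)
  qed
  have g_right: "g (h \<otimes> l) = g h \<otimes> l" if g: "g \<in> G1" and l: "l \<in> L" and h: "h \<in> carrier H" for g l h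
  proof -
    have lc: "l \<in> carrier H" by (rule L_carrier[OF l])
    let ?r = "inv h \<otimes> g h"
    have r: "?r \<in> L" "?r \<in> carrier H" using shift_stab[OF g h] stab_subset_L[OF h] L_carrier by auto
    have "h \<otimes> l = (h \<otimes> l \<otimes> inv h) \<otimes> h" using h lc by (simp add: m_assoc)
    then have "g (h \<otimes> l) = (h \<otimes> l \<otimes> inv h) \<otimes> g h" using g_left[OF g L_normal[OF h l] h] by simp
    also have "\<dots> = h \<otimes> (l \<otimes> ?r)" using h lc gc[OF g h] by (simp add: m_assoc)
    also have "\<dots> = h \<otimes> (?r \<otimes> l)" using L_comm[OF l r(1)] by simp
    also have "\<dots> = h \<otimes> ?r \<otimes> l" using h lc r(2) by (simp only: m_assoc)
    also have "\<dots> = g h \<otimes> l" using g_shift[OF g h] by simp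
    finally show ?thesis .
  qed
  obtain h0 where h0: "h0 \<in> carrier H - L" using ex_not_L by blast
  then have h0c: "h0 \<in> carrier H" by simp
  have "\<exists>g\<in>G1. g h0 \<noteq> h0"
  proof (rule ccontr)
    assume "\<not> (\<exists>g\<in>G1. g h0 \<noteq> h0)"
    then have "bset h0 \<subseteq> {h0}" by (auto simp: bset_G1[OF h0c])
    from card_mono[OF _ this] show False using card_bset[OF h0] p_ge_3 by simp
  qed
  then obtain g where g: "g \<in> G1" "g h0 \<noteq> h0" by blast
  \<comment> \<open>if \<open>g\<close> fixed \<open>h\<close>, so would the whole point stabilizer, and \<open>h\<close> would be a basic set by itself\<close>
  have moved: "g h \<noteq> h" if h: "h \<in> carrier H - L" for h
  proof
    assume gh: "g h = h"
    have hc: "h \<in> carrier H" using h by simp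
    have coset: "inv h \<otimes> h0 \<notin> L"
    proof
      assume l: "inv h \<otimes> h0 \<in> L"
      have "h0 = h \<otimes> (inv h \<otimes> h0)" using hc h0c by (simp add: m_assoc[symmetric])
      then show False using g_right[OF g(1) l hc] gh g(2) by simp
    qed
    define K where "K = stab (h0 \<otimes> inv h)"
    have kh: "h0 \<otimes> inv h \<in> carrier H - L" by (rule quotient_not_L[OF hc h0c coset])
    define s where "s = inv h0 \<otimes> g h0"
    have s: "s \<in> stab h0" "s \<in> carrier H" "g h0 = h0 \<otimes> s"
      using shift_stab[OF g(1) h0c] g_shift[OF g(1) h0c] gc[OF g(1) h0c] h0c by (auto simp: s_def)
    have "s \<noteq> \<one>" using s g(2) h0c by auto
    have both: "h \<otimes> (inv h0 \<otimes> k h0 \<otimes> inv (inv h \<otimes> k h)) \<otimes> inv h \<in> K" if k: "k \<in> G1" for k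
    proof -
      have "bset ((h0 \<otimes> (inv h0 \<otimes> k h0)) \<otimes> inv (h \<otimes> (inv h \<otimes> k h))) = bset (h0 \<otimes> inv h)"
        using pres[OF G1G[OF k] hc h0c] g_shift[OF k hc] g_shift[OF k h0c] by simp
      then show ?thesis unfolding K_def using bset_shift hc h0c gc[OF k] by simp
    qed
    \<comment> \<open>as \<open>g\<close> fixes \<open>h\<close>, the conjugate \<open>u\<close> of \<open>s\<close> lies in \<open>K\<close>; having prime order, \<open>K\<close> consists of its powers\<close>
    define u where "u = h \<otimes> s \<otimes> inv h"
    have u: "u \<in> K" using both[OF g(1)] gh hc s(2) by (simp add: u_def s_def)
    have "u \<noteq> \<one>"
    proof
      assume "u = \<one>"
      then have "inv h \<otimes> u \<otimes> h = \<one>" using hc by simp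
      moreover have "inv h \<otimes> u \<otimes> h = s"
        using hc s(2) by (simp add: u_def m_assoc) (simp add: m_assoc[symmetric])
      ultimately show False using \<open>s \<noteq> \<one>\<close> by simp
    qed
    \<comment> \<open>conjugating back, \<open>s' r\<^sup>-\<^sup>1\<close> is a power of \<open>s\<close>, so \<open>r\<close> lies in two different stabilizers\<close>
    have fixed: "k h = h" if k: "k \<in> G1" for k
    proof -
      define s' where "s' = inv h0 \<otimes> k h0"
      define r where "r = inv h \<otimes> k h"
      have s': "s' \<in> stab h0" "s' \<in> carrier H" using shift_stab[OF k h0c] gc[OF k h0c] h0c by (auto simp: s'_def)
      have r: "r \<in> stab h" "r \<in> carrier H" using shift_stab[OF k hc] gc[OF k hc] hc by (auto simp: r_def)
      have "h \<otimes> (s' \<otimes> inv r) \<otimes> inv h \<in> K" using both[OF k] by (simp add: s'_def r_def)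
      then obtain n :: nat where "h \<otimes> (s' \<otimes> inv r) \<otimes> inv h = u [^] n"
        using stab_power[OF kh, of u] u \<open>u \<noteq> \<one>\<close> unfolding K_def by blast
      then have "h \<otimes> (s' \<otimes> inv r) \<otimes> inv h = h \<otimes> s [^] n \<otimes> inv h"
        using conj_pow[OF hc s(2)] by (simp add: u_def)
      then have "s' \<otimes> inv r = s [^] n" using hc s(2) s' r by simp
      moreover have "s [^] n \<in> stab h0"
        using s(1) by (induction n) (auto intro: subgroup.m_closed[OF stab_subgroup[OF h0c]] one_in_stab[OF h0c])
      ultimately have "inv (s' \<otimes> inv r) \<otimes> s' \<in> stab h0"
        using s' subgroup.m_closed[OF stab_subgroup[OF h0c]] subgroup.m_inv_closed[OF stab_subgroup[OF h0c]] by simp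
      moreover have "inv (s' \<otimes> inv r) \<otimes> s' = r" using s' r by (simp add: inv_mult_group m_assoc)
      ultimately have "r = \<one>" using stab_inter_trivial[OF h h0 coset r(1)] by simp
      then show ?thesis using g_shift[OF k hc] hc by (simp add: r_def)
    qed
    then have "bset h \<subseteq> {h}" by (auto simp: bset_G1[OF hc])
    from card_mono[OF _ this] show False using card_bset[OF h] p_ge_3 by simp
  qed
  have bij: "bij_betw g (carrier H) (carrier H)" by (rule subgroup_BijGroup_bij[OF G G1G[OF g(1)]])
  have rel: "basic_rel H A \<beta> \<gamma> = basic_rel H A (g \<beta>) (g \<gamma>)" if "\<beta> \<in> carrier H" "\<gamma> \<in> carrier H" for \<beta> \<gamma>
    using basic_rel_eq_iff[OF that gc[OF g(1) that(1)] gc[OF g(1) that(2)]] pres[OF G1G[OF g(1)] that] by simp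
  have "g \<in> Gamma1 p H A L"
    unfolding Gamma1_def
  proof (intro CollectI conjI ballI impI)
    show "g \<in> carrier (BijGroup (carrier H))" using subgroup.mem_carrier[OF G G1G[OF g(1)]] .
    show "{x \<in> carrier H. g x = x} = L" using moved g_L[OF g(1)] L_carrier by blast
    fix T assume T: "T \<in> Bsets H A" and card_T: "card T = p"
    then obtain h where h: "h \<in> carrier H" "T = bset h" unfolding Bsets_bset by blast
    have hL: "h \<in> carrier H - L"
      using h card_T bset_L[of h] p_ge_3 by auto
    have "g ` T \<subseteq> T" using g_bset[OF g(1)] bset_carrier[OF h(1)] bset_eq[OF h(1)] unfolding h(2) by blast
    moreover have "inj_on g T"
      using bij bset_carrier[OF h(1)] unfolding h(2) bij_betw_def by (meson inj_on_subset subsetI)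
    ultimately show "g ` T = T" using finite_bset[OF h(1)] h(2) by (intro endo_inj_surj) auto
    show "basic_rel H A \<beta> \<gamma> = basic_rel H A (g \<beta>) (g \<gamma>)" if "\<beta> \<in> T" "\<gamma> \<in> T" for \<beta> \<gamma>
      using that bset_carrier[OF h(1)] unfolding h(2) by (intro rel)
    define r where "r = inv h \<otimes> g h"
    have r: "r \<in> stab h" "r \<in> carrier H" "g h = h \<otimes> r"
      using shift_stab[OF g(1) h(1)] g_shift[OF g(1) h(1)] gc[OF g(1) h(1)] h(1) by (auto simp: r_def)
    have "r \<noteq> \<one>" using moved[OF hL] r h(1) by auto
    have r_pow: "r [^] (n::nat) \<in> stab h" for n
      using r(1) by (induction n) (auto intro: subgroup.m_closed[OF stab_subgroup[OF h(1)]] one_in_stab[OF h(1)])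
    have iter: "(g ^^ n) h = h \<otimes> r [^] n" for n
    proof (induction n)
      case (Suc n)
      have "(g ^^ Suc n) h = g h \<otimes> r [^] n"
        using Suc g_right[OF g(1) _ h(1), of "r [^] n"] r_pow stab_subset_L[OF h(1)] by auto
      also have "\<dots> = h \<otimes> r [^] Suc n"
        using r h(1) nat_pow_Suc2[OF r(2), of n] by (simp add: m_assoc)
      finally show ?case .
    qed (use h in simp)
    have "T = Orbits.orbit g h"
      unfolding orbit_altdef iter h(2)
    proof
      show "bset h \<subseteq> {h \<otimes> r [^] n | n::nat. 0 < n}"
      proof
        fix x assume "x \<in> bset h"
        then obtain s where s: "s \<in> stab h" "x = h \<otimes> s" using bset_eq_coset[OF h(1)] by blast
        obtain n :: nat where "n > 0" "s = r [^] n"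
          using stab_power[OF hL r(1) \<open>r \<noteq> \<one>\<close> s(1)] by blast
        with s(2) show "x \<in> {h \<otimes> r [^] n | n::nat. 0 < n}" by blast
      qed
      show "{h \<otimes> r [^] n | n::nat. 0 < n} \<subseteq> bset h" using bset_eq_coset[OF h(1)] r_pow by blast
    qed
    then show "cyclic_on g T" unfolding cyclic_on_def using self_in_bset[OF h(1)] h(2) by blast
  qed
  moreover have "g \<noteq> \<one>\<^bsub>BijGroup (carrier H)\<^esub>" using g(2) h0c by (auto simp: BijGroup_def)
  ultimately show ?thesis using rel by blast
qed

text \<open>
  The \<open>t i\<close> represent the nontrivial cosets of \<open>L\<close>. Shifting each coset by the corresponding \<open>r i\<close>, and \<open>L\<close>
  by \<open>1\<close>, preserves the basic relations: both sides of \<open>compat\<close> depend only on the cosets, as \<open>L\<close> is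
  abelian and normal. The powers of this shift carry \<open>h\<close> to all elements of \<open>bset h\<close>.
\<close>

lemma Schurian_if_compatible_shifts:
  fixes t r :: "'i \<Rightarrow> 'a"
  assumes t: "\<And>i. i \<in> I \<Longrightarrow> t i \<in> carrier H - L"
    and cover: "\<And>h. h \<in> carrier H - L \<Longrightarrow> \<exists>i\<in>I. inv (t i) \<otimes> h \<in> L"
    and distinct: "\<And>i j. i \<in> I \<Longrightarrow> j \<in> I \<Longrightarrow> inv (t i) \<otimes> t j \<in> L \<Longrightarrow> i = j"
    and r: "\<And>i. i \<in> I \<Longrightarrow> r i \<in> stab (t i)" "\<And>i. i \<in> I \<Longrightarrow> r i \<noteq> \<one>"
    and compat: "\<And>i j. i \<in> I \<Longrightarrow> j \<in> I \<Longrightarrow> i \<noteq> j \<Longrightarrow>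
      t i \<otimes> (r j \<otimes> inv (r i)) \<otimes> inv (t i) \<in> stab (t j \<otimes> inv (t i))"
  shows "Schurian H A"
proof -
  define \<rho> where "\<rho> h = (if h \<in> L then \<one> else r (SOME i. i \<in> I \<and> inv (t i) \<otimes> h \<in> L))" for h
  have rep: "\<exists>i\<in>I. \<exists>l\<in>L. h = t i \<otimes> l \<and> \<rho> h = r i" if h: "h \<in> carrier H - L" for h
  proof -
    define i where "i = (SOME i. i \<in> I \<and> inv (t i) \<otimes> h \<in> L)"
    have "\<exists>i. i \<in> I \<and> inv (t i) \<otimes> h \<in> L" using cover[OF h] by blast
    from someI_ex[OF this] have i: "i \<in> I" "inv (t i) \<otimes> h \<in> L" unfolding i_def by blast+
    moreover have "\<rho> h = r i" using h by (simp add: \<rho>_def i_def)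
    moreover have "h = t i \<otimes> (inv (t i) \<otimes> h)" using t[OF i(1)] h by (simp add: m_assoc[symmetric])
    ultimately show ?thesis by blast
  qed
  have \<rho>_coset: "\<rho> (t i \<otimes> l) = r i" if i: "i \<in> I" and l: "l \<in> L" for i l
  proof -
    have til: "t i \<otimes> l \<in> carrier H - L" by (rule hL_not_L[OF t[OF i] l])
    obtain j m where j: "j \<in> I" "m \<in> L" "t i \<otimes> l = t j \<otimes> m" "\<rho> (t i \<otimes> l) = r j" using rep[OF til] by blast
    have c: "t i \<in> carrier H" "t j \<in> carrier H" "l \<in> carrier H" "m \<in> carrier H"
      using t[OF i] t[OF j(1)] L_carrier l j(2) by auto
    have "t i = t i \<otimes> l \<otimes> inv l" using c by (simp add: m_assoc)
    also have "\<dots> = t j \<otimes> (m \<otimes> inv l)" unfolding j(3) using c by (simp add: m_assoc)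
    finally have "inv (t j) \<otimes> t i = inv (t j) \<otimes> (t j \<otimes> (m \<otimes> inv l))" by simp
    also have "\<dots> = m \<otimes> inv l" using c by (simp add: m_assoc[symmetric])
    finally have "inv (t j) \<otimes> t i \<in> L" using L_mult[OF j(2) L_inv[OF l]] by simp
    then have "j = i" by (rule distinct[OF j(1) i])
    then show ?thesis using j(4) by simp
  qed
  have \<rho>_L: "\<rho> l = \<one>" if "l \<in> L" for l using that by (simp add: \<rho>_def)
  have \<rho>_stab: "\<rho> h \<in> stab h" if h: "h \<in> carrier H" for h
  proof (cases "h \<in> L")
    case True
    then show ?thesis using one_in_stab[OF h] \<rho>_L by simp
  next
    case False
    then obtain i l where i: "i \<in> I" "l \<in> L" "h = t i \<otimes> l" "\<rho> h = r i" using rep[of h] h by blast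
    show ?thesis unfolding i(4) unfolding i(3) stab_coset[OF t[OF i(1)] i(2)] by (rule r(1)[OF i(1)])
  qed
  have \<rho>_nontrivial: "\<rho> h \<noteq> \<one>" if h: "h \<in> carrier H - L" for h
  proof -
    obtain i where "i \<in> I" "\<rho> h = r i" using rep[OF h] by blast
    then show ?thesis using r(2) by simp
  qed
  have \<rho>_mem_L: "\<rho> h \<in> L" if h: "h \<in> carrier H" for h using \<rho>_stab[OF h] stab_subset_L[OF h] by blast
  have \<rho>_mult: "\<rho> (h \<otimes> l) = \<rho> h" if h: "h \<in> carrier H" and l: "l \<in> L" for h l
  proof (cases "h \<in> L")
    case True
    then show ?thesis using \<rho>_L L_mult[OF True l] by simp
  next
    case False
    then obtain i m where i: "i \<in> I" "m \<in> L" "h = t i \<otimes> m" "\<rho> h = r i" using rep[of h] h by blast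
    have "h \<otimes> l = t i \<otimes> (m \<otimes> l)" unfolding i(3) using t[OF i(1)] L_carrier i(2) l by (simp add: m_assoc)
    then show ?thesis using \<rho>_coset[OF i(1) L_mult[OF i(2) l]] i(4) by simp
  qed
  have conj_cancel: "inv h \<otimes> (h \<otimes> x) = x" if "h \<in> carrier H" "x \<in> carrier H" for h x
    using that by (simp add: m_assoc[symmetric])
  \<comment> \<open>the condition of \<open>bset_shift\<close>; it is immediate within a coset and follows from \<open>conj_stab\<close> or \<open>\<rho>_stab\<close> if one point is in \<open>L\<close>\<close>
  have key: "h \<otimes> (\<rho> k \<otimes> inv (\<rho> h)) \<otimes> inv h \<in> stab (k \<otimes> inv h)"
    if h: "h \<in> carrier H" and k: "k \<in> carrier H" for h k
  proof -
    have \<rho>: "\<rho> h \<in> L" "\<rho> k \<in> L" "\<rho> h \<in> carrier H" "\<rho> k \<in> carrier H"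
      using \<rho>_mem_L[OF h] \<rho>_mem_L[OF k] L_carrier by auto
    show ?thesis
    proof (cases "inv h \<otimes> k \<in> L")
      case True
      have "k = h \<otimes> (inv h \<otimes> k)" using h k by (simp add: m_assoc[symmetric])
      then have "\<rho> k = \<rho> h" using \<rho>_mult[OF h True] by simp
      then show ?thesis using \<rho> h k one_in_stab by simp
    next
      case coset: False
      show ?thesis
      proof (cases "h \<in> L")
        case True
        have "h \<otimes> \<rho> k \<otimes> inv h = \<rho> k \<otimes> h \<otimes> inv h" using L_comm[OF True \<rho>(2)] by simp
        also have "\<dots> = \<rho> k" using h \<rho> by (simp add: m_assoc)
        finally have eq: "h \<otimes> (\<rho> k \<otimes> inv (\<rho> h)) \<otimes> inv h = \<rho> k" using \<rho>_L[OF True] \<rho> by simp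
        have "k \<notin> L" using coset L_mult[OF L_inv[OF True]] by blast
        then have "stab (k \<otimes> inv h) = stab k" using stab_coset[OF _ L_inv[OF True]] k by simp
        then show ?thesis using eq \<rho>_stab[OF k] by simp
      next
        case hL: False
        then have hn: "h \<in> carrier H - L" using h by simp
        show ?thesis
        proof (cases "k \<in> L")
          case True
          have "k \<otimes> inv h = inv h \<otimes> (h \<otimes> k \<otimes> inv h)" using h k by (simp add: m_assoc conj_cancel)
          then have "stab (k \<otimes> inv h) = stab (inv h)"
            using stab_coset[OF inv_not_L[OF hn] L_normal[OF h True]] by simp
          moreover have "inv (\<rho> h) \<in> stab h"
            by (rule subgroup.m_inv_closed[OF stab_subgroup[OF h] \<rho>_stab[OF h]])
          ultimately show ?thesis using conj_stab[OF h] \<rho>_L[OF True] \<rho> by simp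
        next
          case False
          then have kn: "k \<in> carrier H - L" using k by simp
          obtain i l where i: "i \<in> I" "l \<in> L" "h = t i \<otimes> l" "\<rho> h = r i" using rep[OF hn] by blast
          obtain j m where j: "j \<in> I" "m \<in> L" "k = t j \<otimes> m" "\<rho> k = r j" using rep[OF kn] by blast
          have c: "t i \<in> carrier H" "t j \<in> carrier H" "l \<in> carrier H" "m \<in> carrier H"
            using t[OF i(1)] t[OF j(1)] L_carrier i(2) j(2) by auto
          have "i \<noteq> j"
          proof
            assume "i = j"
            then have "inv h \<otimes> k = inv l \<otimes> (inv (t i) \<otimes> (t i \<otimes> m))"
              using i(3) j(3) c by (simp add: inv_mult_group m_assoc)
            then have "inv h \<otimes> k = inv l \<otimes> m" using conj_cancel c by simp
            then show False using coset L_mult[OF L_inv[OF i(2)] j(2)] by simp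
          qed
          define x where "x = r j \<otimes> inv (r i)"
          have x: "x \<in> L" "x \<in> carrier H"
            using \<rho> i(4) j(4) L_mult L_inv unfolding x_def by auto
          have "h \<otimes> x \<otimes> inv h = t i \<otimes> (l \<otimes> x) \<otimes> inv l \<otimes> inv (t i)"
            unfolding i(3) using c x by (simp add: inv_mult_group m_assoc)
          also have "\<dots> = t i \<otimes> x \<otimes> inv (t i)"
            unfolding L_comm[OF i(2) x(1)] using c x by (simp add: m_assoc)
          finally have eq: "h \<otimes> x \<otimes> inv h = t i \<otimes> x \<otimes> inv (t i)" .
          have "inv (t i) \<otimes> t j \<notin> L" using distinct[OF i(1) j(1)] \<open>i \<noteq> j\<close> by blast
          then have tn: "t j \<otimes> inv (t i) \<in> carrier H - L" by (rule quotient_not_L[OF c(1,2)])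
          have "m \<otimes> inv l \<in> L" by (rule L_mult[OF j(2) L_inv[OF i(2)]])
          then have st: "stab (t j \<otimes> inv (t i) \<otimes> (t i \<otimes> (m \<otimes> inv l) \<otimes> inv (t i))) = stab (t j \<otimes> inv (t i))"
            by (intro stab_coset[OF tn] L_normal[OF c(1)])
          have "k \<otimes> inv h = t j \<otimes> inv (t i) \<otimes> (t i \<otimes> (m \<otimes> inv l) \<otimes> inv (t i))"
            unfolding i(3) j(3) using c by (simp add: inv_mult_group m_assoc conj_cancel)
          then have "stab (k \<otimes> inv h) = stab (t j \<otimes> inv (t i))" using st by simp
          then show ?thesis
            using compat[OF i(1) j(1) \<open>i \<noteq> j\<close>] eq i(4) j(4) by (simp add: x_def)
        qed
      qed
    qed
  qed
  define f where "f = (\<lambda>h\<in>carrier H. h \<otimes> \<rho> h)"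
  have f: "f h = h \<otimes> \<rho> h" if "h \<in> carrier H" for h using that by (simp add: f_def)
  have \<rho>c: "\<rho> h \<in> carrier H" if "h \<in> carrier H" for h using \<rho>_mem_L[OF that] by (rule L_carrier)
  have inj: "inj_on f (carrier H)"
  proof (rule inj_onI)
    fix h k assume h: "h \<in> carrier H" and k: "k \<in> carrier H" and "f h = f k"
    then have eq: "h \<otimes> \<rho> h = k \<otimes> \<rho> k" by (simp add: f)
    have "\<rho> h = \<rho> (h \<otimes> \<rho> h)" using \<rho>_mult[OF h \<rho>_mem_L[OF h]] by simp
    also have "\<dots> = \<rho> k" unfolding eq by (rule \<rho>_mult[OF k \<rho>_mem_L[OF k]])
    finally show "h = k" using eq h k \<rho>c by simp
  qed
  have "f ` carrier H \<subseteq> carrier H" using f \<rho>c by auto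
  then have "f ` carrier H = carrier H" using inj finite_carrier by (intro endo_inj_surj)
  then have "f \<in> Bij (carrier H)" using inj by (simp add: Bij_def bij_betw_def f_def)
  moreover have "bset (f \<gamma> \<otimes> inv (f \<beta>)) = bset (\<gamma> \<otimes> inv \<beta>)" if "\<beta> \<in> carrier H" "\<gamma> \<in> carrier H" for \<beta> \<gamma>
    unfolding f[OF that(1)] f[OF that(2)]
    using bset_shift[OF that \<rho>c[OF that(1)] \<rho>c[OF that(2)]] key[OF that] by blast
  ultimately have f_aut: "f \<in> scheme_automorphisms" by (simp add: scheme_automorphisms_def)
  have one_L: "\<one> \<in> L" by (rule subgroup.one_closed[OF L_subgroup])
  have iter: "\<exists>g\<in>scheme_automorphisms. g \<one> = \<one> \<and> g h = h \<otimes> \<rho> h [^] n" if h: "h \<in> carrier H" for h and n :: nat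
  proof (induction n)
    case 0
    show ?case
      using subgroup_BijGroup_id[OF scheme_automorphisms_subgroup] h by (intro bexI[of _ "\<lambda>h\<in>carrier H. h"]) auto
  next
    case (Suc n)
    then obtain g where g: "g \<in> scheme_automorphisms" "g \<one> = \<one>" "g h = h \<otimes> \<rho> h [^] n" by blast
    have "\<rho> h [^] n \<in> L" using \<rho>_mem_L[OF h] by (induction n) (auto intro: L_mult one_L)
    then have "f (h \<otimes> \<rho> h [^] n) = h \<otimes> \<rho> h [^] n \<otimes> \<rho> h" using f \<rho>_mult[OF h] h \<rho>c[OF h] by simp
    then have "compose (carrier H) f g h = h \<otimes> \<rho> h [^] Suc n"
      using g(3) h \<rho>c[OF h] by (simp add: compose_def m_assoc)
    moreover have "compose (carrier H) f g \<one> = \<one>" using g(2) f[of \<one>] \<rho>_L[OF one_L] by (simp add: compose_def)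
    moreover have "compose (carrier H) f g \<in> scheme_automorphisms"
      by (rule subgroup_BijGroup_compose[OF scheme_automorphisms_subgroup f_aut g(1)])
    ultimately show ?case by blast
  qed
  have "bset h = point_orbit scheme_automorphisms \<one> h" if h: "h \<in> carrier H" for h
  proof
    show "point_orbit scheme_automorphisms \<one> h \<subseteq> bset h"
      unfolding point_orbit_def using scheme_automorphism_bset[OF _ _ h] by blast
    show "bset h \<subseteq> point_orbit scheme_automorphisms \<one> h"
    proof
      fix x assume x: "x \<in> bset h"
      then obtain s where s: "s \<in> stab h" "x = h \<otimes> s" using bset_eq_coset[OF h] by blast
      have "\<exists>n::nat. s = \<rho> h [^] n"
      proof (cases "h \<in> L")
        case True
        then have "h \<otimes> s = h" using x s(2) bset_L by auto
        moreover have "s \<in> carrier H" using s(1) by (simp add: stab_def)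
        ultimately have "s = \<one>" using h by simp
        then show ?thesis by (intro exI[of _ 0]) simp
      next
        case False
        then have "h \<in> carrier H - L" using h by simp
        then show ?thesis using stab_power[OF _ \<rho>_stab[OF h] \<rho>_nontrivial s(1)] by blast
      qed
      then obtain n :: nat where "x = h \<otimes> \<rho> h [^] n" using s(2) by blast
      moreover obtain g where "g \<in> scheme_automorphisms" "g \<one> = \<one>" "g h = h \<otimes> \<rho> h [^] n"
        using iter[OF h, of n] by blast
      ultimately show "x \<in> point_orbit scheme_automorphisms \<one> h"
        unfolding point_orbit_def by (intro CollectI exI[of _ g]) simp
    qed
  qed
  then show ?thesis
    unfolding Schurian_iff
    using scheme_automorphisms_subgroup right_regular_scheme_automorphisms by blast
qed

text \<open>
  It suffices to look at one point \<open>t i\<close> outside \<open>L\<close> in each \<open>T i\<close>; \<open>\<sigma>\<close> moves it, since \<open>L\<close> is the set of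
  fixed points. The stabilizers of the \<open>T i\<close> are \<open>p - 1\<close> different ones, hence all of them, so the
  \<open>t i\<close> represent all nontrivial cosets of \<open>L\<close>.
\<close>

lemma Schurian_if_Gamma1:
  fixes T :: "'i \<Rightarrow> 'a set"
  assumes \<sigma>: "\<sigma> \<in> Gamma1 p H A L" and I: "card I = p - 1"
    and T: "\<And>i. i \<in> I \<Longrightarrow> T i \<in> Bsets H A" "\<And>i. i \<in> I \<Longrightarrow> \<not> T i \<subseteq> L"
    and St_R: "\<And>i j. i \<in> I \<Longrightarrow> j \<in> I \<Longrightarrow> i \<noteq> j \<Longrightarrow> St_R H (T i) \<noteq> St_R H (T j)"
    and compat: "\<And>i j. i \<in> I \<Longrightarrow> j \<in> I \<Longrightarrow> compatible H A \<sigma> (T i) (T j)"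
  shows "Schurian H A"
proof -
  have "\<exists>x. x \<in> T i \<and> x \<notin> L" if "i \<in> I" for i using T(2)[OF that] by blast
  then obtain t where t_T: "\<And>i. i \<in> I \<Longrightarrow> t i \<in> T i" and t_L: "\<And>i. i \<in> I \<Longrightarrow> t i \<notin> L"
    by metis
  have t: "t i \<in> carrier H - L" if "i \<in> I" for i using t_T t_L Bsets_subset T(1) that by blast
  have T_bset: "T i = bset (t i)" if "i \<in> I" for i using bset_eqI[OF T(1) t_T] that by simp
  have inj: "inj_on (\<lambda>i. stab (t i)) I"
    using St_R T_bset unfolding inj_on_def stab_St_R by metis
  have fin: "finite (stab ` (carrier H - L))" using finite_carrier by simp
  have "(\<lambda>i. stab (t i)) ` I \<subseteq> stab ` (carrier H - L)" using t by blast
  then have stabs: "(\<lambda>i. stab (t i)) ` I = stab ` (carrier H - L)"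
    using fin inj I card_stabs by (intro card_subset_eq) (simp_all add: card_image)
  have \<sigma>T: "\<sigma> ` T i = T i" if "i \<in> I" for i
    using \<sigma> T(1)[OF that] T_bset[OF that] card_bset[OF t[OF that]] unfolding Gamma1_def by simp
  define r where "r i = inv (t i) \<otimes> \<sigma> (t i)" for i
  have \<sigma>t: "\<sigma> (t i) \<in> bset (t i)" if "i \<in> I" for i
    using \<sigma>T[OF that] t_T[OF that] T_bset[OF that] by blast
  have \<sigma>c: "\<sigma> (t i) \<in> carrier H" if "i \<in> I" for i
    using bset_carrier[OF _ \<sigma>t[OF that]] t[OF that] by blast
  have \<sigma>_shift: "\<sigma> (t i) = t i \<otimes> r i" and rc: "r i \<in> carrier H" if "i \<in> I" for i
    using \<sigma>c[OF that] t[OF that] unfolding r_def by (simp_all add: m_assoc[symmetric])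
  show ?thesis
  proof (rule Schurian_if_compatible_shifts[of I t r])
    show "t i \<in> carrier H - L" if "i \<in> I" for i by (rule t[OF that])
    show "\<exists>i\<in>I. inv (t i) \<otimes> h \<in> L" if h: "h \<in> carrier H - L" for h
    proof -
      have "stab h \<in> (\<lambda>i. stab (t i)) ` I" unfolding stabs using h by blast
      then obtain i where "i \<in> I" "stab (t i) = stab h" by auto
      then show ?thesis using stab_inj[OF t h] by blast
    qed
    show "i = j" if ij: "i \<in> I" "j \<in> I" and l: "inv (t i) \<otimes> t j \<in> L" for i j
    proof -
      have "t j = t i \<otimes> (inv (t i) \<otimes> t j)" using t[OF ij(1)] t[OF ij(2)] by (simp add: m_assoc[symmetric])
      then have "stab (t j) = stab (t i)" using stab_coset[OF t[OF ij(1)] l] by simp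
      then show ?thesis using inj ij unfolding inj_on_def by metis
    qed
    show "r i \<in> stab (t i)" if "i \<in> I" for i
      using bset_stab[OF _ rc[OF that], of "t i"] \<sigma>t[OF that] \<sigma>_shift[OF that] t[OF that] by simp
    show "r i \<noteq> \<one>" if "i \<in> I" for i
    proof
      assume "r i = \<one>"
      then have "\<sigma> (t i) = t i" using \<sigma>_shift[OF that] t[OF that] by simp
      then show False using \<sigma> t[OF that] unfolding Gamma1_def by blast
    qed
    show "t i \<otimes> (r j \<otimes> inv (r i)) \<otimes> inv (t i) \<in> stab (t j \<otimes> inv (t i))"
      if ij: "i \<in> I" "j \<in> I" and "i \<noteq> j" for i j
    proof -
      have c: "t i \<in> carrier H" "t j \<in> carrier H" using t ij by blast+
      have "basic_rel H A (t i) (t j) = basic_rel H A (\<sigma> (t i)) (\<sigma> (t j))"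
        using compat[OF ij] t_T[OF ij(1)] t_T[OF ij(2)] unfolding compatible_def by blast
      then have "bset (t j \<otimes> inv (t i)) = bset (\<sigma> (t j) \<otimes> inv (\<sigma> (t i)))"
        using basic_rel_eq_iff[OF c \<sigma>c[OF ij(1)] \<sigma>c[OF ij(2)]] by blast
      then show ?thesis
        using bset_shift[OF c rc[OF ij(1)] rc[OF ij(2)]] \<sigma>_shift[OF ij(1)] \<sigma>_shift[OF ij(2)] by simp
    qed
  qed
qed

end

theorem theorem3p5:
  fixes p :: nat
    and H :: "('a, 'm) monoid_scheme"
    and A :: "('a \<Rightarrow> rat) set"
    and L :: "'a set"
    and T :: "nat \<Rightarrow> 'a set"
  assumes "Factorial_Ring.prime p" and "odd p"
    and "group H" and "H \<cong> H1 p \<or> H \<cong> H2 p"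
    and "p_S_ring p H A" and "\<not> ga_commutative H A"
    and L: "L = O_theta H A"
    and A: "\<forall>U \<in> Bsets H A - Bsets_in H A L. card U = p"
    and B: "card {St_R H U | U. U \<in> Bsets H A - Bsets_in H A L} = p - 1"
    and "\<forall>i\<in>{1..p-1}. T i \<in> Bsets H A - Bsets_in H A L"
    and "\<forall>i\<in>{1..p-1}. \<forall>j\<in>{1..p-1}. i \<noteq> j \<longrightarrow> St_R H (T i) \<noteq> St_R H (T j)"
  shows "Schurian H A \<longleftrightarrow>
    (\<exists>\<sigma> \<in> Gamma1 p H A L. \<sigma> \<noteq> \<one>\<^bsub>BijGroup (carrier H)\<^esub> \<and>
       (\<forall>i\<in>{1..p-1}. \<forall>j\<in>{1..p-1}. compatible H A \<sigma> (T i) (T j)))"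
proof -
  interpret group H by fact
  have nonabelian: "\<exists>x\<in>carrier H. \<exists>y\<in>carrier H. x \<otimes>\<^bsub>H\<^esub> y \<noteq> y \<otimes>\<^bsub>H\<^esub> x"
    using ga_commutative_if_commutative[of A] \<open>\<not> ga_commutative H A\<close> by blast
  obtain e a b c where "nonabelian_heisenberg H p e a b c"
    using nonabelian_heisenberg_if_iso[OF assms(1) \<open>group H\<close> assms(4) nonabelian] by blast
  then interpret G: nonabelian_heisenberg H p e a b c .
  have p: "p > 0" using prime_gt_0_nat[OF assms(1)] .
  have "finite (carrier H)" using G.order_p3 p order_gt_0_iff_finite by simp
  then interpret s_ring H A
    using \<open>p_S_ring p H A\<close> by unfold_locales (simp_all add: p_S_ring_def)
  have outside: "bset h \<in> Bsets H A - Bsets_in H A L" if "h \<in> carrier H - L" for h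
    using that bset_in_Bsets self_in_bset by (auto simp: Bsets_in_def)
  have outside_ex: "\<exists>h\<in>carrier H - L. U = bset h" if U: "U \<in> Bsets H A - Bsets_in H A L" for U
  proof -
    obtain h where "h \<in> U" "h \<notin> L" using U by (auto simp: Bsets_in_def)
    then show ?thesis using U Bsets_subset[of U] bset_eqI[of U h] by blast
  qed
  have stabs: "{St_R H U | U. U \<in> Bsets H A - Bsets_in H A L} = stab ` (carrier H - L)"
  proof
    show "{St_R H U | U. U \<in> Bsets H A - Bsets_in H A L} \<subseteq> stab ` (carrier H - L)"
    proof
      fix S assume "S \<in> {St_R H U | U. U \<in> Bsets H A - Bsets_in H A L}"
      then obtain U where U: "U \<in> Bsets H A - Bsets_in H A L" "S = St_R H U" by blast
      obtain h where h: "h \<in> carrier H - L" "U = bset h" using outside_ex[OF U(1)] by blast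
      show "S \<in> stab ` (carrier H - L)" unfolding U(2) h(2) stab_St_R[symmetric] using h(1) by (rule imageI)
    qed
    show "stab ` (carrier H - L) \<subseteq> {St_R H U | U. U \<in> Bsets H A - Bsets_in H A L}"
    proof (rule image_subsetI)
      fix h assume "h \<in> carrier H - L"
      from outside[OF this] show "stab h \<in> {St_R H U | U. U \<in> Bsets H A - Bsets_in H A L}"
        unfolding stab_St_R by blast
    qed
  qed
  interpret separated_s_ring H A p L
  proof unfold_locales
    show "Factorial_Ring.prime p" "odd p" "L = O_theta H A" by fact+
    show "order H = p ^ 3" by (rule G.order_p3)
    show "\<exists>k. card (bset h) = p ^ k" if "h \<in> carrier H" for h
      using \<open>p_S_ring p H A\<close> bset_in_Bsets[OF that] by (simp add: p_S_ring_def)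
    show "card (bset h) = p" if "h \<in> carrier H - L" for h using A outside[OF that] by blast
    show "card (stab ` (carrier H - L)) = p - 1" using B unfolding stabs .
  qed (fact G.subgroup_p2_normal G.subgroup_p2_commutative)+
  show ?thesis
  proof
    assume "Schurian H A"
    then obtain \<sigma> where \<sigma>: "\<sigma> \<in> Gamma1 p H A L" "\<sigma> \<noteq> \<one>\<^bsub>BijGroup (carrier H)\<^esub>"
      and rel: "\<forall>\<beta>\<in>carrier H. \<forall>\<gamma>\<in>carrier H. basic_rel H A \<beta> \<gamma> = basic_rel H A (\<sigma> \<beta>) (\<sigma> \<gamma>)"
      using Schurian_imp_ex_Gamma1 by blast
    have "T i \<subseteq> carrier H" if "i \<in> {1..p-1}" for i
      using assms(10) that by (intro Bsets_subset) blast
    then have "compatible H A \<sigma> (T i) (T j)" if "i \<in> {1..p-1}" "j \<in> {1..p-1}" for i j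
      using rel that unfolding compatible_def by (meson subsetD)
    then show "\<exists>\<sigma> \<in> Gamma1 p H A L. \<sigma> \<noteq> \<one>\<^bsub>BijGroup (carrier H)\<^esub> \<and>
       (\<forall>i\<in>{1..p-1}. \<forall>j\<in>{1..p-1}. compatible H A \<sigma> (T i) (T j))"
      using \<sigma> by blast
  next
    assume "\<exists>\<sigma> \<in> Gamma1 p H A L. \<sigma> \<noteq> \<one>\<^bsub>BijGroup (carrier H)\<^esub> \<and>
       (\<forall>i\<in>{1..p-1}. \<forall>j\<in>{1..p-1}. compatible H A \<sigma> (T i) (T j))"
    then obtain \<sigma> where \<sigma>: "\<sigma> \<in> Gamma1 p H A L"
      and compat: "\<forall>i\<in>{1..p-1}. \<forall>j\<in>{1..p-1}. compatible H A \<sigma> (T i) (T j)" by blast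
    show "Schurian H A"
    proof (rule Schurian_if_Gamma1[OF \<sigma>, of "{1..p-1}" T])
      show "card {1..p-1} = p - 1" by simp
      show "T i \<in> Bsets H A" "\<not> T i \<subseteq> L" if "i \<in> {1..p-1}" for i
        using assms(10) that by (auto simp: Bsets_in_def)
      show "St_R H (T i) \<noteq> St_R H (T j)" if "i \<in> {1..p-1}" "j \<in> {1..p-1}" "i \<noteq> j" for i j
        using assms(11) that by blast
      show "compatible H A \<sigma> (T i) (T j)" if "i \<in> {1..p-1}" "j \<in> {1..p-1}" for i j
        using compat that by blast
    qed
  qed
qed

end
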